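(* Let $\delta>2$ be an integer and let $G$ be a $2$-connected multigraph. Then the following are equivalent: (1) $G$ satisfies $(\spadesuit)_\delta$; (2) $G$ can be obtained from $\delta$-cycles $C_\delta$ by (repeated) applications of Construction A, Construction B and Construction C (all with parameter $\delta$), i.e. $G$ belongs to the smallest class of multigraphs containing $C_\delta$ and closed under these three constructions.
   Context: Multigraphs are finite, undirected, loop-free, and may have parallel edges. $C_\delta$ is the cycle with $\delta$ vertices and $\delta$ edges. For a multigraph $G=(V,E)$ and $S\subseteq V$, $E(S)$ denotes the set of edges with both endpoints in $S$, $G|_S$ the induced sub-multigraph on $S$, and $G/E(S)$ the result of contracting $E(S)$. A good flat of a $2$-connected multigraph $G=(V,E)$ is a subset $S\subsetneq V$ such that both $G|_S$ and $G/E(S)$ are $2$-connected. Weight function: for a $2$-connected multigraph $G=(V,E)$, $w\colon E\to\{1,\delta-1\}$ is given by $w(e)=1$ if $G\setminus e$ (deletion) is $2$-connected and $w(e)=\delta-1$ if $G/e$ (contraction) is $2$-connected; $w(F)=\sum_{e\in F}w(e)$. $G$ satisfies $(\spadesuit)_\delta$ if it possesses such a weight function and (1) $w(E)=\delta(|V|-1)$ and (2) $w(E(S))+1=\delta(|S|-1)$ for every good flat $S$. Construction A: given $2$-connected multigraphs $G_1,G_2$ and edges $e_1$ of $G_1$ with $w(e_1)=1$ and $e_2$ of $G_2$ with $w(e_2)=\delta-1$ (weights in the respective graphs), take the disjoint union, identify the endpoints of $e_1$ with those of $e_2$ (so that $e_1,e_2$ become one glued edge), and delete the glued edge. Construction B: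 given $2$-connected multigraphs $G_1,G_2$ and edges $e_1$ of $G_1$, $e_2$ of $G_2$ with $w(e_1)=w(e_2)=\delta-1$, take the disjoint union, identify the endpoints of $e_1$ with those of $e_2$, and replace the glued edge by $\delta-2$ parallel edges. Construction C: given a $2$-connected multigraph $G$ with vertices $v_1,v_2$ joined by a path of $\delta-1$ edges whose interior vertices all have degree $2$, replace this path by a single edge between $v_1$ and $v_2$. *)

theory Defs
  imports Main
begin

text \<open>
  The endpoints of an edge form a set of one (loop) or two vertices. Loops are tolerated in the raw
  record because contracting one of several parallel edges creates them; the predicate
  \<open>multigraph\<close> excludes them.
\<close>

record ('v, 'e) pre_multigraph =
  verts :: "'v set"
  edges :: "'e set"
  ends :: "'e \<Rightarrow> 'v set"

definition multigraph :: "('v, 'e) pre_multigraph \<Rightarrow> bool" where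
  "multigraph G \<longleftrightarrow> finite (verts G) \<and> finite (edges G) \<and>
     (\<forall>e\<in>edges G. ends G e \<subseteq> verts G \<and> card (ends G e) = 2)"

definition multigraph_iso ::
  "('v, 'e) pre_multigraph \<Rightarrow> ('w, 'f) pre_multigraph \<Rightarrow> bool" (infix \<open>\<simeq>\<^sub>m\<close> 50) where
  "G \<simeq>\<^sub>m H \<longleftrightarrow> (\<exists>f g. bij_betw f (verts G) (verts H) \<and> bij_betw g (edges G) (edges H) \<and>
     (\<forall>e\<in>edges G. ends H (g e) = f ` ends G e))"

definition degree :: "('v, 'e) pre_multigraph \<Rightarrow> 'v \<Rightarrow> nat" where
  "degree G v = card {e \<in> edges G. v \<in> ends G e}"

definition edges_within :: "('v, 'e) pre_multigraph \<Rightarrow> 'v set \<Rightarrow> 'e set" where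
  "edges_within G S = {e \<in> edges G. ends G e \<subseteq> S}"

definition induced :: "('v, 'e) pre_multigraph \<Rightarrow> 'v set \<Rightarrow> ('v, 'e) pre_multigraph" where
  "induced G S = \<lparr>verts = S, edges = edges_within G S, ends = ends G\<rparr>"

definition delete_edges :: "('v, 'e) pre_multigraph \<Rightarrow> 'e set \<Rightarrow> ('v, 'e) pre_multigraph" where
  "delete_edges G F = \<lparr>verts = verts G, edges = edges G - F, ends = ends G\<rparr>"

definition adjacency :: "('v, 'e) pre_multigraph \<Rightarrow> 'e set \<Rightarrow> ('v \<times> 'v) set" where
  "adjacency G F = {(u, v). \<exists>e\<in>F. ends G e = {u, v}}"

text \<open>The vertices of the contraction are the connected components of the graph
  \<open>(verts G, F)\<close>.\<close>

definition contract :: "('v, 'e) pre_multigraph \<Rightarrow> 'e set \<Rightarrow> ('v set, 'e) pre_multigraph" where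
  "contract G F =
     (let cls = (\<lambda>v. (adjacency G F)\<^sup>* `` {v})
      in \<lparr>verts = cls ` verts G, edges = edges G - F, ends = (\<lambda>e. cls ` ends G e)\<rparr>)"

definition connected_multigraph :: "('v, 'e) pre_multigraph \<Rightarrow> bool" where
  "connected_multigraph G \<longleftrightarrow> verts G \<noteq> {} \<and>
     (\<forall>u\<in>verts G. \<forall>v\<in>verts G. (u, v) \<in> (adjacency G (edges G))\<^sup>*)"

text \<open>
  Neither a cut vertex nor a bridge. With at least three vertices the absence of bridges follows
  from the absence of cut vertices. With two vertices it demands at least two parallel edges: the
  digon is 2-connected, a single edge and a single vertex are not.
\<close>

definition two_connected :: "('v, 'e) pre_multigraph \<Rightarrow> bool" where
  "two_connected G \<longleftrightarrow> multigraph G \<and> 2 \<le> card (verts G) \<and> connected_multigraph G \<and>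
     (\<forall>v\<in>verts G. connected_multigraph (induced G (verts G - {v}))) \<and>
     (\<forall>e\<in>edges G. connected_multigraph (delete_edges G {e}))"

definition good_flat :: "('v, 'e) pre_multigraph \<Rightarrow> 'v set \<Rightarrow> bool" where
  "good_flat G S \<longleftrightarrow> S \<subset> verts G \<and> two_connected (induced G S) \<and>
     two_connected (contract G (edges_within G S))"

definition weight_function :: "nat \<Rightarrow> ('v, 'e) pre_multigraph \<Rightarrow> ('e \<Rightarrow> nat) \<Rightarrow> bool" where
  "weight_function \<delta> G w \<longleftrightarrow> (\<forall>e\<in>edges G. w e \<in> {1, \<delta> - 1} \<and>
     (two_connected (delete_edges G {e}) \<longrightarrow> w e = 1) \<and>
     (two_connected (contract G {e}) \<longrightarrow> w e = \<delta> - 1))"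

definition spade :: "nat \<Rightarrow> ('v, 'e) pre_multigraph \<Rightarrow> bool" where
  "spade \<delta> G \<longleftrightarrow> (\<exists>w. weight_function \<delta> G w \<and>
     (\<Sum>e\<in>edges G. w e) = \<delta> * (card (verts G) - 1) \<and>
     (\<forall>S. good_flat G S \<longrightarrow> (\<Sum>e\<in>edges_within G S. w e) + 1 = \<delta> * (card S - 1)))"

definition cycle_multigraph :: "nat \<Rightarrow> (nat, nat) pre_multigraph" where
  "cycle_multigraph n = \<lparr>verts = {..<n}, edges = {..<n}, ends = (\<lambda>i. {i, Suc i mod n})\<rparr>"

definition disjoint_union ::
  "('v, 'e) pre_multigraph \<Rightarrow> ('w, 'f) pre_multigraph \<Rightarrow> ('v + 'w, 'e + 'f) pre_multigraph" where
  "disjoint_union G H =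
     \<lparr>verts = Inl ` verts G \<union> Inr ` verts H,
      edges = Inl ` edges G \<union> Inr ` edges H,
      ends = case_sum (\<lambda>e. Inl ` ends G e) (\<lambda>f. Inr ` ends H f)\<rparr>"

definition identify_vertices ::
  "('v \<Rightarrow> 'w) \<Rightarrow> ('v, 'e) pre_multigraph \<Rightarrow> ('w, 'e) pre_multigraph" where
  "identify_vertices f G =
     \<lparr>verts = f ` verts G, edges = edges G, ends = (\<lambda>e. f ` ends G e)\<rparr>"

definition add_parallel_edges ::
  "nat \<Rightarrow> 'v \<Rightarrow> 'v \<Rightarrow> ('v, 'e) pre_multigraph \<Rightarrow> ('v, 'e + nat) pre_multigraph" where
  "add_parallel_edges k x y G =
     \<lparr>verts = verts G, edges = Inl ` edges G \<union> Inr ` {..<k},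
      ends = case_sum (ends G) (\<lambda>_. {x, y})\<rparr>"

text \<open>Disjoint union with \<open>x\<^sub>2\<close> identified with \<open>x\<^sub>1\<close> and \<open>y\<^sub>2\<close> with \<open>y\<^sub>1\<close>.\<close>

definition glue ::
  "('v, 'e) pre_multigraph \<Rightarrow> 'v \<Rightarrow> 'v \<Rightarrow> ('w, 'f) pre_multigraph \<Rightarrow> 'w \<Rightarrow> 'w \<Rightarrow>
   ('v + 'w, 'e + 'f) pre_multigraph" where
  "glue G\<^sub>1 x\<^sub>1 y\<^sub>1 G\<^sub>2 x\<^sub>2 y\<^sub>2 =
     identify_vertices (id(Inr x\<^sub>2 := Inl x\<^sub>1, Inr y\<^sub>2 := Inl y\<^sub>1)) (disjoint_union G\<^sub>1 G\<^sub>2)"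

definition has_weight :: "nat \<Rightarrow> ('v, 'e) pre_multigraph \<Rightarrow> 'e \<Rightarrow> nat \<Rightarrow> bool" where
  "has_weight \<delta> G e k \<longleftrightarrow> (\<exists>w. weight_function \<delta> G w \<and> w e = k)"

text \<open>Both copies \<open>Inl e\<^sub>1\<close> and \<open>Inr e\<^sub>2\<close> of the glued edge are removed. The order in which the
  endpoints are named is free, so both ways of gluing the edges are covered.\<close>

definition construction_A ::
  "nat \<Rightarrow> ('v, 'e) pre_multigraph \<Rightarrow> ('w, 'f) pre_multigraph \<Rightarrow>
   ('v + 'w, 'e + 'f) pre_multigraph \<Rightarrow> bool" where
  "construction_A \<delta> G\<^sub>1 G\<^sub>2 H \<longleftrightarrow> two_connected G\<^sub>1 \<and> two_connected G\<^sub>2 \<and>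
     (\<exists>e\<^sub>1\<in>edges G\<^sub>1. \<exists>e\<^sub>2\<in>edges G\<^sub>2. \<exists>x\<^sub>1 y\<^sub>1 x\<^sub>2 y\<^sub>2.
        has_weight \<delta> G\<^sub>1 e\<^sub>1 1 \<and> has_weight \<delta> G\<^sub>2 e\<^sub>2 (\<delta> - 1) \<and>
        ends G\<^sub>1 e\<^sub>1 = {x\<^sub>1, y\<^sub>1} \<and> ends G\<^sub>2 e\<^sub>2 = {x\<^sub>2, y\<^sub>2} \<and>
        H = delete_edges (glue G\<^sub>1 x\<^sub>1 y\<^sub>1 G\<^sub>2 x\<^sub>2 y\<^sub>2) {Inl e\<^sub>1, Inr e\<^sub>2})"

definition construction_B ::
  "nat \<Rightarrow> ('v, 'e) pre_multigraph \<Rightarrow> ('w, 'f) pre_multigraph \<Rightarrow>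
   ('v + 'w, ('e + 'f) + nat) pre_multigraph \<Rightarrow> bool" where
  "construction_B \<delta> G\<^sub>1 G\<^sub>2 H \<longleftrightarrow> two_connected G\<^sub>1 \<and> two_connected G\<^sub>2 \<and>
     (\<exists>e\<^sub>1\<in>edges G\<^sub>1. \<exists>e\<^sub>2\<in>edges G\<^sub>2. \<exists>x\<^sub>1 y\<^sub>1 x\<^sub>2 y\<^sub>2.
        has_weight \<delta> G\<^sub>1 e\<^sub>1 (\<delta> - 1) \<and> has_weight \<delta> G\<^sub>2 e\<^sub>2 (\<delta> - 1) \<and>
        ends G\<^sub>1 e\<^sub>1 = {x\<^sub>1, y\<^sub>1} \<and> ends G\<^sub>2 e\<^sub>2 = {x\<^sub>2, y\<^sub>2} \<and>
        H = add_parallel_edges (\<delta> - 2) (Inl x\<^sub>1) (Inl y\<^sub>1)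
              (delete_edges (glue G\<^sub>1 x\<^sub>1 y\<^sub>1 G\<^sub>2 x\<^sub>2 y\<^sub>2) {Inl e\<^sub>1, Inr e\<^sub>2}))"

definition is_path :: "('v, 'e) pre_multigraph \<Rightarrow> 'v list \<Rightarrow> 'e list \<Rightarrow> bool" where
  "is_path G vs es \<longleftrightarrow> length vs = Suc (length es) \<and> distinct vs \<and> set vs \<subseteq> verts G \<and>
     set es \<subseteq> edges G \<and> (\<forall>i<length es. ends G (es ! i) = {vs ! i, vs ! Suc i})"

definition construction_C ::
  "nat \<Rightarrow> ('v, 'e) pre_multigraph \<Rightarrow> ('v, 'e + nat) pre_multigraph \<Rightarrow> bool" where
  "construction_C \<delta> G H \<longleftrightarrow> two_connected G \<and>
     (\<exists>vs es. is_path G vs es \<and> length es = \<delta> - 1 \<and>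
        (let interior = set vs - {hd vs, last vs}
         in (\<forall>v\<in>interior. degree G v = 2) \<and>
            H = add_parallel_edges 1 (hd vs) (last vs)
                  (delete_edges (induced G (verts G - interior)) (set es))))"

text \<open>
  The smallest class, closed under isomorphism, that contains the \<open>\<delta>\<close>-cycle and is closed under the
  three constructions. Vertices and edges are natural numbers so that every finite multigraph has
  an isomorphic copy in the type.
\<close>

inductive constructible :: "nat \<Rightarrow> (nat, nat) pre_multigraph \<Rightarrow> bool" for \<delta> :: nat where
  cycle: "G \<simeq>\<^sub>m cycle_multigraph \<delta> \<Longrightarrow> constructible \<delta> G"
| A: "constructible \<delta> G\<^sub>1 \<Longrightarrow> constructible \<delta> G\<^sub>2 \<Longrightarrow> construction_A \<delta> G\<^sub>1 G\<^sub>2 H \<Longrightarrow> G \<simeq>\<^sub>m H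
     \<Longrightarrow> constructible \<delta> G"
| B: "constructible \<delta> G\<^sub>1 \<Longrightarrow> constructible \<delta> G\<^sub>2 \<Longrightarrow> construction_B \<delta> G\<^sub>1 G\<^sub>2 H \<Longrightarrow> G \<simeq>\<^sub>m H
     \<Longrightarrow> constructible \<delta> G"
| C: "constructible \<delta> G\<^sub>1 \<Longrightarrow> construction_C \<delta> G\<^sub>1 H \<Longrightarrow> G \<simeq>\<^sub>m H \<Longrightarrow> constructible \<delta> G"

definition obtainable_from_cycles :: "nat \<Rightarrow> ('v, 'e) pre_multigraph \<Rightarrow> bool" where
  "obtainable_from_cycles \<delta> G \<longleftrightarrow> (\<exists>H. constructible \<delta> H \<and> G \<simeq>\<^sub>m H)"

end

theory Submission
  imports Defs
begin

text \<open>
  A weight function whose total and whose good flats satisfy the two equations of the spade property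
  is called balanced. Suppose a two-connected graph \<open>G\<close> with balanced weights has at least three
  vertices. If \<open>G - x\<close> is two-connected for all \<open>x\<close>, then all these sets are good flats and counting
  weights around the vertices leaves only three vertices. Otherwise a two-vertex cut exists, and \<open>G\<close> is
  a cycle or contains a proper two-connected induced subgraph attached to the rest at only two
  vertices; a maximal one is a good flat. Replacing either side of such a flat by a virtual edge, of
  weight \<open>1\<close> inside and \<open>\<delta> - 1\<close> outside, gives two smaller balanced graphs of which \<open>G\<close> is the result
  under construction A. So by induction \<open>G\<close> arises by construction A from \<open>\<delta>\<close>-cycles, digons and bonds
  of \<open>\<delta>\<close> parallel edges; digons and bonds come from constructions C and B.

  Conversely, the good flats and the deletable and contractible edges of a 2-sum are determined by
  those of its two summands, so construction A preserves the spade property. Construction B is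
  construction A applied twice to a bond. For construction C, every block in a cyclic chain of blocks has weight one
  less than \<open>\<delta>\<close> times its rank, so that the chain has exactly \<open>\<delta>\<close> blocks; hence the complement of
  the path is a good flat or a single edge, and construction C undoes construction A with a \<open>\<delta>\<close>-cycle.
\<close>

section \<open>Connectivity of vertex sets\<close>

text \<open>The constants come from the rank, the number of vertices minus one. The ranks of the two
  sides of a two-separation exceed that of the graph by one in total, so the two virtual weights
  must sum to \<delta>; a good flat misses \<delta> times its rank by 1, hence 1 inside and \<delta>
  - 1 outside. Counting around the vertices gives n = 2 + 2/(\<delta> - 1), at most 3 as \<delta> >
  2. In a cyclic chain of k blocks on n vertices the ranks sum to n, so the weight is \<delta> * n -
  k, which equals \<delta> * (n - 1) only for k = \<delta>.

  The obstacle is the digon: neither edge is deletable or contractible, so weight functions are not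
  unique there. With at least three edges every edge is deletable or contractible, and its weight is
  forced. Hence a weight prescribed by a construction is either the balanced one or sits in a digon,
  where it can be chosen. For the same reason the decomposition must prove, along with
  constructibility, that balanced weights form a weight function: construction A asks for this at
  the virtual edges.\<close>

definition adj :: "('v, 'e) pre_multigraph \<Rightarrow> 'v \<Rightarrow> 'v \<Rightarrow> bool" where
  "adj G u v \<longleftrightarrow> (\<exists>e\<in>edges G. ends G e = {u, v})"

text \<open>Closed sets replace walks: to use connectivity it is enough to exhibit a nonempty set
  that no edge inside \<open>X\<close> leaves. Working with vertex sets of one fixed
  \<open>G\<close> avoids forming induced subgraphs.\<close>

definition conn :: "('v, 'e) pre_multigraph \<Rightarrow> 'v set \<Rightarrow> bool" where
  "conn G X \<longleftrightarrow> X \<noteq> {} \<and>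
     (\<forall>C. C \<subseteq> X \<and> C \<noteq> {} \<and> (\<forall>a\<in>C. \<forall>b\<in>X. adj G a b \<longrightarrow> b \<in> C) \<longrightarrow> C = X)"

lemma adj_commute: "adj G u v \<longleftrightarrow> adj G v u"
  by (auto simp: adj_def insert_commute)

lemma connI:
  assumes "X \<noteq> {}"
    and "\<And>C. C \<subseteq> X \<Longrightarrow> C \<noteq> {} \<Longrightarrow> (\<And>a b. a \<in> C \<Longrightarrow> b \<in> X \<Longrightarrow> adj G a b \<Longrightarrow> b \<in> C) \<Longrightarrow> X \<subseteq> C"
  shows "conn G X"
  using assms unfolding conn_def by (metis subset_antisym)

lemma connD:
  assumes "conn G X" "C \<subseteq> X" "C \<noteq> {}" "\<And>a b. a \<in> C \<Longrightarrow> b \<in> X \<Longrightarrow> adj G a b \<Longrightarrow> b \<in> C"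
  shows "C = X"
  using assms unfolding conn_def by metis

lemma conn_nonempty: "conn G X \<Longrightarrow> X \<noteq> {}"
  by (simp add: conn_def)

lemma conn_singleton [simp]: "conn G {x}"
  by (auto simp: conn_def)

lemma conn_mono:
  assumes "conn G X" "\<And>a b. a \<in> X \<Longrightarrow> b \<in> X \<Longrightarrow> adj G a b \<Longrightarrow> adj H a b"
  shows "conn H X"
proof (rule connI)
  fix C assume "C \<subseteq> X" "C \<noteq> {}" "\<And>a b. a \<in> C \<Longrightarrow> b \<in> X \<Longrightarrow> adj H a b \<Longrightarrow> b \<in> C"
  then have "C = X" by (intro connD[OF assms(1)]) (use assms(2) in auto)
  then show "X \<subseteq> C" by simp
qed (rule conn_nonempty[OF assms(1)])

lemma conn_cong:
  assumes "\<And>a b. a \<in> X \<Longrightarrow> b \<in> X \<Longrightarrow> adj G a b \<longleftrightarrow> adj H a b"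
  shows "conn G X \<longleftrightarrow> conn H X"
  using assms conn_mono[of G X H] conn_mono[of H X G] by blast

text \<open>The trace on \<open>X\<close> of a set closed in the larger \<open>Y\<close> is closed
  in \<open>X\<close>, so it is everything or empty.\<close>

lemma conn_dichotomy:
  assumes "conn G X" "X \<subseteq> Y" "\<And>a b. a \<in> C \<Longrightarrow> b \<in> Y \<Longrightarrow> adj G a b \<Longrightarrow> b \<in> C"
  shows "X \<subseteq> C \<or> X \<inter> C = {}"
  using connD[OF assms(1), of "X \<inter> C"] assms(2,3) by blast

lemma conn_Un:
  assumes "conn G X" "conn G Y" "X \<inter> Y \<noteq> {}"
  shows "conn G (X \<union> Y)"
proof (rule connI)
  fix C assume C: "C \<subseteq> X \<union> Y" "C \<noteq> {}" "\<And>a b. a \<in> C \<Longrightarrow> b \<in> X \<union> Y \<Longrightarrow> adj G a b \<Longrightarrow> b \<in> C"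
  have "X \<subseteq> C \<or> X \<inter> C = {}" "Y \<subseteq> C \<or> Y \<inter> C = {}"
    using conn_dichotomy[OF assms(1), of "X \<union> Y" C] conn_dichotomy[OF assms(2), of "X \<union> Y" C] C(3)
    by blast+
  then show "X \<union> Y \<subseteq> C" using assms(3) C(1,2) by blast
qed (use assms in \<open>auto simp: conn_def\<close>)

lemma not_connE:
  assumes "\<not> conn G X" "X \<noteq> {}"
  obtains A B where "A \<union> B = X" "A \<inter> B = {}" "A \<noteq> {}" "B \<noteq> {}"
    "\<forall>a\<in>A. \<forall>b\<in>B. \<not> adj G a b \<and> \<not> adj G b a"
proof -
  from assms obtain C where C: "C \<subseteq> X" "C \<noteq> {}" "C \<noteq> X" "\<forall>a\<in>C. \<forall>b\<in>X. adj G a b \<longrightarrow> b \<in> C"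
    unfolding conn_def by blast
  show thesis
    by (rule that[of C "X - C"]) (use C adj_commute[of G] in auto)
qed

text \<open>Preimages of closed sets are closed. Allowing \<open>h a = h b\<close> covers maps that
  collapse edges, such as the quotient map of a contraction.\<close>

lemma conn_image:
  assumes "conn G X" "\<And>a b. a \<in> X \<Longrightarrow> b \<in> X \<Longrightarrow> adj G a b \<Longrightarrow> h a = h b \<or> adj H (h a) (h b)"
  shows "conn H (h ` X)"
proof (rule connI)
  fix C assume C: "C \<subseteq> h ` X" "C \<noteq> {}" "\<And>a b. a \<in> C \<Longrightarrow> b \<in> h ` X \<Longrightarrow> adj H a b \<Longrightarrow> b \<in> C"
  have "{a \<in> X. h a \<in> C} = X"
    by (rule connD[OF assms(1)]) (use C assms(2) in auto, metis imageI)
  then show "h ` X \<subseteq> C" by blast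
qed (use assms(1) in \<open>auto simp: conn_def\<close>)

lemma conn_edge:
  assumes "adj G a b"
  shows "conn G {a, b}"
proof (rule connI)
  fix C assume C: "C \<subseteq> {a, b}" "C \<noteq> {}" "\<And>p q. p \<in> C \<Longrightarrow> q \<in> {a, b} \<Longrightarrow> adj G p q \<Longrightarrow> q \<in> C"
  then have "a \<in> C \<or> b \<in> C" by blast
  then show "{a, b} \<subseteq> C" using C(3)[of a b] C(3)[of b a] assms adj_commute[of G a b] by auto
qed simp

lemma conn_path:
  assumes "xs \<noteq> []" "\<And>i. Suc i < length xs \<Longrightarrow> adj G (xs ! i) (xs ! Suc i)"
  shows "conn G (set xs)"
  using assms
proof (induction xs)
  case (Cons a xs)
  show ?case
  proof (cases "xs = []")
    case False
    have *: "conn G (set xs)"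
    proof (rule Cons.IH)
      show "adj G (xs ! i) (xs ! Suc i)" if "Suc i < length xs" for i
        using Cons.prems(2)[of "Suc i"] that by simp
    qed (rule False)
    have "adj G a (hd xs)" using Cons.prems(2)[of 0] False by (simp add: hd_conv_nth)
    then have "conn G {a, hd xs}" by (rule conn_edge)
    from conn_Un[OF this *] False show ?thesis by (auto simp: insert_absorb)
  qed simp
qed simp

lemma connected_multigraph_iff_conn:
  assumes "\<And>e. e \<in> edges G \<Longrightarrow> ends G e \<subseteq> verts G"
  shows "connected_multigraph G \<longleftrightarrow> conn G (verts G)"
proof
  assume L: "connected_multigraph G"
  show "conn G (verts G)"
  proof (rule connI)
    fix C assume C: "C \<subseteq> verts G" "C \<noteq> {}" 
      "\<And>a b. a \<in> C \<Longrightarrow> b \<in> verts G \<Longrightarrow> adj G a b \<Longrightarrow> b \<in> C"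
    then obtain c where c: "c \<in> C" by blast
    have "v \<in> C" if "(c, v) \<in> (adjacency G (edges G))\<^sup>*" for v
      using that
    proof (induction rule: rtrancl_induct)
      case (step y z)
      then have "adj G y z" "z \<in> verts G"
        using assms by (auto simp: adjacency_def adj_def)
      with step C(3) show ?case by blast
    qed (rule c)
    then show "verts G \<subseteq> C" using L c C(1) unfolding connected_multigraph_def by blast
  qed (use L in \<open>auto simp: connected_multigraph_def\<close>)
next
  assume R: "conn G (verts G)"
  have "(u, v) \<in> (adjacency G (edges G))\<^sup>*" if "u \<in> verts G" "v \<in> verts G" for u v
  proof -
    have "{v \<in> verts G. (u, v) \<in> (adjacency G (edges G))\<^sup>*} = verts G"
    proof (rule connD[OF R])
      fix a b assume "a \<in> {v \<in> verts G. (u, v) \<in> (adjacency G (edges G))\<^sup>*}" "b \<in> verts G" "adj G a b"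
      moreover from \<open>adj G a b\<close> have "(a, b) \<in> adjacency G (edges G)"
        by (auto simp: adj_def adjacency_def)
      ultimately show "b \<in> {v \<in> verts G. (u, v) \<in> (adjacency G (edges G))\<^sup>*}"
        by (auto intro: rtrancl_into_rtrancl)
    qed (use that in auto)
    then show ?thesis using that by blast
  qed
  then show "connected_multigraph G"
    using R by (auto simp: connected_multigraph_def conn_def)
qed

section \<open>Induced subgraphs and edge deletion\<close>

lemma verts_induced [simp]: "verts (induced G S) = S"
  and edges_induced [simp]: "edges (induced G S) = edges_within G S"
  and ends_induced [simp]: "ends (induced G S) = ends G"
  by (simp_all add: induced_def)

lemma verts_delete_edges [simp]: "verts (delete_edges G F) = verts G"
  and edges_delete_edges [simp]: "edges (delete_edges G F) = edges G - F"
  and ends_delete_edges [simp]: "ends (delete_edges G F) = ends G"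
  by (simp_all add: delete_edges_def)

lemma adj_induced: "adj (induced G S) u v \<longleftrightarrow> adj G u v \<and> u \<in> S \<and> v \<in> S"
  by (auto simp: adj_def edges_within_def)

lemma conn_induced: "X \<subseteq> S \<Longrightarrow> conn (induced G S) X \<longleftrightarrow> conn G X"
  by (rule conn_cong) (auto simp: adj_induced)

lemma multigraph_ends:
  assumes "multigraph G" "e \<in> edges G"
  obtains a b where "ends G e = {a, b}" "a \<noteq> b" "a \<in> verts G" "b \<in> verts G"
  using assms unfolding multigraph_def by (metis card_2_iff insert_subset)

lemma multigraph_induced: "multigraph G \<Longrightarrow> S \<subseteq> verts G \<Longrightarrow> multigraph (induced G S)"
  by (auto simp: multigraph_def edges_within_def intro: finite_subset)

lemma multigraph_delete_edges: "multigraph G \<Longrightarrow> multigraph (delete_edges G F)"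
  by (auto simp: multigraph_def)

lemma adj_verts: "multigraph G \<Longrightarrow> adj G a b \<Longrightarrow> a \<in> verts G \<and> b \<in> verts G \<and> a \<noteq> b"
  by (auto simp: adj_def elim!: multigraph_ends) (auto simp: doubleton_eq_iff)

lemma multigraph_conn: "multigraph G \<Longrightarrow> connected_multigraph G \<longleftrightarrow> conn G (verts G)"
  by (rule connected_multigraph_iff_conn) (auto simp: multigraph_def)

lemma connected_induced:
  "multigraph G \<Longrightarrow> S \<subseteq> verts G \<Longrightarrow> connected_multigraph (induced G S) \<longleftrightarrow> conn G S"
  by (simp add: multigraph_conn multigraph_induced conn_induced)

section \<open>Two-connectedness through connected vertex sets\<close>

lemma two_connected_multigraph: "two_connected G \<Longrightarrow> multigraph G"
  by (simp add: two_connected_def)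

lemma two_connected_card: "two_connected G \<Longrightarrow> 2 \<le> card (verts G)"
  by (simp add: two_connected_def)

lemma two_connected_conn_remove:
  "two_connected G \<Longrightarrow> v \<in> verts G \<Longrightarrow> conn G (verts G - {v})"
  using connected_induced[of G "verts G - {v}"] by (auto simp: two_connected_def)

lemma two_connected_conn_delete:
  "two_connected G \<Longrightarrow> e \<in> edges G \<Longrightarrow> conn (delete_edges G {e}) (verts G)"
  using multigraph_conn[OF multigraph_delete_edges, of G "{e}"] by (auto simp: two_connected_def)

lemma two_connected_conn: "two_connected G \<Longrightarrow> conn G (verts G)"
  using multigraph_conn by (auto simp: two_connected_def)

lemma two_connected_finite:
  "two_connected G \<Longrightarrow> finite (verts G)" "two_connected G \<Longrightarrow> finite (edges G)"
  by (auto simp: two_connected_def multigraph_def)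

text \<open>Connectivity of two or more vertices yields one edge; since that edge is no bridge, the
  same argument yields another after deleting it.\<close>

lemma two_connected_card_edges:
  assumes "two_connected G"
  shows "2 \<le> card (edges G)"
proof -
  from assms have c: "conn G (verts G)" "2 \<le> card (verts G)"
    using two_connected_conn two_connected_card by blast+
  then obtain a where a: "a \<in> verts G" "{a} \<noteq> verts G"
    by (metis Suc_1 all_not_in_conv card.empty card_1_singleton_iff not_less_eq_eq One_nat_def
        le_zero_eq nat.distinct(1) order_refl)
  have ex: "\<exists>e\<in>edges H. True" if "conn H (verts G)" for H :: "('a,'b) pre_multigraph"
  proof (rule ccontr)
    assume "\<not> ?thesis"
    then have "{a} = verts G" by (intro connD[OF that]) (use a in \<open>auto simp: adj_def\<close>)
    with a show False by simp
  qed
  from ex[OF c(1)] obtain e where e: "e \<in> edges G" by blast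
  from ex[OF two_connected_conn_delete[OF assms e]] obtain f where "f \<in> edges G" "f \<noteq> e" by auto
  then have "card {e, f} \<le> card (edges G)"
    using e two_connected_finite[OF assms] by (intro card_mono) auto
  with \<open>f \<noteq> e\<close> show ?thesis by simp
qed

lemma multigraph_ends_card2:
  assumes "multigraph G" "card (verts G) = 2" "e \<in> edges G"
  shows "ends G e = verts G"
  using assms by (metis card_subset_eq multigraph_def)

text \<open>From three vertices on, the absence of cut vertices implies connectivity and the absence
  of bridges; on two vertices only the number of parallel edges counts. This reduces
  two-connectedness to connectivity of vertex-deleted sets.\<close>

lemma two_connected_iff:
  assumes "multigraph G"
  shows "two_connected G \<longleftrightarrow> card (verts G) = 2 \<and> 2 \<le> card (edges G) \<or>
    3 \<le> card (verts G) \<and> (\<forall>v\<in>verts G. conn G (verts G - {v}))"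
    (is "?L \<longleftrightarrow> ?A \<or> ?B")
proof
  assume ?L
  then have "2 \<le> card (verts G)" "2 \<le> card (edges G)" "\<forall>v\<in>verts G. conn G (verts G - {v})"
    by (simp_all add: two_connected_card two_connected_card_edges two_connected_conn_remove)
  then show "?A \<or> ?B" by linarith
next
  have fin: "finite (verts G)" "finite (edges G)" using assms by (auto simp: multigraph_def)
  have main: ?L if "2 \<le> card (verts G)" "\<forall>v\<in>verts G. conn G (verts G - {v})"
    "\<forall>e\<in>edges G. conn (delete_edges G {e}) (verts G)" "conn G (verts G)"
    using that assms multigraph_conn[OF multigraph_delete_edges[OF assms]]
    by (simp add: two_connected_def connected_induced Diff_subset multigraph_conn)
  assume "?A \<or> ?B"
  then show ?L
  proof
    assume A: ?A
    then obtain a b where ab: "verts G = {a, b}" "a \<noteq> b" by (meson card_2_iff)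
    have E: "ends G e = {a, b}" if "e \<in> edges G" for e
      using multigraph_ends_card2[OF assms] A that ab by auto
    show ?L
    proof (rule main)
      show "\<forall>v\<in>verts G. conn G (verts G - {v})"
        using ab by (auto simp: insert_Diff_if)
      have "edges G - {e} \<noteq> {}" for e
        using A fin by (metis card.empty card_Diff_singleton_if diff_is_0_eq not_numeral_le_zero
            One_nat_def Suc_1 Suc_n_not_le_n diff_le_self le_trans)
      then have "\<exists>e'\<in>edges G. e' \<noteq> e" for e by blast
      then show "\<forall>e\<in>edges G. conn (delete_edges G {e}) (verts G)"
        using E ab by (auto simp: adj_def intro!: conn_edge) (metis Diff_iff singletonD)
      then show "conn G (verts G)" using E ab
        by (metis A card.empty conn_edge adj_def ex_in_conv not_numeral_le_zero)
    qed (use A in auto)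
  next
    assume B: ?B
    have third: "\<exists>z\<in>verts G. z \<noteq> a \<and> z \<noteq> b" for a b
    proof (rule ccontr)
      assume "\<not> ?thesis"
      then have "card (verts G) \<le> card {a, b}" by (intro card_mono) auto
      also have "\<dots> \<le> 2" by (simp add: card_insert_if)
      finally show False using B by simp
    qed
    show ?L
    proof (rule main)
      show c: "conn G (verts G)"
      proof (rule connI)
        fix C assume C: "C \<subseteq> verts G" "C \<noteq> {}" 
          "\<And>a b. a \<in> C \<Longrightarrow> b \<in> verts G \<Longrightarrow> adj G a b \<Longrightarrow> b \<in> C"
        then obtain c where c: "c \<in> C" by blast
        show "verts G \<subseteq> C"
        proof
          fix v assume v: "v \<in> verts G"
          \<comment> \<open>Deleting a vertex other than \<open>c\<close> and \<open>v\<close>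
            leaves a connected set that contains both.\<close>
          from third[of c v] obtain z where z: "z \<in> verts G" "z \<noteq> c" "z \<noteq> v" by blast
          have "verts G - {z} \<subseteq> C \<or> (verts G - {z}) \<inter> C = {}"
            by (rule conn_dichotomy[where Y = "verts G"]) (use B z C(3) in auto)
          with c C(1) v z show "v \<in> C" by blast
        qed
      qed (use B in auto)
      show "\<forall>e\<in>edges G. conn (delete_edges G {e}) (verts G)"
      proof
        fix e assume e: "e \<in> edges G"
        from multigraph_ends[OF assms e] obtain a b where ab: "ends G e = {a, b}" "a \<noteq> b"
          "a \<in> verts G" "b \<in> verts G" by blast
        let ?H = "delete_edges G {e}"
        have adjH: "adj ?H p q" if "adj G p q" "{p, q} \<noteq> {a, b}" for p q
          using that ab by (auto simp: adj_def)
        \<comment> \<open>Deleting an end of \<open>e\<close> removes \<open>e\<close> as well. The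
          two sets obtained in this way cover the graph and share a third vertex.\<close>
        have "conn ?H (verts G - {z})" if "z \<in> {a, b}" for z
          by (rule conn_mono[of G]) (use B ab that in \<open>auto intro: adjH\<close>)
        then have "conn ?H (verts G - {a})" "conn ?H (verts G - {b})" by auto
        moreover have "(verts G - {a}) \<union> (verts G - {b}) = verts G" using ab by auto
        moreover have "(verts G - {a}) \<inter> (verts G - {b}) \<noteq> {}" using third[of a b] by blast
        ultimately show "conn ?H (verts G)" using conn_Un by metis
      qed
    qed (use B in auto)
  qed
qed

text \<open>Parallel edges influence two-connectedness only through their number on two vertices, so
  adjacency and the edge count determine it.\<close>

lemma two_connected_cong:
  assumes "multigraph G" "multigraph H" "verts G = verts H" "card (edges G) = card (edges H)"
    "\<And>a b. a \<in> verts G \<Longrightarrow> b \<in> verts G \<Longrightarrow> adj G a b \<longleftrightarrow> adj H a b"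
  shows "two_connected G \<longleftrightarrow> two_connected H"
proof -
  have "conn G (verts G - {v}) \<longleftrightarrow> conn H (verts G - {v})" for v
    by (rule conn_cong) (use assms(5) in auto)
  then show ?thesis using assms(3,4) by (simp add: two_connected_iff assms(1,2))
qed

lemma two_connected_induced_iff:
  assumes "multigraph G" "S \<subseteq> verts G"
  shows "two_connected (induced G S) \<longleftrightarrow> card S = 2 \<and> 2 \<le> card (edges_within G S) \<or>
    3 \<le> card S \<and> (\<forall>v\<in>S. conn G (S - {v}))"
proof -
  have "conn (induced G S) (S - {v}) \<longleftrightarrow> conn G (S - {v})" for v
    by (rule conn_induced) blast
  then show ?thesis by (simp add: two_connected_iff multigraph_induced[OF assms])
qed

lemma two_connected_induced_conn:
  assumes "two_connected (induced G S)"
  shows "conn G S" "v \<in> S \<Longrightarrow> conn G (S - {v})"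
proof -
  show "conn G S" using two_connected_conn[OF assms] conn_induced[of S S G] by simp
  assume "v \<in> S"
  then have "conn (induced G S) (S - {v})" using two_connected_conn_remove[OF assms] by simp
  then show "conn G (S - {v})" using conn_induced[of "S - {v}" S G] by blast
qed

text \<open>A vertex without edges would be a closed set by itself; this excludes an isolated vertex
  both in \<open>G\<close> and after deleting a first edge at \<open>v\<close>.\<close>

lemma two_connected_degree:
  assumes "two_connected G" "v \<in> verts G"
  shows "2 \<le> card {e \<in> edges G. v \<in> ends G e}"
proof -
  from assms have c: "conn G (verts G)" "2 \<le> card (verts G)"
    using two_connected_conn two_connected_card by blast+
  then have a: "{v} \<noteq> verts G" using card_1_singleton_iff[of "verts G"] by auto
  have ex: "\<exists>e\<in>edges H. v \<in> ends H e" if "conn H (verts G)" for H :: "('a,'b) pre_multigraph"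
  proof (rule ccontr)
    assume "\<not> ?thesis"
    then have "{v} = verts G" by (intro connD[OF that]) (use assms a in \<open>auto simp: adj_def\<close>)
    with a show False by simp
  qed
  from ex[OF c(1)] obtain e where e: "e \<in> edges G" "v \<in> ends G e" by blast
  from ex[OF two_connected_conn_delete[OF assms(1) e(1)]]
  obtain f where f: "f \<in> edges G" "f \<noteq> e" "v \<in> ends G f" by auto
  then have "card {e, f} \<le> card {e \<in> edges G. v \<in> ends G e}"
    using e two_connected_finite[OF assms(1)] by (intro card_mono) auto
  with \<open>f \<noteq> e\<close> show ?thesis by simp
qed

section \<open>Contraction and good flats\<close>

text \<open>As \<open>S\<close> is connected, its inner edges merge it into one class and leave
  every other vertex alone. This makes the vertices of the contraction explicit.\<close>

lemma component_conn_set: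
  assumes "multigraph G" "conn G S"
  shows "(adjacency G (edges_within G S))\<^sup>* `` {v} = (if v \<in> S then S else {v})"
proof -
  let ?R = "adjacency G (edges_within G S)"
  have R: "(a, b) \<in> ?R \<longleftrightarrow> adj G a b \<and> a \<in> S \<and> b \<in> S" for a b
    by (auto simp: adjacency_def adj_def edges_within_def)
  have notin: "b = v" if "(v, b) \<in> ?R\<^sup>*" "v \<notin> S" for b
    using that by (induction rule: rtrancl_induct) (auto simp: R)
  have inS: "b \<in> S" if "(v, b) \<in> ?R\<^sup>*" "v \<in> S" for b
    using that by (induction rule: rtrancl_induct) (auto simp: R)
  have "{b \<in> S. (v, b) \<in> ?R\<^sup>*} = S" if "v \<in> S"
    by (rule connD[OF assms(2)]) (use that R in \<open>auto intro: rtrancl_into_rtrancl\<close>)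
  then show ?thesis using notin inS by auto
qed

text \<open>Deleting an uncontracted vertex \<open>p\<close> from the contraction leaves an image of
  \<open>G - p\<close>, which is connected anyway. Deleting the contracted vertex leaves a copy of
  \<open>G - S\<close>, and this is the only real condition.\<close>

lemma two_connected_contract_iff:
  assumes G: "two_connected G" and S: "S \<subset> verts G" "conn G S" "2 \<le> card S"
  shows "two_connected (contract G (edges_within G S)) \<longleftrightarrow> conn G (verts G - S)"
proof -
  note mG = two_connected_multigraph[OF G]
  define q where "q = (\<lambda>v. if v \<in> S then S else {v})"
  let ?C = "contract G (edges_within G S)"
  have vC: "verts ?C = q ` verts G" and eC: "edges ?C = edges G - edges_within G S"
    and nC: "ends ?C = (\<lambda>e. q ` ends G e)"
    by (simp_all add: contract_def Let_def component_conn_set[OF mG S(2)] q_def)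
  have fin: "finite (verts G)" "finite (edges G)" using two_connected_finite[OF G] by auto
  have qdiff: "q a \<noteq> q b" if "a \<noteq> b" "\<not> (a \<in> S \<and> b \<in> S)" for a b
    using that by (auto simp: q_def)
  have vC2: "verts ?C = insert S ((\<lambda>v. {v}) ` (verts G - S))"
    using S(1) conn_nonempty[OF S(2)] unfolding vC q_def by (auto simp: image_iff)
  have S_notin: "S \<notin> (\<lambda>v. {v}) ` (verts G - S)" by auto
  have cardC: "card (verts ?C) = Suc (card (verts G - S))"
    unfolding vC2 using fin S_notin by (simp add: card_image)
  have mC: "multigraph ?C"
    unfolding multigraph_def
  proof (intro conjI ballI)
    fix e assume e: "e \<in> edges ?C"
    then have "e \<in> edges G" by (simp add: eC)
    from multigraph_ends[OF mG this] obtain a b where ab: "ends G e = {a, b}" "a \<noteq> b"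
      "a \<in> verts G" "b \<in> verts G" by blast
    then have "\<not> (a \<in> S \<and> b \<in> S)" using e unfolding eC by (auto simp: edges_within_def)
    then show "ends ?C e \<subseteq> verts ?C" "card (ends ?C e) = 2"
      using ab qdiff[of a b] by (auto simp: nC vC)
  qed (use fin in \<open>auto simp: vC eC\<close>)
  have adjC: "q a = q b \<or> adj ?C (q a) (q b)" if "adj G a b" for a b
  proof (cases "a \<in> S \<and> b \<in> S")
    case False
    from that obtain e where e: "e \<in> edges G" "ends G e = {a, b}" by (auto simp: adj_def)
    then have "e \<in> edges ?C" "ends ?C e = {q a, q b}"
      using False unfolding eC nC by (auto simp: edges_within_def)
    then show ?thesis unfolding adj_def by blast
  qed (simp add: q_def)
  have adjC': "adj G a b" if ab: "adj ?C {a} {b}" "a \<notin> S" "b \<notin> S" for a b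
  proof -
    from ab(1) obtain e where e: "e \<in> edges G" "q ` ends G e = {{a}, {b}}"
      by (auto simp: adj_def eC nC)
    from multigraph_ends[OF mG e(1)] obtain c d where cd: "ends G e = {c, d}" by blast
    have "c \<notin> S \<and> d \<notin> S" using e(2) ab by (auto simp: cd q_def doubleton_eq_iff split: if_splits)
    then have "{c, d} = {a, b}" using e(2) cd by (auto simp: q_def doubleton_eq_iff split: if_splits)
    with e cd show ?thesis by (auto simp: adj_def)
  qed
  have conn_S: "conn ?C (verts ?C - {S}) \<longleftrightarrow> conn G (verts G - S)"
  proof -
    have eq: "verts ?C - {S} = (\<lambda>v. {v}) ` (verts G - S)" using S_notin unfolding vC2 by auto
    show ?thesis
    proof
      assume "conn ?C (verts ?C - {S})"
      then have "conn G (the_elem ` (verts ?C - {S}))"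
        by (rule conn_image) (auto simp: eq intro: adjC')
      then show "conn G (verts G - S)" by (simp add: eq image_image)
    next
      assume "conn G (verts G - S)"
      then show "conn ?C (verts ?C - {S})"
        unfolding eq by (rule conn_image) (use adjC in \<open>force simp: q_def\<close>)
    qed
  qed
  have conn_p: "conn ?C (verts ?C - {{p}})" if p: "p \<in> verts G - S" for p
  proof -
    have "verts ?C - {{p}} = q ` (verts G - {p})"
      using p S(1) conn_nonempty[OF S(2)] by (auto simp: vC q_def split: if_splits)
    moreover have "conn G (verts G - {p})" using two_connected_conn_remove[OF G] p by simp
    ultimately show ?thesis using conn_image[of G "verts G - {p}" q ?C] adjC by metis
  qed
  have pos: "0 < card (verts G - S)" using S(1) fin by (auto simp: card_gt_0_iff)
  show ?thesis
  proof (cases "card (verts G - S) = 1")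
    case True
    then obtain p where p: "verts G - S = {p}" by (auto simp: card_1_singleton_iff)
    then have pV: "p \<in> verts G" by auto
    \<comment> \<open>The contraction now has two vertices, so two parallel edges are required; the
      degree of \<open>p\<close> provides them.\<close>
    have "edges ?C = {e \<in> edges G. p \<in> ends G e}"
      using p mG unfolding eC by (fastforce simp: edges_within_def multigraph_def)
    with two_connected_degree[OF G pV] have "2 \<le> card (edges ?C)" by simp
    then show ?thesis using mC cardC True p by (simp add: two_connected_iff)
  next
    case False
    then have "3 \<le> card (verts ?C)" "card (verts ?C) \<noteq> 2" using cardC pos by auto
    moreover have "(\<forall>v\<in>verts ?C. conn ?C (verts ?C - {v})) \<longleftrightarrow> conn G (verts G - S)"
      using conn_S conn_p unfolding vC2 by blast
    ultimately show ?thesis using mC by (simp add: two_connected_iff)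
  qed
qed

text \<open>This form removes the contraction, whose vertices are sets of vertices; later arguments
  only compare connected subsets of one graph.\<close>

lemma good_flat_iff:
  assumes "two_connected G"
  shows "good_flat G S \<longleftrightarrow> S \<subset> verts G \<and> two_connected (induced G S) \<and> conn G (verts G - S)"
proof -
  have "two_connected (contract G (edges_within G S)) \<longleftrightarrow> conn G (verts G - S)"
    if "S \<subset> verts G" "two_connected (induced G S)"
    using two_connected_contract_iff[OF assms that(1)] two_connected_induced_conn(1)[OF that(2)]
      two_connected_card[OF that(2)] by simp
  then show ?thesis by (auto simp: good_flat_def)
qed

lemma good_flatD:
  assumes "good_flat G S"
  shows "S \<subset> verts G" "two_connected (induced G S)"
  using assms by (auto simp: good_flat_def)

text \<open>A parallel edge becomes a loop, and on two vertices a single class remains. Otherwise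
  \<open>e\<close> is the only edge within its two ends, and contracting it is contracting a
  connected set of two vertices.\<close>

lemma two_connected_contract_edge_iff:
  assumes G: "two_connected G" and e: "e \<in> edges G"
  shows "two_connected (contract G {e}) \<longleftrightarrow> 3 \<le> card (verts G) \<and>
    (\<forall>e'\<in>edges G. ends G e' = ends G e \<longrightarrow> e' = e) \<and> conn G (verts G - ends G e)"
proof -
  note mG = two_connected_multigraph[OF G]
  from multigraph_ends[OF mG e] obtain a b where ab: "ends G e = {a, b}" "a \<noteq> b"
    "a \<in> verts G" "b \<in> verts G" by blast
  have cG: "2 \<le> card (verts G)" using two_connected_card[OF G] .
  have cls: "(adjacency G {e})\<^sup>* `` {a} = (adjacency G {e})\<^sup>* `` {b}"
  proof -
    have "(a, b) \<in> adjacency G {e}" "(b, a) \<in> adjacency G {e}"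
      using ab by (auto simp: adjacency_def)
    then show ?thesis by (meson converse_rtrancl_into_rtrancl Image_singleton_iff subsetI subset_antisym)
  qed
  have par: "\<not> two_connected (contract G {e})" if "e' \<in> edges G" "ends G e' = ends G e" "e' \<noteq> e" for e'
  proof
    assume "two_connected (contract G {e})"
    moreover have "e' \<in> edges (contract G {e})" using that by (simp add: contract_def Let_def)
    ultimately have "card (ends (contract G {e}) e') = 2"
      using two_connected_multigraph by (auto simp: multigraph_def)
    then show False using cls that ab by (simp add: contract_def Let_def)
  qed
  have two: "\<not> two_connected (contract G {e})" if "card (verts G) = 2"
  proof
    assume "two_connected (contract G {e})"
    then have "2 \<le> card (verts (contract G {e}))" by (rule two_connected_card)
    moreover have "verts G = {a, b}" using multigraph_ends_card2[OF mG that e] ab by simp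
    ultimately show False using cls by (simp add: contract_def Let_def)
  qed
  show ?thesis
  proof (cases "3 \<le> card (verts G) \<and> (\<forall>e'\<in>edges G. ends G e' = ends G e \<longrightarrow> e' = e)")
    case True
    have "edges_within G {a, b} = {e}"
    proof -
      have "f = e" if "f \<in> edges G" "ends G f \<subseteq> {a, b}" for f
      proof -
        have "card (ends G f) = 2" using mG that by (auto simp: multigraph_def)
        then have "ends G f = {a, b}" using that ab card_subset_eq[of "{a, b}" "ends G f"] by simp
        with True that ab show ?thesis by auto
      qed
      then show ?thesis using e ab unfolding edges_within_def by blast
    qed
    moreover have "adj G a b" using e ab by (auto simp: adj_def)
    moreover have "{a, b} \<subset> verts G"
    proof -
      have "card {a, b} = 2" using ab by simp
      then have "{a, b} \<noteq> verts G" using True by fastforce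
      then show ?thesis using ab by auto
    qed
    ultimately show ?thesis
      using two_connected_contract_iff[OF G, of "{a, b}"] conn_edge[of G a b] ab True by simp
  next
    case False
    then have "card (verts G) = 2 \<or> (\<exists>e'\<in>edges G. ends G e' = ends G e \<and> e' \<noteq> e)"
      using cG by (auto simp: numeral_3_eq_3)
    then show ?thesis using par two False by blast
  qed
qed

text \<open>A non-contractible edge has a parallel copy, lies on only two vertices, or has ends that
  separate the graph; in the last case a detour through a part of the separation replaces the edge.
  Three edges exclude the digon. The lemma makes the weight of every edge forced outside the
  digon.\<close>

lemma two_connected_delete_or_contract:
  assumes G: "two_connected G" and e: "e \<in> edges G" and E: "3 \<le> card (edges G)"
  shows "two_connected (delete_edges G {e}) \<or> two_connected (contract G {e})"
proof (rule disjCI)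
  assume nc: "\<not> two_connected (contract G {e})"
  note mG = two_connected_multigraph[OF G]
  let ?H = "delete_edges G {e}"
  from multigraph_ends[OF mG e] obtain a b where ab: "ends G e = {a, b}" "a \<noteq> b"
    "a \<in> verts G" "b \<in> verts G" by blast
  have mH: "multigraph ?H" by (rule multigraph_delete_edges[OF mG])
  have fin: "finite (verts G)" "finite (edges G)" using two_connected_finite[OF G] by auto
  have adjH: "adj ?H p q" if "adj G p q" "{p, q} \<noteq> {a, b}" for p q
    using that ab by (auto simp: adj_def)
  have connG: "conn G (verts G - {z})" if "z \<in> verts G" for z
    by (rule two_connected_conn_remove[OF G that])
  show "two_connected ?H"
  proof (cases "card (verts G) = 2")
    case True
    then show ?thesis using E e fin by (simp add: two_connected_iff[OF mH])
  next
    case False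
    then have V3: "3 \<le> card (verts G)" using two_connected_card[OF G] by linarith
    have "conn ?H (verts G - {z})" if z: "z \<in> verts G" for z
    proof (cases "z \<in> {a, b} \<or> (\<exists>e'\<in>edges G. ends G e' = ends G e \<and> e' \<noteq> e)")
      case True
      \<comment> \<open>Either \<open>e\<close> vanishes together with \<open>z\<close>, or a
        parallel edge stands in for it.\<close>
      have "adj ?H p q" if "p \<in> verts G - {z}" "q \<in> verts G - {z}" "adj G p q" for p q
        using True that adjH[of p q] ab by (fastforce simp: adj_def)
      then show ?thesis using conn_mono[OF connG[OF z]] by blast
    next
      case F: False
      then have nab: "\<not> conn G (verts G - {a, b})"
        using nc V3 ab by (auto simp: two_connected_contract_edge_iff[OF G e])
      have "verts G - {a, b} \<noteq> {}" using z F by auto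
      with nab obtain Y1 Y2 where Y: "Y1 \<union> Y2 = verts G - {a, b}" "Y1 \<inter> Y2 = {}"
        "Y1 \<noteq> {}" "Y2 \<noteq> {}" "\<forall>p\<in>Y1. \<forall>q\<in>Y2. \<not> adj G p q \<and> \<not> adj G q p"
        by (rule not_connE)
      \<comment> \<open>The part of the separation by \<open>{a, b}\<close> that misses
        \<open>z\<close>; it serves as a detour between \<open>a\<close> and
        \<open>b\<close>.\<close>
      obtain W where W: "W \<subseteq> verts G - {a, b}" "W \<noteq> {}" "z \<notin> W"
        "\<And>p q. p \<in> W \<Longrightarrow> q \<in> verts G - {a, b} \<Longrightarrow> adj G p q \<Longrightarrow> q \<in> W"
      proof (cases "z \<in> Y1")
        case True
        have "q \<in> Y2" if "p \<in> Y2" "q \<in> verts G - {a, b}" "adj G p q" for p q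
          using Y(1) Y(5) that by blast
        then show ?thesis using that[of Y2] Y(1,2,4) True by blast
      next
        case False
        have "q \<in> Y1" if "p \<in> Y1" "q \<in> verts G - {a, b}" "adj G p q" for p q
          using Y(1) Y(5) that by blast
        then show ?thesis using that[of Y1] Y(1,3) False by blast
      qed
      \<comment> \<open>If only \<open>p\<close> were in \<open>C\<close>, then
        \<open>W \<inter> C\<close> would be closed in \<open>G - p\<close> and \<open>W - C\<close>
        closed in \<open>G - q\<close>. Both would have to be empty, although \<open>W\<close> is
        not.\<close>
      have key: "q \<in> C" if C: "\<And>p q. p \<in> C \<Longrightarrow> q \<in> verts G - {z} \<Longrightarrow> adj ?H p q \<Longrightarrow> q \<in> C"
        and pC: "p \<in> C" and pq: "{p, q} = {a, b}" for C p q
      proof (rule ccontr)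
        assume qC: "q \<notin> C"
        have pqV: "p \<in> verts G" "q \<in> verts G" "p \<noteq> q" using pq ab by (auto simp: doubleton_eq_iff)
        have closed: "s \<in> C" if "r \<in> C" "r \<in> W" "s \<in> verts G" "s \<noteq> z" "adj G r s" for r s
          using C[of r s] adjH[of r s] that W(1) by (auto simp: doubleton_eq_iff)
        have closed': "r \<in> C" if "s \<in> C" "r \<in> W" "s \<in> verts G" "s \<noteq> z" "adj G r s" for r s
          using C[of s r] adjH[of s r] that W adj_commute[of G r s] by (auto simp: doubleton_eq_iff)
        have Wnot: "p \<notin> W" "q \<notin> W" "z \<noteq> p" "z \<noteq> q" using W(1) pq F by auto
        have VW: "s \<in> W" if "r \<in> W" "s \<in> verts G" "s \<noteq> p" "s \<noteq> q" "adj G r s" for r s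
          using W(4)[of r s] that pq by (auto simp: doubleton_eq_iff)
        have "W \<inter> C = {}"
        proof (rule ccontr)
          assume ne: "W \<inter> C \<noteq> {}"
          have "W \<inter> C = verts G - {p}"
          proof (rule connD[OF connG[OF pqV(1)] _ ne])
            fix r s assume "r \<in> W \<inter> C" "s \<in> verts G - {p}" "adj G r s"
            then show "s \<in> W \<inter> C" using VW[of r s] closed[of r s] qC Wnot W(3) by (cases "s = q") auto
          qed (use W(1) Wnot in auto)
          then show False using Wnot pqV by auto
        qed
        moreover have "W \<subseteq> C"
        proof (rule ccontr)
          assume ne: "\<not> W \<subseteq> C"
          have "W - C = verts G - {q}"
          proof (rule connD[OF connG[OF pqV(2)]])
            fix r s assume rs: "r \<in> W - C" "s \<in> verts G - {q}" "adj G r s"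
            then have "s \<noteq> p" using closed'[of p r] pC pqV Wnot by auto
            then show "s \<in> W - C" using VW[of r s] closed'[of s r] rs W(3) by auto
          qed (use W(1) Wnot ne in auto)
          then show False using Wnot pqV by auto
        qed
        ultimately show False using W(2) by auto
      qed
      show ?thesis
      proof (rule connI)
        show "verts G - {z} \<noteq> {}" using connG[OF z] conn_nonempty by blast
        fix C assume C: "C \<subseteq> verts G - {z}" "C \<noteq> {}"
          "\<And>p q. p \<in> C \<Longrightarrow> q \<in> verts G - {z} \<Longrightarrow> adj ?H p q \<Longrightarrow> q \<in> C"
        have "C = verts G - {z}"
        proof (rule connD[OF connG[OF z] C(1,2)])
          fix p q assume pq: "p \<in> C" "q \<in> verts G - {z}" "adj G p q"
          show "q \<in> C"
          proof (cases "{p, q} = {a, b}")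
            case True
            show ?thesis by (rule key[OF _ pq(1) True]) (rule C(3))
          next
            case False
            then show ?thesis using C(3)[OF pq(1,2)] adjH pq(3) by blast
          qed
        qed
        then show "verts G - {z} \<subseteq> C" by simp
      qed
    qed
    then show ?thesis using V3 by (simp add: two_connected_iff[OF mH])
  qed
qed

section \<open>Isomorphisms and weights\<close>

text \<open>The two maps are kept explicit because weights are moved along \<open>g\<close> and the
  image of a particular edge has to be named.\<close>

definition iso_via ::
  "('v \<Rightarrow> 'w) \<Rightarrow> ('e \<Rightarrow> 'f) \<Rightarrow> ('v, 'e) pre_multigraph \<Rightarrow> ('w, 'f) pre_multigraph \<Rightarrow> bool" where
  "iso_via f g G H \<longleftrightarrow> bij_betw f (verts G) (verts H) \<and> bij_betw g (edges G) (edges H) \<and>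
     (\<forall>e\<in>edges G. ends H (g e) = f ` ends G e)"

text \<open>The requirements of \<open>weight_function\<close> on deletable and contractible edges are omitted: for
  \<open>\<delta> > 2\<close> they follow, and without them the notion is inherited by both sides of a two-separation.\<close>

definition balanced :: "nat \<Rightarrow> ('v, 'e) pre_multigraph \<Rightarrow> ('e \<Rightarrow> nat) \<Rightarrow> bool" where
  "balanced \<delta> G w \<longleftrightarrow> (\<forall>e\<in>edges G. w e \<in> {1, \<delta> - 1}) \<and>
     sum w (edges G) = \<delta> * (card (verts G) - 1) \<and>
     (\<forall>S. good_flat G S \<longrightarrow> sum w (edges_within G S) + 1 = \<delta> * (card S - 1))"

lemma multigraph_iso_iff: "G \<simeq>\<^sub>m H \<longleftrightarrow> (\<exists>f g. iso_via f g G H)"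
  by (simp add: multigraph_iso_def iso_via_def)

lemma spade_iff: "spade \<delta> G \<longleftrightarrow> (\<exists>w. weight_function \<delta> G w \<and> balanced \<delta> G w)"
  unfolding spade_def balanced_def by (auto simp: weight_function_def)

text \<open>In a multigraph the ends of edges lie in \<open>verts G\<close>, where \<open>f\<close>
  is injective, so images of ends can be pulled back.\<close>

lemma iso_via_sym:
  assumes "multigraph G" "iso_via f g G H"
  shows "iso_via (the_inv_into (verts G) f) (the_inv_into (edges G) g) H G"
proof -
  have f: "bij_betw f (verts G) (verts H)" and g: "bij_betw g (edges G) (edges H)"
    using assms(2) by (auto simp: iso_via_def)
  have "ends G (the_inv_into (edges G) g e') = the_inv_into (verts G) f ` ends H e'"
    if e': "e' \<in> edges H" for e'
  proof -
    obtain e where e: "e \<in> edges G" "e' = g e" using g e' by (auto simp: bij_betw_def)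
    have sub: "ends G e \<subseteq> verts G" using assms(1) e by (auto simp: multigraph_def)
    have "the_inv_into (verts G) f ` f ` ends G e = ends G e"
      using sub f by (force simp: image_image bij_betw_def the_inv_into_f_f)
    moreover have "the_inv_into (edges G) g e' = e"
      using e g by (simp add: bij_betw_def the_inv_into_f_f)
    ultimately show ?thesis using assms(2) e by (simp add: iso_via_def)
  qed
  then show ?thesis using f g by (simp add: iso_via_def bij_betw_the_inv_into)
qed

lemma multigraph_iso_sym: "multigraph G \<Longrightarrow> G \<simeq>\<^sub>m H \<Longrightarrow> H \<simeq>\<^sub>m G"
  unfolding multigraph_iso_iff using iso_via_sym by blast

lemma iso_via_multigraph:
  assumes "multigraph G" "iso_via f g G H"
  shows "multigraph H"
proof -
  have f: "bij_betw f (verts G) (verts H)" and g: "bij_betw g (edges G) (edges H)"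
    using assms(2) by (auto simp: iso_via_def)
  have "ends H e' \<subseteq> verts H \<and> card (ends H e') = 2" if e': "e' \<in> edges H" for e'
  proof -
    obtain e where e: "e \<in> edges G" "e' = g e" using g e' by (auto simp: bij_betw_def)
    have sub: "ends G e \<subseteq> verts G" "card (ends G e) = 2" using assms(1) e by (auto simp: multigraph_def)
    then have "inj_on f (ends G e)" using f by (meson bij_betw_def inj_on_subset)
    then show ?thesis using sub f assms(2) e by (auto simp: iso_via_def bij_betw_def card_image)
  qed
  moreover have "finite (verts H)" "finite (edges H)"
    using assms(1) f g by (auto simp: multigraph_def bij_betw_finite)
  ultimately show ?thesis by (simp add: multigraph_def)
qed

section \<open>Invariance under isomorphism\<close>

context
  fixes f :: "'v \<Rightarrow> 'w" and g :: "'e \<Rightarrow> 'f" and G :: "('v, 'e) pre_multigraph"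
    and H :: "('w, 'f) pre_multigraph"
  assumes G: "multigraph G" and iso: "iso_via f g G H"
begin

lemma iso_simps:
  "inj_on f (verts G)" "verts H = f ` verts G" "inj_on g (edges G)" "edges H = g ` edges G"
  "e \<in> edges G \<Longrightarrow> ends H (g e) = f ` ends G e"
  using iso by (auto simp: iso_via_def bij_betw_def)

lemma iso_image_eq: "A \<subseteq> verts G \<Longrightarrow> B \<subseteq> verts G \<Longrightarrow> f ` A = f ` B \<longleftrightarrow> A = B"
  using iso_simps(1) by (rule inj_on_image_eq_iff)

lemma iso_ends: "e \<in> edges G \<Longrightarrow> ends G e \<subseteq> verts G"
  using G by (auto simp: multigraph_def)

lemma iso_adj:
  assumes "u \<in> verts G" "v \<in> verts G"
  shows "adj H (f u) (f v) \<longleftrightarrow> adj G u v"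
proof -
  have "ends H (g e) = {f u, f v} \<longleftrightarrow> ends G e = {u, v}" if "e \<in> edges G" for e
    using iso_image_eq[of "ends G e" "{u, v}"] iso_ends[OF that] assms that by (simp add: iso_simps(5))
  then show ?thesis by (auto simp: adj_def iso_simps(4))
qed

lemma iso_conn:
  assumes "X \<subseteq> verts G"
  shows "conn H (f ` X) \<longleftrightarrow> conn G X"
proof
  assume "conn G X"
  then show "conn H (f ` X)" by (rule conn_image) (use assms iso_adj in blast)
next
  have inv: "the_inv_into (verts G) f (f x) = x" if "x \<in> X" for x
    using that assms iso_simps(1) by (auto simp: the_inv_into_f_f)
  assume "conn H (f ` X)"
  then have "conn G (the_inv_into (verts G) f ` f ` X)"
    by (rule conn_image) (use assms in \<open>auto simp: inv iso_adj subset_iff\<close>)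
  then show "conn G X" using inv by (simp add: image_image)
qed

lemma iso_edges_within:
  assumes "S \<subseteq> verts G"
  shows "edges_within H (f ` S) = g ` edges_within G S"
proof -
  have "ends H (g e) \<subseteq> f ` S \<longleftrightarrow> ends G e \<subseteq> S" if "e \<in> edges G" for e
    using iso_ends[OF that] assms iso_simps(1) that by (auto simp: iso_simps(5) inj_on_def subset_iff image_iff) blast
  then show ?thesis by (auto simp: edges_within_def iso_simps(4))
qed

lemma iso_induced:
  assumes "S \<subseteq> verts G"
  shows "iso_via f g (induced G S) (induced H (f ` S))"
proof -
  have "edges_within G S \<subseteq> edges G" by (auto simp: edges_within_def)
  then show ?thesis
    using assms iso_simps(5) inj_on_subset[OF iso_simps(1)] inj_on_subset[OF iso_simps(3)]
    by (auto simp: iso_via_def bij_betw_def iso_edges_within)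
qed

lemma iso_delete:
  assumes "e \<in> edges G"
  shows "iso_via f g (delete_edges G {e}) (delete_edges H {g e})"
  using assms iso_simps
  by (auto simp: iso_via_def bij_betw_def intro: inj_on_subset dest: inj_onD)

lemma iso_card: "card (verts H) = card (verts G)" "card (edges H) = card (edges G)"
  using iso by (auto simp: iso_via_def bij_betw_same_card)

lemma iso_two_connected: "two_connected H \<longleftrightarrow> two_connected G"
proof -
  have "conn H (verts H - {f v}) \<longleftrightarrow> conn G (verts G - {v})" if "v \<in> verts G" for v
  proof -
    have "verts H - {f v} = f ` (verts G - {v})"
      using that iso_simps(1) by (auto simp: iso_simps(2) dest: inj_onD)
    then show ?thesis using iso_conn[of "verts G - {v}"] by auto
  qed
  then have "(\<forall>v\<in>verts H. conn H (verts H - {v})) \<longleftrightarrow> (\<forall>v\<in>verts G. conn G (verts G - {v}))"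
    by (simp add: iso_simps(2))
  then show ?thesis
    by (simp add: two_connected_iff G iso_via_multigraph[OF G iso] iso_card)
qed

end

text \<open>Comparing the characterizations of contractibility avoids an isomorphism between the two
  quotient graphs.\<close>

lemma iso_contract_edge:
  assumes G: "two_connected G" and iso: "iso_via f g G H" and e: "e \<in> edges G"
  shows "two_connected (contract H {g e}) \<longleftrightarrow> two_connected (contract G {e})"
proof -
  note mG = two_connected_multigraph[OF G]
  note s = iso_simps[OF mG iso]
  have H: "two_connected H" using iso_two_connected[OF mG iso] G by simp
  have ge: "g e \<in> edges H" using e s by simp
  have sub: "ends G e \<subseteq> verts G" using iso_ends[OF mG iso e] .
  have "verts H - ends H (g e) = f ` (verts G - ends G e)"
    using s(1) sub e by (simp add: s(2,5) inj_on_image_set_diff)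
  then have 1: "conn H (verts H - ends H (g e)) \<longleftrightarrow> conn G (verts G - ends G e)"
    using iso_conn[OF mG iso, of "verts G - ends G e"] by auto
  have "ends H (g e') = ends H (g e) \<longleftrightarrow> ends G e' = ends G e" "g e' = g e \<longleftrightarrow> e' = e"
    if "e' \<in> edges G" for e'
    using that e iso_image_eq[OF mG iso iso_ends[OF mG iso that] sub] s(3) by (auto simp: s(5) inj_on_eq_iff)
  then have 2: "(\<forall>e'\<in>edges H. ends H e' = ends H (g e) \<longrightarrow> e' = g e) \<longleftrightarrow>
      (\<forall>e'\<in>edges G. ends G e' = ends G e \<longrightarrow> e' = e)"
    by (simp add: s(4))
  show ?thesis
    unfolding two_connected_contract_edge_iff[OF G e] two_connected_contract_edge_iff[OF H ge]
    using 1 2 iso_card[OF mG iso] by simp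
qed

lemma iso_good_flat:
  assumes G: "two_connected G" and iso: "iso_via f g G H" and S: "S \<subseteq> verts G"
  shows "good_flat H (f ` S) \<longleftrightarrow> good_flat G S"
proof -
  note mG = two_connected_multigraph[OF G]
  have H: "two_connected H" using iso_two_connected[OF mG iso] G by simp
  have "verts H - f ` S = f ` (verts G - S)"
    using iso_simps[OF mG iso] S by (simp add: inj_on_image_set_diff)
  then have "conn H (verts H - f ` S) \<longleftrightarrow> conn G (verts G - S)"
    using iso_conn[OF mG iso, of "verts G - S"] by auto
  moreover have "f ` S \<subset> verts H \<longleftrightarrow> S \<subset> verts G"
    using iso_image_eq[OF mG iso S subset_refl] iso_simps(2)[OF mG iso] S by auto
  moreover have "two_connected (induced H (f ` S)) \<longleftrightarrow> two_connected (induced G S)"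
    using iso_two_connected[OF multigraph_induced[OF mG S] iso_induced[OF mG iso S]] .
  ultimately show ?thesis by (simp add: good_flat_iff G H)
qed

lemma iso_balanced:
  assumes G: "two_connected G" and iso: "iso_via f g G H"
  shows "balanced \<delta> H w \<longleftrightarrow> balanced \<delta> G (w \<circ> g)"
proof -
  note mG = two_connected_multigraph[OF G]
  note s = iso_simps[OF mG iso]
  have 1: "sum w (g ` F) = sum (w \<circ> g) F" if "F \<subseteq> edges G" for F
    using s(3) that by (intro sum.reindex) (auto intro: inj_on_subset)
  have 2: "sum w (edges_within H (f ` S)) = sum (w \<circ> g) (edges_within G S)" "card (f ` S) = card S"
    if "S \<subseteq> verts G" for S
    using 1[of "edges_within G S"] that s(1) iso_edges_within[OF mG iso that]
    by (auto simp: edges_within_def intro: card_image inj_on_subset)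
  have flats: "(\<forall>S. good_flat H S \<longrightarrow> P S) \<longleftrightarrow> (\<forall>S. good_flat G S \<longrightarrow> P (f ` S))" for P
  proof (intro iffI allI impI)
    fix S assume L: "\<forall>S. good_flat H S \<longrightarrow> P S" and S: "good_flat G S"
    then show "P (f ` S)" using iso_good_flat[OF G iso, of S] good_flatD(1)[OF S] by auto
  next
    fix S assume R: "\<forall>S. good_flat G S \<longrightarrow> P (f ` S)" and S: "good_flat H S"
    then have "S \<subseteq> f ` verts G" using good_flatD(1)[OF S] s(2) by auto
    then obtain T where T: "T \<subseteq> verts G" "S = f ` T" by (meson subset_imageE)
    with S R show "P S" using iso_good_flat[OF G iso T(1)] by auto
  qed
  have "(\<forall>S. good_flat G S \<longrightarrow> sum w (edges_within H (f ` S)) + 1 = \<delta> * (card (f ` S) - 1)) \<longleftrightarrow>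
      (\<forall>S. good_flat G S \<longrightarrow> sum (w \<circ> g) (edges_within G S) + 1 = \<delta> * (card S - 1))"
    using 2 good_flatD(1) by (metis psubset_imp_subset)
  then show ?thesis
    unfolding balanced_def flats using 1[of "edges G"] iso_card[OF mG iso] by (simp add: s(4))
qed

lemma iso_weight_function:
  assumes G: "two_connected G" and iso: "iso_via f g G H"
  shows "weight_function \<delta> H w \<longleftrightarrow> weight_function \<delta> G (w \<circ> g)"
proof -
  note mG = two_connected_multigraph[OF G]
  have "two_connected (delete_edges H {g e}) \<longleftrightarrow> two_connected (delete_edges G {e})"
    if "e \<in> edges G" for e
    using iso_two_connected[OF multigraph_delete_edges[OF mG] iso_delete[OF mG iso that]] .
  then show ?thesis
    unfolding weight_function_def using iso_contract_edge[OF G iso] iso_simps(4)[OF mG iso] by auto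
qed

lemma iso_spade:
  assumes G: "multigraph G" and iso: "G \<simeq>\<^sub>m H" and H: "two_connected H" "spade \<delta> H"
  shows "two_connected G" "spade \<delta> G"
proof -
  from iso obtain f g where fg: "iso_via f g G H" by (auto simp: multigraph_iso_iff)
  show tG: "two_connected G" using iso_two_connected[OF G fg] H by simp
  show "spade \<delta> G"
    using H(2) iso_balanced[OF tG fg] iso_weight_function[OF tG fg] unfolding spade_iff by blast
qed

text \<open>Needed because \<open>constructible\<close> speaks only of graphs over natural
  numbers.\<close>

lemma multigraph_nat_copy:
  assumes "multigraph G"
  obtains f g and H :: "(nat, nat) pre_multigraph" where "iso_via f g G H"
proof -
  obtain f where f: "bij_betw f (verts G) {..<card (verts G)}"
    using assms ex_bij_betw_finite_nat[of "verts G"] by (auto simp: multigraph_def atLeast0LessThan)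
  obtain g where g: "bij_betw g (edges G) {..<card (edges G)}"
    using assms ex_bij_betw_finite_nat[of "edges G"] by (auto simp: multigraph_def atLeast0LessThan)
  have "iso_via f g G \<lparr>verts = {..<card (verts G)}, edges = {..<card (edges G)},
      ends = (\<lambda>n. f ` ends G (the_inv_into (edges G) g n))\<rparr>"
    using f g by (auto simp: iso_via_def bij_betw_def the_inv_into_f_f)
  then show thesis by (rule that)
qed

text \<open>On two vertices every edge has the same pair of ends, so arbitrary bijections are
  compatible.\<close>

lemma bond_iso:
  assumes G: "multigraph G" "card (verts G) = 2" and H: "multigraph H" "card (verts H) = 2"
    and E: "card (edges G) = card (edges H)"
  shows "G \<simeq>\<^sub>m H"
proof -
  have fin: "finite (verts G)" "finite (edges G)" "finite (verts H)" "finite (edges H)"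
    using G(1) H(1) by (auto simp: multigraph_def)
  obtain f where f: "bij_betw f (verts G) (verts H)"
    using finite_same_card_bij[of "verts G" "verts H"] fin G(2) H(2) by auto
  obtain g where g: "bij_betw g (edges G) (edges H)"
    using finite_same_card_bij[of "edges G" "edges H"] fin E by auto
  have "ends H (g e) = f ` ends G e" if "e \<in> edges G" for e
    using multigraph_ends_card2[OF G that] multigraph_ends_card2[OF H bij_betw_apply[OF g that]] f
    by (simp add: bij_betw_def)
  then show ?thesis unfolding multigraph_iso_def using f g by blast
qed

section \<open>Two-separations\<close>

text \<open>\<open>None\<close> is the virtual edge of a side of the separation.\<close>

definition side ::
  "('v, 'e) pre_multigraph \<Rightarrow> 'v set \<Rightarrow> 'e set \<Rightarrow> 'v \<Rightarrow> 'v \<Rightarrow> ('v, 'e option) pre_multigraph" where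
  "side G W F x y = \<lparr>verts = W, edges = insert None (Some ` F), ends = case_option {x, y} (ends G)\<rparr>"

lemma verts_side [simp]: "verts (side G W F x y) = W"
  and edges_side [simp]: "edges (side G W F x y) = insert None (Some ` F)"
  and ends_side [simp]: "ends (side G W F x y) None = {x, y}" "ends (side G W F x y) (Some e) = ends G e"
  by (simp_all add: side_def)

lemma adj_side: "adj (side G W F x y) a b \<longleftrightarrow> {a, b} = {x, y} \<or> (\<exists>e\<in>F. ends G e = {a, b})"
  by (auto simp: adj_def)

lemma adj_delete_side: "adj (delete_edges (side G W F x y) {None}) a b \<longleftrightarrow> (\<exists>e\<in>F. ends G e = {a, b})"
proof -
  have "insert None (Some ` F) - {None} = Some ` F" by auto
  then show ?thesis by (simp add: adj_def)
qed

lemma edges_within_side: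
  "edges_within (side G W F x y) T = (if {x, y} \<subseteq> T then {None} else {}) \<union> Some ` {e \<in> F. ends G e \<subseteq> T}"
  by (auto simp: edges_within_def)

text \<open>An edge joining \<open>x\<close> and \<open>y\<close> may belong to either part. The
  assumptions are symmetric, so statements are proved for the side of \<open>P\<close> and obtained
  for the side of \<open>Q\<close> from \<open>swap\<close>.\<close>

locale two_sep =
  fixes G :: "('v, 'e) pre_multigraph" and VP VQ :: "'v set" and P Q :: "'e set" and x y :: 'v
  assumes mG: "multigraph G" and xy: "x \<noteq> y" and V: "verts G = VP \<union> VQ"
    and VI: "VP \<inter> VQ = {x, y}" and E: "edges G = P \<union> Q" and PQ: "P \<inter> Q = {}"
    and Pne: "P \<noteq> {}" and Qne: "Q \<noteq> {}"
    and endsP: "e \<in> P \<Longrightarrow> ends G e \<subseteq> VP" and endsQ: "e \<in> Q \<Longrightarrow> ends G e \<subseteq> VQ"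
begin

lemma swap: "two_sep G VQ VP Q P x y"
  by unfold_locales (use mG xy V VI E PQ Pne Qne endsP endsQ in auto)

abbreviation "sideP \<equiv> side G VP P x y"
abbreviation "sideQ \<equiv> side G VQ Q x y"

lemma xyV: "x \<in> VP" "y \<in> VP" "x \<in> VQ" "y \<in> VQ"
  using VI by auto

lemma inter: "v \<in> VP \<Longrightarrow> v \<in> VQ \<Longrightarrow> v = x \<or> v = y"
  using VI by auto

lemma fin: "finite VP" "finite VQ" "finite P" "finite Q"
  using mG V E by (auto simp: multigraph_def)

lemma multigraph_sideP: "multigraph sideP"
  using mG xy xyV fin endsP E by (auto simp: multigraph_def)

text \<open>An edge of \<open>Q\<close> with both ends in \<open>VP\<close> joins \<open>x\<close>
  and \<open>y\<close>, and so does the virtual edge.\<close>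

lemma adj_imp_sideP:
  assumes "adj G a b" "a \<in> VP" "b \<in> VP"
  shows "adj sideP a b"
proof -
  from assms(1) obtain e where e: "e \<in> P \<union> Q" "ends G e = {a, b}" by (auto simp: adj_def E)
  show ?thesis
  proof (cases "e \<in> P")
    case True
    then show ?thesis using e by (auto simp: adj_side)
  next
    case False
    then have "{a, b} \<subseteq> {x, y}" using endsQ[of e] e assms VI by auto
    moreover have "a \<noteq> b" using adj_verts[OF mG assms(1)] by simp
    ultimately have "{a, b} = {x, y}" by auto
    then show ?thesis by (simp add: adj_side)
  qed
qed

lemma sideP_imp_adj: "adj sideP a b \<Longrightarrow> {a, b} \<noteq> {x, y} \<Longrightarrow> adj G a b"
  by (auto simp: adj_side adj_def E)

lemma adj_inner: "adj G a b \<Longrightarrow> a \<in> VP \<Longrightarrow> a \<notin> {x, y} \<Longrightarrow> b \<in> VP"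
proof -
  assume a: "adj G a b" "a \<in> VP" "a \<notin> {x, y}"
  then obtain e where e: "e \<in> P \<union> Q" "ends G e = {a, b}" by (auto simp: adj_def E)
  have "e \<notin> Q" using endsQ[of e] e a VI by auto
  then show "b \<in> VP" using endsP[of e] e by auto
qed

lemma conn_sideP_outside:
  assumes "X \<subseteq> VP" "\<not> {x, y} \<subseteq> X"
  shows "conn sideP X \<longleftrightarrow> conn G X"
proof (rule conn_cong)
  fix a b assume "a \<in> X" "b \<in> X"
  moreover from this have "{a, b} \<noteq> {x, y}" using assms(2) by auto
  ultimately show "adj sideP a b \<longleftrightarrow> adj G a b" using adj_imp_sideP sideP_imp_adj assms(1) by blast
qed

text \<open>The virtual edge is not a bridge of its side; after deleting it only edges of
  \<open>G\<close> remain.\<close>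

lemma conn_VP:
  assumes "two_connected sideP"
  shows "conn G VP"
proof -
  have "conn (delete_edges sideP {None}) VP" using two_connected_conn_delete[OF assms, of None] by simp
  then show ?thesis by (rule conn_mono) (simp add: adj_delete_side, auto simp: adj_def E)
qed

text \<open>If \<open>Z\<close> avoids \<open>x\<close> and \<open>y\<close>, the connected set
  \<open>VQ\<close> takes over the role of the virtual edge. If \<open>Z\<close> contains exactly
  one of them, the remainders of the two sides are connected and meet in the other one.\<close>

lemma conn_from_sideP:
  assumes Z: "Z \<subseteq> VP" "\<not> {x, y} \<subseteq> Z" and c: "conn sideP (VP - Z)" and Q: "two_connected sideQ"
  shows "conn G (verts G - Z)"
proof -
  interpret S: two_sep G VQ VP Q P x y by (rule swap)
  have ZQ: "Z \<inter> VQ = Z \<inter> {x, y}" using Z(1) VI by auto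
  consider (none) "x \<notin> Z" "y \<notin> Z" | (one) u where "u \<in> {x, y}" "Z \<inter> VQ = {u}"
  proof (cases "Z \<inter> {x, y} = {}")
    case False
    then have "Z \<inter> {x, y} = {x} \<or> Z \<inter> {x, y} = {y}" using Z(2) by auto
    then show ?thesis using that(2) ZQ by auto
  qed (use that in auto)
  then show ?thesis
  proof cases
    case none
    have cQ: "conn G VQ" by (rule S.conn_VP[OF Q])
    show ?thesis
    proof (rule connI)
      fix C assume C: "C \<subseteq> verts G - Z" "C \<noteq> {}"
        "\<And>a b. a \<in> C \<Longrightarrow> b \<in> verts G - Z \<Longrightarrow> adj G a b \<Longrightarrow> b \<in> C"
      have VQZ: "VQ \<subseteq> verts G - Z" using none ZQ V by auto
      have d: "VQ \<subseteq> C \<or> VQ \<inter> C = {}"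
        by (rule conn_dichotomy[OF cQ VQZ]) (rule C(3))
      have ne: "VP \<inter> C \<noteq> {}" using d C(1,2) V xyV by auto
      have "VP \<inter> C = VP - Z"
      proof (rule connD[OF c _ ne])
        fix a b assume ab: "a \<in> VP \<inter> C" "b \<in> VP - Z" "adj sideP a b"
        show "b \<in> VP \<inter> C"
        proof (cases "{a, b} = {x, y}")
          case True
          then have "a \<in> VQ" "b \<in> VQ" using xyV by (auto simp: doubleton_eq_iff)
          then show ?thesis using d ab by auto
        next
          case False
          then show ?thesis using C(3)[of a b] sideP_imp_adj[OF ab(3)] ab V by auto
        qed
      qed (use C(1) in auto)
      moreover from this have "VQ \<subseteq> C" using d none xyV by blast
      ultimately show "verts G - Z \<subseteq> C" using V by auto
    qed (use none xyV V in auto)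
  next
    case one
    have uQ: "u \<in> VQ" using one xyV by auto
    have n: "\<not> {x, y} \<subseteq> VQ - {u}" using one by auto
    have "conn sideQ (VQ - {u})" using two_connected_conn_remove[OF Q] uQ by simp
    then have cQ: "conn G (VQ - {u})" using S.conn_sideP_outside[OF _ n] by blast
    have "\<not> {x, y} \<subseteq> VP - Z" using one by auto
    then have cP: "conn G (VP - Z)" using c conn_sideP_outside[of "VP - Z"] by blast
    obtain v where v: "{u, v} = {x, y}" "u \<noteq> v" using one xy by (metis insert_commute insertE singletonD)
    then have "v \<in> (VP - Z) \<inter> (VQ - {u})" using one Z xyV VI by (auto simp: doubleton_eq_iff)
    moreover have "verts G - Z = (VP - Z) \<union> (VQ - {u})" using V one Z(1) VI by auto
    ultimately show ?thesis using conn_Un[OF cP cQ] by auto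
  qed
qed

text \<open>A closed set of the side that avoids \<open>x\<close> and \<open>y\<close> is closed in
  \<open>G - Z\<close>. One that meets \<open>{x, y}\<close> contains all of it outside
  \<open>Z\<close>, by the virtual edge, and becomes closed in \<open>G - Z\<close> after adding the
  rest of \<open>VQ\<close>.\<close>

lemma conn_to_sideP:
  assumes Z: "Z \<subseteq> VP" "\<not> {x, y} \<subseteq> Z" and c: "conn G (verts G - Z)"
  shows "conn sideP (VP - Z)"
proof (rule connI)
  show "VP - Z \<noteq> {}" using Z xyV by auto
  fix C assume C: "C \<subseteq> VP - Z" "C \<noteq> {}" "\<And>a b. a \<in> C \<Longrightarrow> b \<in> VP - Z \<Longrightarrow> adj sideP a b \<Longrightarrow> b \<in> C"
  have closed: "b \<in> C" if "a \<in> C" "b \<in> VP - Z" "adj G a b" for a b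
    using C(1) C(3)[OF that(1,2)] adj_imp_sideP[OF that(3)] that by blast
  have xyC: "v \<in> C" if "u \<in> C" "{u, v} = {x, y}" "v \<notin> Z" for u v
    using C(3)[of u v] that xyV by (auto simp: adj_side doubleton_eq_iff)
  show "VP - Z \<subseteq> C"
  proof (cases "C \<inter> {x, y} = {}")
    case True
    have "C = verts G - Z"
    proof (rule connD[OF c _ C(2)])
      fix a b assume ab: "a \<in> C" "b \<in> verts G - Z" "adj G a b"
      then have "b \<in> VP" using adj_inner[of a b] True C(1) by auto
      then show "b \<in> C" using closed ab by auto
    qed (use C(1) V in auto)
    then have False using True Z(2) xyV V by auto
    then show ?thesis ..
  next
    case False
    have full: "{x, y} - Z \<subseteq> C" using False xyC[of x y] xyC[of y x] by (auto simp: insert_commute)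
    have "C \<union> (VQ - Z) = verts G - Z"
    proof (rule connD[OF c])
      fix a b assume ab: "a \<in> C \<union> (VQ - Z)" "b \<in> verts G - Z" "adj G a b"
      show "b \<in> C \<union> (VQ - Z)"
      proof (cases "b \<in> VQ")
        case bF: False
        then have bP: "b \<in> VP - Z" "b \<notin> {x, y}" using ab V xyV by auto
        then have "a \<in> VP" using adj_inner[of b a] ab(3) adj_commute[of G] by auto
        then have "a \<in> C" using ab(1) full VI by auto
        then show ?thesis using closed[OF _ bP(1) ab(3)] by simp
      qed (use ab in auto)
    qed (use C V in auto)
    then show ?thesis using full inter xyV V by blast
  qed
qed

section \<open>Two-connectedness and good flats of the sides\<close>

lemma two_connected_sideP:
  assumes "two_connected G"
  shows "two_connected sideP"
proof (cases "card VP = 2")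
  case True
  have "card (insert None (Some ` P)) = Suc (card P)" using fin by (simp add: card_image)
  moreover have "0 < card P" using Pne fin by (simp add: card_gt_0_iff)
  ultimately show ?thesis using True by (simp add: two_connected_iff[OF multigraph_sideP])
next
  case False
  have "card {x, y} \<le> card VP" using fin xyV by (intro card_mono) auto
  then have "3 \<le> card VP" using False xy by simp
  moreover have "conn sideP (VP - {z})" if "z \<in> VP" for z
    using conn_to_sideP[of "{z}"] two_connected_conn_remove[OF assms, of z] that V xy by auto
  ultimately show ?thesis by (simp add: two_connected_iff[OF multigraph_sideP])
qed

lemma two_connected_from_sides:
  assumes P: "two_connected sideP" and Q: "two_connected sideQ"
  shows "two_connected G"
proof -
  interpret S: two_sep G VQ VP Q P x y by (rule swap)
  have sub: "{x, y} \<subseteq> verts G" using V xyV by auto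
  have finV: "finite (verts G)" using fin V by simp
  have "card {x, y} \<le> card (verts G)" using finV sub by (rule card_mono)
  then consider (two) "card (verts G) = 2" | (three) "3 \<le> card (verts G)" using xy by fastforce
  then show ?thesis
  proof cases
    case two
    obtain p q where "p \<in> P" "q \<in> Q" using Pne Qne by blast
    then have "p \<noteq> q" "{p, q} \<subseteq> edges G" using PQ E by auto
    then have "card {p, q} = 2" "{p, q} \<subseteq> edges G" by auto
    then have "2 \<le> card (edges G)" using fin E by (metis card_mono finite_Un)
    then show ?thesis using two by (simp add: two_connected_iff[OF mG])
  next
    case three
    have "conn G (verts G - {z})" if "z \<in> verts G" for z
    proof (cases "z \<in> VP")
      case True
      then show ?thesis
        using conn_from_sideP[of "{z}"] two_connected_conn_remove[OF P, of z] xy Q by auto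
    next
      case False
      then have "z \<in> VQ" using that V by auto
      then show ?thesis
        using S.conn_from_sideP[of "{z}"] two_connected_conn_remove[OF Q, of z] xy P by auto
    qed
    then show ?thesis using three by (simp add: two_connected_iff[OF mG])
  qed
qed

lemma edges_within_inside:
  assumes "T \<subseteq> VP" "\<not> {x, y} \<subseteq> T"
  shows "edges_within G T = {e \<in> P. ends G e \<subseteq> T}"
proof -
  have "\<not> ends G e \<subseteq> T" if "e \<in> Q" for e
  proof
    assume s: "ends G e \<subseteq> T"
    have "e \<in> edges G" using that E by simp
    from multigraph_ends[OF mG this] obtain a b where ab: "ends G e = {a, b}" "a \<noteq> b" by blast
    then have "{a, b} \<subseteq> {x, y}" using s endsQ[OF that] assms VI by auto
    then have "{x, y} \<subseteq> T" using ab s by auto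
    then show False using assms by simp
  qed
  then show ?thesis using E by (auto simp: edges_within_def)
qed

lemma two_connected_induced_sideP_inside:
  assumes "T \<subseteq> VP" "\<not> {x, y} \<subseteq> T"
  shows "two_connected (induced sideP T) \<longleftrightarrow> two_connected (induced G T)"
proof (rule two_connected_cong)
  show "multigraph (induced sideP T)" using multigraph_induced[OF multigraph_sideP] assms by simp
  show "multigraph (induced G T)" by (rule multigraph_induced[OF mG]) (use assms V in auto)
  show "card (edges (induced sideP T)) = card (edges (induced G T))"
    using assms by (auto simp: edges_within_side edges_within_inside card_image)
  fix a b assume "a \<in> verts (induced sideP T)" "b \<in> verts (induced sideP T)"
  then have ab: "a \<in> T" "b \<in> T" by auto
  then have "{a, b} \<noteq> {x, y}" using assms by auto
  then show "adj (induced sideP T) a b \<longleftrightarrow> adj (induced G T) a b"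
    using ab assms(1) adj_imp_sideP[of a b] sideP_imp_adj[of a b] unfolding adj_induced by blast
qed simp

text \<open>Enlarging a set that contains \<open>x\<close> and \<open>y\<close> by all of
  \<open>VQ\<close> yields another two-separation with the same second side, so the results on
  two-connectedness apply to the induced subgraph.\<close>

lemma two_sep_induced:
  assumes "{x, y} \<subseteq> T" "T \<subseteq> VP" "{e \<in> P. ends G e \<subseteq> T} \<noteq> {}"
  shows "two_sep (induced G (T \<union> VQ)) T VQ {e \<in> P. ends G e \<subseteq> T} Q x y"
proof
  show "edges (induced G (T \<union> VQ)) = {e \<in> P. ends G e \<subseteq> T} \<union> Q"
  proof -
    have "ends G e \<subseteq> T" if "e \<in> P" "ends G e \<subseteq> T \<union> VQ" for e
      using endsP[OF that(1)] that(2) inter xyV assms(1) by blast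
    then show ?thesis using endsQ by (auto simp: edges_within_def E)
  qed
  show "multigraph (induced G (T \<union> VQ))" by (rule multigraph_induced[OF mG]) (use assms V in auto)
  show "T \<inter> VQ = {x, y}" using assms(1,2) xyV by (auto dest: inter)
  show "{e \<in> P. ends G e \<subseteq> T} \<inter> Q = {}" using PQ by auto
qed (use xy assms(3) Qne endsQ in simp_all)

lemma induced_side_eq:
  assumes "{x, y} \<subseteq> T"
  shows "side (induced G (T \<union> VQ)) T {e \<in> P. ends G e \<subseteq> T} x y = induced sideP T"
  using assms edges_within_side[of G VP P x y T] unfolding side_def induced_def by simp

lemma side_induced_eq: "side (induced G (T \<union> VQ)) VQ Q x y = sideQ"
  unfolding side_def induced_def by simp

text \<open>The virtual edge stands for the whole opposite side, so a flat containing both of its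
  ends must absorb \<open>VQ\<close>.\<close>

lemma good_flat_from_sideP:
  assumes G: "two_connected G" and T: "good_flat sideP T"
  shows "good_flat G (if {x, y} \<subseteq> T then T \<union> VQ else T)"
proof -
  interpret S: two_sep G VQ VP Q P x y by (rule swap)
  have P: "two_connected sideP" by (rule two_connected_sideP[OF G])
  have Q: "two_connected sideQ" by (rule S.two_connected_sideP[OF G])
  have T': "T \<subset> VP" "two_connected (induced sideP T)" "conn sideP (VP - T)"
    using T by (auto simp: good_flat_iff[OF P])
  show ?thesis
  proof (cases "{x, y} \<subseteq> T")
    case True
    \<comment> \<open>Otherwise the virtual edge would be the only edge within \<open>T\<close>, but
      a two-connected graph has two.\<close>
    have ne: "{e \<in> P. ends G e \<subseteq> T} \<noteq> {}"
    proof
      assume e: "{e \<in> P. ends G e \<subseteq> T} = {}"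
      have "2 \<le> card (edges_within sideP T)" using two_connected_card_edges[OF T'(2)] by simp
      then show False using True e by (simp add: edges_within_side)
    qed
    interpret I: two_sep "induced G (T \<union> VQ)" T VQ "{e \<in> P. ends G e \<subseteq> T}" Q x y
      by (rule two_sep_induced) (use True T' ne in auto)
    have "two_connected (induced G (T \<union> VQ))"
      by (rule I.two_connected_from_sides) (use T'(2) Q in \<open>auto simp: induced_side_eq[OF True] side_induced_eq\<close>)
    moreover have eq: "verts G - (T \<union> VQ) = VP - T" using V VI True by auto
    moreover have "conn G (VP - T)" using T'(3) conn_sideP_outside[of "VP - T"] True by auto
    moreover have "T \<union> VQ \<subset> verts G" using eq T'(1) V by auto
    ultimately show ?thesis using True by (simp add: good_flat_iff[OF G])
  next
    case False
    have "conn G (verts G - T)" by (rule conn_from_sideP) (use T' False Q in auto)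
    moreover have "two_connected (induced G T)"
      using two_connected_induced_sideP_inside[of T] T' False by auto
    moreover have "T \<subset> verts G" using T'(1) V by auto
    ultimately have "good_flat G T" by (simp add: good_flat_iff[OF G])
    then show ?thesis using False by auto
  qed
qed

text \<open>The flat contains at most one of \<open>x\<close> and \<open>y\<close> and stays
  connected without it; every passage between the sides uses one of these two vertices.\<close>

lemma good_flat_inside_cases:
  assumes G: "two_connected G" and S: "good_flat G S" and n: "\<not> {x, y} \<subseteq> S"
  shows "S \<subseteq> VP \<or> S \<subseteq> VQ"
proof -
  have S': "S \<subset> verts G" "two_connected (induced G S)" using good_flatD[OF S] by auto
  interpret S: two_sep G VQ VP Q P x y by (rule swap)
  have c: "conn G (S - {x, y}) \<or> S \<subseteq> {x, y}"
  proof (cases "S \<inter> {x, y} = {}")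
    case True
    then have "S - {x, y} = S" by auto
    then show ?thesis using two_connected_induced_conn(1)[OF S'(2)] by simp
  next
    case False
    then obtain u where u: "u \<in> S" "S - {x, y} = S - {u}" using n by blast
    then show ?thesis using two_connected_induced_conn(2)[OF S'(2)] by simp
  qed
  show ?thesis
  proof (cases "S \<subseteq> {x, y}")
    case False
    with c have c': "conn G (S - {x, y})" by simp
    have "S - {x, y} \<subseteq> VP - {x, y} \<or> (S - {x, y}) \<inter> (VP - {x, y}) = {}"
      by (rule conn_dichotomy[OF c', of "S - {x, y}"]) (use adj_inner in auto)
    then show ?thesis using S'(1) V xyV by blast
  qed (use xyV in auto)
qed

lemma good_flat_to_sideP_inside:
  assumes G: "two_connected G" and S: "good_flat G S" and n: "\<not> {x, y} \<subseteq> S" and sub: "S \<subseteq> VP"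
  shows "good_flat sideP S"
proof -
  have S': "S \<subset> verts G" "two_connected (induced G S)" "conn G (verts G - S)"
    using S by (auto simp: good_flat_iff[OF G])
  have "conn sideP (VP - S)" by (rule conn_to_sideP[OF sub n S'(3)])
  moreover have "S \<subset> VP" using sub n xyV by auto
  ultimately show ?thesis
    using two_connected_induced_sideP_inside[OF sub n] S'(2)
    by (simp add: good_flat_iff[OF two_connected_sideP[OF G]])
qed

text \<open>The complement of the flat is connected and avoids \<open>x\<close> and
  \<open>y\<close>, so it lies strictly on one side.\<close>

lemma good_flat_across_cases:
  assumes G: "two_connected G" and S: "good_flat G S" and n: "{x, y} \<subseteq> S"
  shows "VP \<subseteq> S \<or> VQ \<subseteq> S"
proof -
  have S': "S \<subset> verts G" "conn G (verts G - S)" using S by (auto simp: good_flat_iff[OF G])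
  have "verts G - S \<subseteq> VP - {x, y} \<or> (verts G - S) \<inter> (VP - {x, y}) = {}"
    by (rule conn_dichotomy[OF S'(2), of "verts G - S"]) (use adj_inner n in auto)
  then show ?thesis using V n inter by blast
qed

text \<open>The exception occurs when the flat has no edge of \<open>P\<close>: its trace on the
  side would be the virtual edge alone, which is not two-connected. Then the flat is
  \<open>VQ\<close>, and the virtual edge of the opposite side is deletable, which determines its
  weight.\<close>

lemma good_flat_to_sideP_across:
  assumes G: "two_connected G" and S: "good_flat G S" and n: "{x, y} \<subseteq> S" and sub: "VQ \<subseteq> S"
  shows "good_flat sideP (S \<inter> VP) \<or>
    S = VQ \<and> edges_within G S = Q \<and> two_connected (delete_edges sideQ {None})"
proof -
  interpret S: two_sep G VQ VP Q P x y by (rule swap)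
  have S': "S \<subset> verts G" "two_connected (induced G S)" "conn G (verts G - S)"
    using S by (auto simp: good_flat_iff[OF G])
  define T where "T = S \<inter> VP"
  have ST: "S = T \<union> VQ" using S'(1) sub V by (auto simp: T_def)
  have xyT: "{x, y} \<subseteq> T" using n xyV by (auto simp: T_def)
  have TP: "T \<subset> VP" using S'(1) sub V by (auto simp: T_def)
  show ?thesis
  proof (cases "{e \<in> P. ends G e \<subseteq> T} = {}")
    case False
    interpret I: two_sep "induced G (T \<union> VQ)" T VQ "{e \<in> P. ends G e \<subseteq> T}" Q x y
      by (rule two_sep_induced) (use xyT TP False in auto)
    have "two_connected (induced sideP T)"
      using I.two_connected_sideP S'(2) ST induced_side_eq[OF xyT] by simp
    moreover have "verts G - S = VP - T" using V ST VI xyT by auto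
    moreover from this have "conn sideP (VP - T)"
      using S'(3) conn_sideP_outside[of "VP - T"] xyT by auto
    ultimately show ?thesis using TP
      by (simp add: good_flat_iff[OF two_connected_sideP[OF G]] T_def)
  next
    case True
    have EQ: "edges_within G S = Q"
    proof -
      have "ends G e \<subseteq> T" if "e \<in> P" "ends G e \<subseteq> S" for e
        using endsP[OF that(1)] that(2) by (auto simp: T_def)
      then show ?thesis using endsQ sub True E by (auto simp: edges_within_def)
    qed
    \<comment> \<open>Every vertex of \<open>S\<close> meets an edge within \<open>S\<close>, and
      these edges are exactly those of \<open>Q\<close>.\<close>
    have "S \<subseteq> VQ"
    proof
      fix s assume "s \<in> S"
      then have "2 \<le> card {e \<in> edges_within G S. s \<in> ends G e}"
        using two_connected_degree[OF S'(2), of s] by simp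
      then have "{e \<in> Q. s \<in> ends G e} \<noteq> {}" unfolding EQ by fastforce
      then show "s \<in> VQ" using endsQ by auto
    qed
    then have SQ: "S = VQ" using sub by auto
    have "two_connected (delete_edges sideQ {None}) \<longleftrightarrow> two_connected (induced G S)"
    proof (rule two_connected_cong)
      have "insert None (Some ` Q) - {None} = Some ` Q" by auto
      then show "card (edges (delete_edges sideQ {None})) = card (edges (induced G S))"
        using EQ by (simp add: card_image)
      show "multigraph (delete_edges sideQ {None})"
        by (rule multigraph_delete_edges[OF S.multigraph_sideP])
      show "multigraph (induced G S)" using multigraph_induced[OF mG] S' by simp
      show "adj (delete_edges sideQ {None}) a b \<longleftrightarrow> adj (induced G S) a b" for a b
        unfolding adj_delete_side using EQ by (simp add: adj_def)
    qed (use SQ in simp)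
    then show ?thesis using SQ EQ S'(2) by simp
  qed
qed

section \<open>Ranks and weights across a two-separation\<close>

lemma card_V: "card (verts G) + 2 = card VP + card VQ"
  using card_Un_Int[of VP VQ] fin V VI xy by simp

lemma card_ge2: "2 \<le> card VP" "2 \<le> card VQ"
  using card_mono[of VP "{x, y}"] card_mono[of VQ "{x, y}"] fin xyV xy by auto

lemma sum_edges: "sum w (edges G) = sum w P + sum w Q"
  using E PQ fin by (simp add: sum.union_disjoint)

lemma sum_sideP: "sum w (edges sideP) = w None + sum (w \<circ> Some) P"
  using fin by (simp add: sum.reindex)

lemma sum_within_sideP:
  "sum w (edges_within sideP T) =
    (if {x, y} \<subseteq> T then w None else 0) + sum (w \<circ> Some) {e \<in> P. ends G e \<subseteq> T}"
proof -
  have f: "finite {e \<in> P. ends G e \<subseteq> T}" using fin by simp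
  have "sum w (Some ` {e \<in> P. ends G e \<subseteq> T}) = sum (w \<circ> Some) {e \<in> P. ends G e \<subseteq> T}"
    by (rule sum.reindex) simp
  then show ?thesis unfolding edges_within_side using f by (auto simp: sum.insert)
qed

lemma sum_within_across:
  assumes "{x, y} \<subseteq> T" "T \<subseteq> VP"
  shows "sum w (edges_within G (T \<union> VQ)) = sum w {e \<in> P. ends G e \<subseteq> T} + sum w Q"
proof -
  have "ends G e \<subseteq> T" if "e \<in> P" "ends G e \<subseteq> T \<union> VQ" for e
    using endsP[OF that(1)] that(2) inter xyV assms(1) by blast
  then have "edges_within G (T \<union> VQ) = {e \<in> P. ends G e \<subseteq> T} \<union> Q"
    using endsQ by (auto simp: edges_within_def E)
  moreover have "{e \<in> P. ends G e \<subseteq> T} \<inter> Q = {}" using PQ by auto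
  ultimately show ?thesis using fin by (simp add: sum.union_disjoint)
qed

lemma card_across:
  assumes "{x, y} \<subseteq> T" "T \<subseteq> VP"
  shows "card (T \<union> VQ) + 2 = card T + card VQ"
proof -
  have "T \<inter> VQ = {x, y}" using VI assms by auto
  moreover have "finite T" using assms fin by (auto intro: finite_subset)
  ultimately show ?thesis using card_Un_Int[of T VQ] fin xy by simp
qed

end

context two_sep
begin

text \<open>Subtracting the assumption on \<open>P\<close> from the total gives \<open>Q\<close> the
  weight \<delta> * (card VQ - 2) + c. Replacing \<open>VQ\<close> by a virtual edge of weight
  \<open>c\<close> therefore changes weight and \<delta> times rank by the same amount, in every
  flat through \<open>x\<close> and \<open>y\<close>.\<close>

lemma balanced_sideP:
  assumes G: "two_connected G" and w: "balanced \<delta> G w" and c: "c \<in> {1, \<delta> - 1}"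
    and P: "sum w P + c = \<delta> * (card VP - 1)"
  shows "balanced \<delta> sideP (case_option c w)"
proof -
  let ?w = "case_option c w"
  have ws: "?w \<circ> Some = w" by auto
  \<comment> \<open>The shared pair \<open>x\<close>, \<open>y\<close> is split off from both sides,
    so that subtraction on natural numbers is exact.\<close>
  obtain p q where pq: "card VP = p + 2" "card VQ = q + 2"
    using card_ge2 by (metis le_add_diff_inverse2)
  then have cV: "card (verts G) = p + q + 2" using card_V by simp
  have tot: "sum w P + sum w Q = \<delta> * (p + q + 1)"
    using w cV sum_edges[of w] by (simp add: balanced_def)
  then have Q: "sum w Q = \<delta> * q + c" using P pq by (simp add: algebra_simps)
  have flat: "sum ?w (edges_within sideP T) + 1 = \<delta> * (card T - 1)" if T: "good_flat sideP T" for T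
  proof -
    note flatG = good_flat_from_sideP[OF G T]
    have TP: "T \<subseteq> VP" using good_flatD(1)[OF T] by auto
    show ?thesis
    proof (cases "{x, y} \<subseteq> T")
      case True
      have "2 \<le> card T" using two_connected_card[OF good_flatD(2)[OF T]] by simp
      then obtain t where t: "card T = t + 2" by (metis le_add_diff_inverse2)
      then have "card (T \<union> VQ) = t + q + 2" using card_across[OF True TP] pq by simp
      moreover have "sum w (edges_within G (T \<union> VQ)) + 1 = \<delta> * (card (T \<union> VQ) - 1)"
        using flatG True w by (simp add: balanced_def)
      ultimately have "sum w {e \<in> P. ends G e \<subseteq> T} + sum w Q + 1 = \<delta> * (t + q + 1)"
        using sum_within_across[OF True TP, of w] by simp
      then have "sum w {e \<in> P. ends G e \<subseteq> T} + c + 1 = \<delta> * (t + 1)"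
        using Q by (simp add: algebra_simps)
      then show ?thesis using True t by (simp add: sum_within_sideP ws)
    next
      case False
      have "sum w (edges_within G T) + 1 = \<delta> * (card T - 1)"
        using flatG False w by (auto simp: balanced_def)
      then show ?thesis using False edges_within_inside[OF TP False] sum_within_sideP[of ?w T] ws by auto
    qed
  qed
  moreover have "sum ?w (edges sideP) = \<delta> * (card (verts sideP) - 1)"
    using P sum_sideP[of ?w] ws by simp
  moreover have "\<forall>e\<in>edges sideP. ?w e \<in> {1, \<delta> - 1}"
    using c w E by (auto simp: balanced_def)
  ultimately show ?thesis unfolding balanced_def by blast
qed

text \<open>A vertex other than \<open>x\<close> and \<open>y\<close> would have degree at most one
  in the side, which is therefore a digon.\<close>

lemma single_edge_sideP:
  assumes "two_connected sideP" "P = {e}"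
  shows "VP = {x, y}" "ends G e = {x, y}"
proof -
  have "z \<in> {x, y}" if "z \<in> VP" for z
  proof (rule ccontr)
    assume z: "z \<notin> {x, y}"
    have "2 \<le> card {f \<in> edges sideP. z \<in> ends sideP f}"
      using two_connected_degree[OF assms(1), of z] that by simp
    also have "\<dots> \<le> card {Some e}" using z assms(2) by (intro card_mono) auto
    finally show False by simp
  qed
  then show VP: "VP = {x, y}" using xyV by auto
  have "e \<in> edges G" using E assms by simp
  then have "card (ends G e) = 2" using mG by (auto simp: multigraph_def)
  then show "ends G e = {x, y}"
    using endsP[of e] assms VP xy card_subset_eq[of "{x, y}" "ends G e"] by simp
qed

text \<open>The virtual weights sum to \<delta> because the ranks of the sides exceed the rank of
  \<open>G\<close> by one. Besides the balance equations, both sides carry genuine weight functions,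
  which settle the flat that is visible in neither side.\<close>

context
  fixes wP wQ :: "'e option \<Rightarrow> nat" and w :: "'e \<Rightarrow> nat" and \<delta> :: nat
  assumes G: "two_connected G"
    and wP: "weight_function \<delta> sideP wP" "balanced \<delta> sideP wP"
    and wQ: "weight_function \<delta> sideQ wQ" "balanced \<delta> sideQ wQ"
    and virt: "wP None + wQ None = \<delta>"
    and w: "\<And>e. e \<in> P \<Longrightarrow> w e = wP (Some e)" "\<And>e. e \<in> Q \<Longrightarrow> w e = wQ (Some e)"
begin

lemma sumP: "F \<subseteq> P \<Longrightarrow> sum (wP \<circ> Some) F = sum w F"
  using w(1) by (auto intro!: sum.cong)

lemma totalP: "wP None + sum w P = \<delta> * (card VP - 1)"
  using wP(2) sum_sideP[of wP] sumP[of P] by (simp add: balanced_def)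

lemma totalQ: "wQ None + sum w Q = \<delta> * (card VQ - 1)"
proof -
  interpret S: two_sep G VQ VP Q P x y by (rule swap)
  have "sum (wQ \<circ> Some) Q = sum w Q" using w(2) by (auto intro!: sum.cong)
  then show ?thesis using wQ(2) S.sum_sideP[of wQ] by (simp add: balanced_def)
qed

lemma glued_flat_inside:
  assumes S: "good_flat G S" "\<not> {x, y} \<subseteq> S" "S \<subseteq> VP"
  shows "sum w (edges_within G S) + 1 = \<delta> * (card S - 1)"
proof -
  have "sum wP (edges_within sideP S) + 1 = \<delta> * (card S - 1)"
    using wP(2) good_flat_to_sideP_inside[OF G S] by (simp add: balanced_def)
  then show ?thesis
    using S(2,3) sumP[of "{e \<in> P. ends G e \<subseteq> S}"] by (auto simp: sum_within_sideP edges_within_inside)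
qed

text \<open>If the flat restricts to the side of \<open>P\<close>, the equation there and the total
  of the other side add up. In the exceptional case the virtual edge of \<open>sideQ\<close> is
  deletable, so its weight is 1: exactly the deficit that a good flat must have.\<close>

lemma glued_flat_across:
  assumes S: "good_flat G S" "{x, y} \<subseteq> S" "VQ \<subseteq> S"
  shows "sum w (edges_within G S) + 1 = \<delta> * (card S - 1)"
proof -
  interpret S: two_sep G VQ VP Q P x y by (rule swap)
  obtain q where q: "card VQ = q + 2" using card_ge2 by (metis le_add_diff_inverse2)
  consider (side) "good_flat sideP (S \<inter> VP)" |
    (all) "S = VQ" "edges_within G S = Q" "two_connected (delete_edges sideQ {None})"
    using good_flat_to_sideP_across[OF G S] by blast
  then show ?thesis
  proof cases
    case side
    define T where "T = S \<inter> VP"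
    have ST: "S = T \<union> VQ" using good_flatD(1)[OF S(1)] S(3) V by (auto simp: T_def)
    have T: "{x, y} \<subseteq> T" "T \<subseteq> VP" using S(2) xyV by (auto simp: T_def)
    have fT: "good_flat sideP T" using side by (simp add: T_def)
    have "2 \<le> card T" using two_connected_card[OF good_flatD(2)[OF fT]] by simp
    then obtain t where t: "card T = t + 2" by (metis le_add_diff_inverse2)
    have cS: "card S = t + q + 2" using card_across[OF T] t q ST by simp
    have "sum wP (edges_within sideP T) + 1 = \<delta> * (t + 1)"
      using wP(2) fT t by (simp add: balanced_def)
    then have "wP None + sum w {e \<in> P. ends G e \<subseteq> T} + 1 = \<delta> * (t + 1)"
      using T sumP[of "{e \<in> P. ends G e \<subseteq> T}"] by (simp add: sum_within_sideP)
    moreover have "wQ None + sum w Q = \<delta> * (q + 1)" using totalQ q by simp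
    ultimately have "sum w {e \<in> P. ends G e \<subseteq> T} + sum w Q + 1 = \<delta> * (t + q + 1)"
      using virt by (simp add: algebra_simps)
    then show ?thesis using sum_within_across[OF T, of w] ST cS by simp
  next
    case all
    have "wQ None = 1" using wQ(1) all(3) by (auto simp: weight_function_def)
    then show ?thesis using totalQ all by simp
  qed
qed

text \<open>Deletability and contractibility of \<open>e\<close> in \<open>G\<close> pass to the
  same edge of its side, unless \<open>e\<close> is the only edge of \<open>P\<close>. Then its side
  is a digon and \<open>e\<close> inherits the role of the virtual edge on the other side.\<close>

lemma glued_weight:
  assumes e: "e \<in> P"
  shows "w e \<in> {1, \<delta> - 1}" "two_connected (delete_edges G {e}) \<Longrightarrow> w e = 1"
    "two_connected (contract G {e}) \<Longrightarrow> w e = \<delta> - 1"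
proof -
  interpret S: two_sep G VQ VP Q P x y by (rule swap)
  have tP: "two_connected sideP" by (rule two_connected_sideP[OF G])
  have tQ: "two_connected sideQ" by (rule S.two_connected_sideP[OF G])
  have eG: "e \<in> edges G" and eP: "Some e \<in> edges sideP" and nQ: "None \<in> edges sideQ"
    using e E by auto
  show "w e \<in> {1, \<delta> - 1}" using wP(1) eP w(1)[OF e] unfolding weight_function_def by metis
  \<comment> \<open>The digon has total weight \<delta>, so \<open>e\<close> receives the complement
    of \<open>wP None\<close>, which is \<open>wQ None\<close>.\<close>
  have single: "w e = wQ None" if "P = {e}"
    using totalP single_edge_sideP[OF tP that] that xy virt by simp
  {
    assume del: "two_connected (delete_edges G {e})"
    show "w e = 1"
    proof (cases "P = {e}")
      case True
      have "two_connected (delete_edges sideQ {None}) \<longleftrightarrow> two_connected (delete_edges G {e})"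
      proof (rule two_connected_cong)
        have 1: "insert None (Some ` Q) - {None} = Some ` Q" by auto
        have 2: "edges G - {e} = Q" using E PQ True by auto
        show "card (edges (delete_edges sideQ {None})) = card (edges (delete_edges G {e}))"
          using 1 2 by (simp add: card_image)
        show "adj (delete_edges sideQ {None}) a b \<longleftrightarrow> adj (delete_edges G {e}) a b" for a b
          unfolding adj_delete_side using 2 by (simp add: adj_def)
        show "verts (delete_edges sideQ {None}) = verts (delete_edges G {e})"
          using V single_edge_sideP(1)[OF tP True] xyV by auto
      qed (use multigraph_delete_edges S.multigraph_sideP mG in blast)+
      then have "wQ None = 1" using wQ(1) nQ del unfolding weight_function_def by metis
      then show ?thesis using single[OF True] by simp
    next
      case False
      then have ne: "P - {e} \<noteq> {}" using e by auto
      interpret D: two_sep "delete_edges G {e}" VP VQ "P - {e}" Q x y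
        by unfold_locales
          (use multigraph_delete_edges[OF mG] xy V VI E PQ ne Qne endsP endsQ e in auto)
      have "side (delete_edges G {e}) VP (P - {e}) x y = delete_edges sideP {Some e}"
        unfolding side_def delete_edges_def by auto
      then have "two_connected (delete_edges sideP {Some e})" using D.two_connected_sideP[OF del] by simp
      then have "wP (Some e) = 1" using wP(1) eP unfolding weight_function_def by metis
      then show ?thesis using w(1)[OF e] by simp
    qed
  next
    assume "two_connected (contract G {e})"
    then have con: "3 \<le> card (verts G)" "\<forall>e'\<in>edges G. ends G e' = ends G e \<longrightarrow> e' = e"
      "conn G (verts G - ends G e)" by (auto simp: two_connected_contract_edge_iff[OF G eG])
    show "w e = \<delta> - 1"
    proof (cases "P = {e}")
      case True
      note sing = single_edge_sideP[OF tP True]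
      have VQ: "verts G = VQ" using V sing xyV by auto
      have "e' = None" if "e' \<in> edges sideQ" "ends sideQ e' = {x, y}" for e'
        using that con(2) sing E PQ True by auto
      moreover have "conn sideQ (VQ - {x, y})"
        using con(3) sing(2) VQ S.conn_sideP_outside[of "VQ - {x, y}"] by auto
      ultimately have "two_connected (contract sideQ {None})"
        using con(1) VQ by (auto simp: two_connected_contract_edge_iff[OF tQ nQ])
      then have "wQ None = \<delta> - 1" using wQ(1) nQ unfolding weight_function_def by metis
      then show ?thesis using single[OF True] by simp
    next
      case False
      then obtain e2 where e2: "e2 \<in> P" "e2 \<noteq> e" using e by auto
      obtain eq where eq: "eq \<in> Q" using Qne by auto
      have "eq \<noteq> e" using eq e PQ by auto
      have sub: "ends G e \<subseteq> VP" by (rule endsP[OF e])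
      have ends_eq: "ends G f = {x, y}" if "f \<in> edges G" "ends G f \<subseteq> {x, y}" for f
      proof -
        have "card (ends G f) = 2" using mG that by (auto simp: multigraph_def)
        then show ?thesis using that xy card_subset_eq[of "{x, y}" "ends G f"] by simp
      qed
      \<comment> \<open>If \<open>e\<close> joined \<open>x\<close> and \<open>y\<close>,
        connectivity of the rest would shrink one side to \<open>{x, y}\<close>; a further edge of
        that side would then be parallel to \<open>e\<close>.\<close>
      have nxy: "\<not> {x, y} \<subseteq> ends G e"
      proof
        assume "{x, y} \<subseteq> ends G e"
        moreover obtain a b where "ends G e = {a, b}" using multigraph_ends[OF mG eG] by metis
        ultimately have exy: "ends G e = {x, y}" using xy by auto
        have "verts G - {x, y} \<subseteq> VP - {x, y} \<or> (verts G - {x, y}) \<inter> (VP - {x, y}) = {}"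
          by (rule conn_dichotomy[of G _ "verts G - {x, y}"]) (use con(3) exy adj_inner in auto)
        then have "VQ = {x, y} \<or> VP = {x, y}" using V xyV inter by blast
        then show False
        proof
          assume "VQ = {x, y}"
          then have "ends G eq = {x, y}" using endsQ[OF eq] eq E ends_eq by auto
          then show False using con(2) exy eq E \<open>eq \<noteq> e\<close> by auto
        next
          assume "VP = {x, y}"
          then have "ends G e2 = {x, y}" using endsP[OF e2(1)] e2 E ends_eq by auto
          then show False using con(2) exy e2 E by auto
        qed
      qed
      have c: "conn sideP (VP - ends G e)" by (rule conn_to_sideP[OF sub nxy con(3)])
      have "card VP \<noteq> 2"
      proof
        assume "card VP = 2"
        then have "VP = {x, y}" using fin xyV xy card_subset_eq[of VP "{x, y}"] by auto
        then show False using ends_eq[of e] sub nxy eG by auto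
      qed
      then have "3 \<le> card VP" using card_ge2 by linarith
      moreover have "e' = Some e" if "e' \<in> edges sideP" "ends sideP e' = ends G e" for e'
        using that con(2) nxy E by auto
      ultimately have "two_connected (contract sideP {Some e})"
        using c by (auto simp: two_connected_contract_edge_iff[OF tP eP])
      then have "wP (Some e) = \<delta> - 1" using wP(1) eP unfolding weight_function_def by metis
      then show ?thesis using w(1)[OF e] by simp
    qed
  }
qed

end

lemma glued_spade:
  assumes tP: "two_connected sideP" and tQ: "two_connected sideQ"
    and wP: "weight_function \<delta> sideP wP" "balanced \<delta> sideP wP"
    and wQ: "weight_function \<delta> sideQ wQ" "balanced \<delta> sideQ wQ"
    and virt: "wP None + wQ None = \<delta>"
    and w: "\<And>e. e \<in> P \<Longrightarrow> w e = wP (Some e)" "\<And>e. e \<in> Q \<Longrightarrow> w e = wQ (Some e)"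
  shows "weight_function \<delta> G w" "balanced \<delta> G w"
proof -
  interpret S: two_sep G VQ VP Q P x y by (rule swap)
  have G: "two_connected G" by (rule two_connected_from_sides[OF tP tQ])
  have virt': "wQ None + wP None = \<delta>" using virt by simp
  note gP = glued_weight[OF G wP wQ virt w]
  note gQ = S.glued_weight[OF G wQ wP virt' w(2,1)]
  show wf: "weight_function \<delta> G w"
    unfolding weight_function_def
  proof (intro ballI conjI impI)
    fix e assume "e \<in> edges G"
    then have e: "e \<in> P \<or> e \<in> Q" using E by simp
    show "w e \<in> {1, \<delta> - 1}" using e gP(1) gQ(1) by blast
    show "w e = 1" if "two_connected (delete_edges G {e})" using e gP(2) gQ(2) that by blast
    show "w e = \<delta> - 1" if "two_connected (contract G {e})" using e gP(3) gQ(3) that by blast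
  qed
  obtain p q where pq: "card VP = p + 2" "card VQ = q + 2"
    using card_ge2 by (metis le_add_diff_inverse2)
  then have cV: "card (verts G) = p + q + 2" using card_V by simp
  have "wP None + sum w P + (wQ None + sum w Q) = \<delta> * (p + 1) + \<delta> * (q + 1)"
    using totalP[OF G wP wQ virt w] totalQ[OF G wP wQ virt w] pq by simp
  then have "sum w (edges G) = \<delta> * (p + q + 1)"
    using virt sum_edges[of w] by (simp add: algebra_simps)
  then have total: "sum w (edges G) = \<delta> * (card (verts G) - 1)" using cV by simp
  have "sum w (edges_within G S) + 1 = \<delta> * (card S - 1)" if S: "good_flat G S" for S
  proof (cases "{x, y} \<subseteq> S")
    case True
    then show ?thesis
      using good_flat_across_cases[OF G S True] glued_flat_across[OF G wP wQ virt w S True]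
        S.glued_flat_across[OF G wQ wP virt' w(2,1) S True] by blast
  next
    case False
    then show ?thesis
      using good_flat_inside_cases[OF G S False] glued_flat_inside[OF G wP wQ virt w S False]
        S.glued_flat_inside[OF G wQ wP virt' w(2,1) S False] by blast
  qed
  then show "balanced \<delta> G w" using total wf by (auto simp: balanced_def weight_function_def)
qed

end

section \<open>Vertex sets attached at two vertices\<close>

definition attached_at :: "('v, 'e) pre_multigraph \<Rightarrow> 'v set \<Rightarrow> 'v \<Rightarrow> 'v \<Rightarrow> bool" where
  "attached_at G S a b \<longleftrightarrow> (\<forall>p\<in>S. \<forall>q\<in>verts G - S. adj G p q \<longrightarrow> p = a \<or> p = b)"

definition block_at :: "('v, 'e) pre_multigraph \<Rightarrow> 'v set \<Rightarrow> 'v \<Rightarrow> 'v \<Rightarrow> bool" where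
  "block_at G T a b \<longleftrightarrow> T \<subset> verts G \<and> two_connected (induced G T) \<and> a \<in> T \<and> b \<in> T \<and> a \<noteq> b \<and>
     attached_at G T a b"

text \<open>A piece of \<open>W\<close> without an edge to \<open>D\<close> would be closed in
  \<open>G - z\<close>, contrary to two-connectedness of \<open>G\<close>.\<close>

lemma conn_add_attached:
  assumes G: "two_connected G" and D: "conn G D" "D \<subseteq> verts G" "z \<notin> D" and z: "z \<in> verts G"
    and W: "W \<subseteq> verts G - {z}" "D \<inter> W = {}"
    and nb: "\<And>r s. r \<in> W \<Longrightarrow> s \<in> verts G \<Longrightarrow> adj G r s \<Longrightarrow> s \<in> W \<or> s = z \<or> s \<in> D"
  shows "conn G (D \<union> W)"
proof (rule connI)
  show "D \<union> W \<noteq> {}" using conn_nonempty[OF D(1)] by auto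
  have c: "conn G (verts G - {z})" by (rule two_connected_conn_remove[OF G z])
  fix C assume C: "C \<subseteq> D \<union> W" "C \<noteq> {}" "\<And>a b. a \<in> C \<Longrightarrow> b \<in> D \<union> W \<Longrightarrow> adj G a b \<Longrightarrow> b \<in> C"
  have Dz: "D \<subseteq> verts G - {z}" "D \<noteq> {}" using D conn_nonempty[OF D(1)] by auto
  have dich: "D \<subseteq> C \<or> D \<inter> C = {}"
    by (rule conn_dichotomy[OF D(1), of "D \<union> W"]) (use C(3) in auto)
  have DC: "D \<subseteq> C"
  proof (rule ccontr)
    assume "\<not> D \<subseteq> C"
    then have dis: "D \<inter> C = {}" using dich by simp
    then have CW: "C \<subseteq> W" using C(1) by auto
    have "C = verts G - {z}"
    proof (rule connD[OF c _ C(2)])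
      fix a b assume ab: "a \<in> C" "b \<in> verts G - {z}" "adj G a b"
      then have "b \<in> W \<or> b \<in> D" using nb[of a b] CW by auto
      then show "b \<in> C" using C(3)[OF ab(1) _ ab(3)] by auto
    qed (use CW W in auto)
    then show False using dis Dz by auto
  qed
  have "W \<subseteq> C"
  proof (rule ccontr)
    assume ne: "\<not> W \<subseteq> C"
    have "W - C = verts G - {z}"
    proof (rule connD[OF c])
      fix a b assume ab: "a \<in> W - C" "b \<in> verts G - {z}" "adj G a b"
      then have "b \<in> W \<or> b \<in> D" using nb[of a b] by auto
      moreover have "b \<notin> C" using C(3)[of b a] ab adj_commute[of G a b] by auto
      ultimately show "b \<in> W - C" using DC by auto
    qed (use W ne in auto)
    then show False using DC Dz by auto
  qed
  then show "D \<union> W \<subseteq> C" using DC by simp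
qed

text \<open>If the complement falls apart, one part can be absorbed: its vertices have neighbours
  only in that part and in \<open>T\<close>, so two-connectedness survives and the attachment
  vertices stay the same. The other part keeps the set proper, and the complement shrinks.\<close>

lemma block_extends_to_good_flat:
  assumes G: "two_connected G" and T: "block_at G T a b"
  shows "\<exists>S. good_flat G S \<and> block_at G S a b"
  using T
proof (induction "card (verts G - T)" arbitrary: T rule: less_induct)
  case less
  note mG = two_connected_multigraph[OF G]
  have T: "T \<subset> verts G" "two_connected (induced G T)" "a \<in> T" "b \<in> T" "a \<noteq> b" "attached_at G T a b"
    using less.prems by (auto simp: block_at_def)
  have fin: "finite (verts G)" using two_connected_finite[OF G] by simp
  show ?case
  proof (cases "conn G (verts G - T)")
    case True
    then show ?thesis using T less.prems by (auto simp: good_flat_iff[OF G])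
  next
    case False
    have "verts G - T \<noteq> {}" using T by auto
    with False obtain D1 D2 where D: "D1 \<union> D2 = verts G - T" "D1 \<inter> D2 = {}" "D1 \<noteq> {}" "D2 \<noteq> {}"
      "\<forall>p\<in>D1. \<forall>q\<in>D2. \<not> adj G p q \<and> \<not> adj G q p" by (rule not_connE)
    let ?S = "T \<union> D1"
    have S: "?S \<subset> verts G" using D T by auto
    have DV: "D1 \<subseteq> verts G" "D1 \<inter> T = {}" using D by auto
    have finS: "finite ?S" using S fin by (meson finite_subset psubset_imp_subset)
    have "2 \<le> card T" using two_connected_card[OF T(2)] by simp
    moreover have "card T < card ?S" using DV D(3) finS by (intro psubset_card_mono) auto
    ultimately have c3: "3 \<le> card ?S" by linarith
    have "conn G (?S - {z})" if z: "z \<in> ?S" for z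
    proof -
      have "conn G (T - {z})"
        using two_connected_induced_conn[OF T(2)] by (cases "z \<in> T") auto
      then have "conn G ((T - {z}) \<union> (D1 - {z}))"
      proof (rule conn_add_attached[OF G, where z = z])
        fix r s assume rs: "r \<in> D1 - {z}" "s \<in> verts G" "adj G r s"
        then have "s \<notin> D2" using D(5) by auto
        then show "s \<in> D1 - {z} \<or> s = z \<or> s \<in> T - {z}" using rs D(1) by auto
      qed (use z S DV in auto)
      then show ?thesis by (simp add: Un_Diff)
    qed
    then have tS: "two_connected (induced G ?S)"
      using c3 S by (simp add: two_connected_induced_iff[OF mG psubset_imp_subset[OF S]])
    have "attached_at G ?S a b"
      unfolding attached_at_def
    proof (intro ballI impI)
      fix p q assume pq: "p \<in> ?S" "q \<in> verts G - ?S" "adj G p q"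
      then have "q \<in> D2" using D(1) by auto
      then have "p \<in> T" using pq D(5) by auto
      then show "p = a \<or> p = b" using T(6) pq unfolding attached_at_def by auto
    qed
    then have "block_at G ?S a b" using S tS T by (auto simp: block_at_def)
    moreover have "card (verts G - ?S) < card (verts G - T)"
      using fin D S by (intro psubset_card_mono) auto
    ultimately show ?thesis using less.hyps by blast
  qed
qed

text \<open>A cut vertex \<open>z\<close> of \<open>S\<close> does not cut \<open>G\<close>, so each
  part must reach the outside through \<open>u\<close> or \<open>v\<close>. The two parts thus
  contain one of these each, and the pieces are attached at \<open>u\<close>, \<open>z\<close> and
  at \<open>z\<close>, \<open>v\<close>: the situation of \<open>S\<close> repeats.\<close>

lemma cut_split:
  assumes G: "two_connected G" and S: "S \<subset> verts G" "u \<in> S" "v \<in> S" "u \<noteq> v" "conn G S"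
    "attached_at G S u v" "3 \<le> card S" "\<not> two_connected (induced G S)"
  obtains z X Y where "X \<union> Y = S" "X \<inter> Y = {z}" "u \<in> X" "v \<in> Y" "u \<noteq> z" "v \<noteq> z"
    "conn G X" "conn G Y" "attached_at G X u z" "attached_at G Y z v"
    "\<forall>a\<in>X - {z}. \<forall>b\<in>Y - {z}. \<not> adj G a b \<and> \<not> adj G b a"
    "conn G (verts G - S) \<longrightarrow> conn G (verts G - X) \<and> conn G (verts G - Y)"
proof -
  note split = that
  note mG = two_connected_multigraph[OF G]
  obtain z where z: "z \<in> S" "\<not> conn G (S - {z})"
    using S two_connected_induced_iff[OF mG psubset_imp_subset[OF S(1)]] by auto
  have "S - {z} \<noteq> {}" using S(2-4) by auto
  with z(2) obtain A B where AB: "A \<union> B = S - {z}" "A \<inter> B = {}" "A \<noteq> {}" "B \<noteq> {}"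
    "\<forall>a\<in>A. \<forall>b\<in>B. \<not> adj G a b \<and> \<not> adj G b a" by (rule not_connE)
  have zV: "z \<in> verts G" using z S by auto
  have cz: "conn G (verts G - {z})" by (rule two_connected_conn_remove[OF G zV])
  \<comment> \<open>Otherwise no edge of \<open>G - z\<close> leaves \<open>C\<close>, because only
    \<open>u\<close> and \<open>v\<close> have neighbours outside \<open>S\<close>.\<close>
  have key: "C \<inter> {u, v} - {z} \<noteq> {}"
    if C: "C \<subseteq> S - {z}" "C \<noteq> {}" "\<And>a b. a \<in> C \<Longrightarrow> b \<in> S - {z} \<Longrightarrow> adj G a b \<Longrightarrow> b \<in> C" for C
  proof
    assume e: "C \<inter> {u, v} - {z} = {}"
    have "C = verts G - {z}"
    proof (rule connD[OF cz _ C(2)])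
      fix a b assume ab: "a \<in> C" "b \<in> verts G - {z}" "adj G a b"
      have "b \<in> S"
      proof (rule ccontr)
        assume "b \<notin> S"
        then have "a = u \<or> a = v" using S(6) ab C(1) unfolding attached_at_def by auto
        then show False using e ab C(1) by auto
      qed
      then show "b \<in> C" using C(3) ab by auto
    qed (use C(1) S in auto)
    then show False using C(1) S(1) z(1) by auto
  qed
  have kA: "A \<inter> {u, v} - {z} \<noteq> {}"
  proof (rule key)
    fix a b assume "a \<in> A" "b \<in> S - {z}" "adj G a b"
    then show "b \<in> A" using AB(1,5) by blast
  qed (use AB in auto)
  have kB: "B \<inter> {u, v} - {z} \<noteq> {}"
  proof (rule key)
    fix a b assume "a \<in> B" "b \<in> S - {z}" "adj G a b"
    then show "b \<in> B" using AB(1,5) by blast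
  qed (use AB in auto)
  \<comment> \<open>The parts are interchangeable, so it suffices to treat \<open>u\<close> in the
    first and \<open>v\<close> in the second.\<close>
  have goal: thesis if A: "A \<union> B = S - {z}" "A \<inter> B = {}" "u \<in> A" "v \<in> B"
    "\<forall>a\<in>A. \<forall>b\<in>B. \<not> adj G a b \<and> \<not> adj G b a" for A B
  proof -
    have zAB: "z \<notin> A" "z \<notin> B" using A(1) by auto
    have cX: "conn G (insert z C)" if C: "C \<subseteq> S - {z}"
      "\<And>a b. a \<in> C \<Longrightarrow> b \<in> S - {z} \<Longrightarrow> adj G a b \<Longrightarrow> b \<in> C" for C
    proof (rule connI)
      fix K assume K: "K \<subseteq> insert z C" "K \<noteq> {}"
        "\<And>a b. a \<in> K \<Longrightarrow> b \<in> insert z C \<Longrightarrow> adj G a b \<Longrightarrow> b \<in> K"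
      have zK: "z \<in> K"
      proof (rule ccontr)
        assume zK: "z \<notin> K"
        have "K = S"
        proof (rule connD[OF S(5) _ K(2)])
          fix a b assume ab: "a \<in> K" "b \<in> S" "adj G a b"
          then have "b \<in> insert z C" using C(2)[of a b] K(1) zK by (cases "b = z") auto
          then show "b \<in> K" using K(3) ab by auto
        qed (use K(1) C(1) z in auto)
        then show False using z zK by simp
      qed
      show "insert z C \<subseteq> K"
      proof (rule ccontr)
        assume ne: "\<not> insert z C \<subseteq> K"
        have "C - K = S"
        proof (rule connD[OF S(5)])
          fix a b assume ab: "a \<in> C - K" "b \<in> S" "adj G a b"
          then have "b \<notin> K" using K(3)[of b a] adj_commute[of G a b] by auto
          moreover from this have "b \<in> C" using C(2)[of a b] ab zK by auto
          ultimately show "b \<in> C - K" by simp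
        qed (use C(1) ne zK in auto)
        then show False using z(1) C(1) by auto
      qed
    qed simp
    have "\<And>a b. a \<in> A \<Longrightarrow> b \<in> S - {z} \<Longrightarrow> adj G a b \<Longrightarrow> b \<in> A"
      "\<And>a b. a \<in> B \<Longrightarrow> b \<in> S - {z} \<Longrightarrow> adj G a b \<Longrightarrow> b \<in> B"
      using A(1,5) by blast+
    then have cc: "conn G (insert z A)" "conn G (insert z B)" using cX A(1) by blast+
    have att: "attached_at G (insert z A) u z" "attached_at G (insert z B) z v"
      unfolding attached_at_def using S(6) A unfolding attached_at_def by blast+
    have co: "conn G (verts G - S) \<longrightarrow> conn G (verts G - insert z A) \<and> conn G (verts G - insert z B)"
    proof
      assume cS: "conn G (verts G - S)"
      have "conn G ((verts G - S) \<union> B)" "conn G ((verts G - S) \<union> A)"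
        by (rule conn_add_attached[OF G cS, where z = z]; use A S(1) z zV in blast)+
      moreover have "(verts G - S) \<union> B = verts G - insert z A" "(verts G - S) \<union> A = verts G - insert z B"
        using A(1,2) zAB S(1) z by auto
      ultimately show "conn G (verts G - insert z A) \<and> conn G (verts G - insert z B)" by simp
    qed
    show thesis
    proof (rule split[of "insert z A" "insert z B" z])
      show "insert z A \<union> insert z B = S" using A(1) z(1) by auto
      show "insert z A \<inter> insert z B = {z}" using A(2) by auto
      show "\<forall>a\<in>insert z A - {z}. \<forall>b\<in>insert z B - {z}. \<not> adj G a b \<and> \<not> adj G b a" using A(5) by auto
    qed (use A(3,4) zAB cc att co in auto)
  qed
  have "u \<in> A \<and> v \<in> B \<or> v \<in> A \<and> u \<in> B" using kA kB AB(2) by auto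
  then show thesis
  proof
    assume "u \<in> A \<and> v \<in> B"
    then show thesis using goal[of A B] AB by simp
  next
    assume h: "v \<in> A \<and> u \<in> B"
    show thesis by (rule goal[of B A]) (use AB h in auto)
  qed
qed

lemma edges_within_split:
  assumes mG: "multigraph G" and "X \<union> Y = S" "X \<inter> Y = {z}"
    "\<forall>a\<in>X - {z}. \<forall>b\<in>Y - {z}. \<not> adj G a b \<and> \<not> adj G b a"
  shows "edges_within G S = edges_within G X \<union> edges_within G Y"
    "edges_within G X \<inter> edges_within G Y = {}"
proof -
  have "ends G e \<subseteq> X \<or> ends G e \<subseteq> Y" if e: "e \<in> edges G" "ends G e \<subseteq> S" for e
  proof -
    from multigraph_ends[OF mG e(1)] obtain a b where ab: "ends G e = {a, b}" by blast
    then have "adj G a b" using e by (auto simp: adj_def)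
    then show ?thesis using assms(2,4) e(2) assms(3) unfolding ab by blast
  qed
  then show "edges_within G S = edges_within G X \<union> edges_within G Y"
    using assms(2) by (auto simp: edges_within_def)
  have "\<not> (ends G e \<subseteq> X \<and> ends G e \<subseteq> Y)" if e: "e \<in> edges G" for e
  proof
    assume "ends G e \<subseteq> X \<and> ends G e \<subseteq> Y"
    then have "ends G e \<subseteq> {z}" using assms(3) by auto
    moreover have "card (ends G e) = 2" using mG e by (auto simp: multigraph_def)
    ultimately show False using card_mono[of "{z}" "ends G e"] by simp
  qed
  then show "edges_within G X \<inter> edges_within G Y = {}" by (auto simp: edges_within_def)
qed

lemma is_path_append:
  assumes 1: "is_path G vs1 es1" and 2: "is_path G vs2 es2"
    and m: "last vs1 = hd vs2" "set vs1 \<inter> set vs2 = {last vs1}"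
  shows "is_path G (vs1 @ tl vs2) (es1 @ es2)"
proof -
  have len: "length vs1 = Suc (length es1)" "length vs2 = Suc (length es2)"
    using 1 2 by (auto simp: is_path_def)
  obtain a ws where vs2: "vs2 = a # ws" using len by (cases vs2) auto
  have nth: "(vs1 @ tl vs2) ! (length es1 + j) = vs2 ! j" if "j < length vs2" for j
  proof (cases j)
    case 0
    have "vs1 ! length es1 = last vs1" using len by (metis diff_Suc_1 last_conv_nth length_0_conv nat.distinct(1))
    then show ?thesis using 0 len m vs2 by (simp add: nth_append)
  next
    case (Suc k)
    then show ?thesis using len vs2 by (simp add: nth_append)
  qed
  have "ends G ((es1 @ es2) ! i) = {(vs1 @ tl vs2) ! i, (vs1 @ tl vs2) ! Suc i}"
    if i: "i < length (es1 @ es2)" for i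
  proof (cases "i < length es1")
    case True
    then show ?thesis using 1 len by (auto simp: is_path_def nth_append)
  next
    case False
    define j where "j = i - length es1"
    have j: "i = length es1 + j" "j < length es2" using False i by (auto simp: j_def)
    have "ends G (es2 ! j) = {vs2 ! j, vs2 ! Suc j}" using 2 j by (auto simp: is_path_def)
    then show ?thesis using nth[of j] nth[of "Suc j"] j len by (simp add: nth_append)
  qed
  moreover have "distinct (vs1 @ tl vs2)"
  proof -
    have "a = last vs1" "a \<notin> set ws" "distinct vs1" "distinct ws"
      using 1 2 m vs2 by (auto simp: is_path_def)
    moreover from this have "set vs1 \<inter> set ws = {}"
    proof -
      have "set vs1 \<inter> set ws \<subseteq> {a}" using m vs2 by fastforce
      then show ?thesis using \<open>a \<notin> set ws\<close> by auto
    qed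
    ultimately show ?thesis using vs2 by simp
  qed
  ultimately show ?thesis using 1 2 vs2 unfolding is_path_def by auto
qed

text \<open>Repeated splitting at cut vertices ends in two-connected pieces or single edges. If no
  two-connected piece turns up, the edges line up to a path from \<open>u\<close> to
  \<open>v\<close>.\<close>

lemma path_or_block:
  assumes G: "two_connected G" and S: "S \<subset> verts G" "u \<in> S" "v \<in> S" "u \<noteq> v" "conn G S" "attached_at G S u v"
  shows "(\<exists>T a b. block_at G T a b) \<or>
    (\<exists>vs es. is_path G vs es \<and> set vs = S \<and> set es = edges_within G S \<and> hd vs = u \<and> last vs = v)"
  using S
proof (induction "card S" arbitrary: S u v rule: less_induct)
  case less
  note mG = two_connected_multigraph[OF G]
  note S = less.prems
  have fin: "finite (verts G)" "finite (edges G)" using two_connected_finite[OF G] by auto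
  have finS: "finite S" using S(1) fin by (meson finite_subset psubset_imp_subset)
  show ?case
  proof (cases "two_connected (induced G S)")
    case True
    then show ?thesis using S unfolding block_at_def by blast
  next
    case nt: False
    have "card {u, v} \<le> card S" using finS S by (intro card_mono) auto
    then consider "card S = 2" | "3 \<le> card S" using S(4) by fastforce
    then show ?thesis
    proof cases
      case 1
      then have Suv: "S = {u, v}" using S finS card_subset_eq[of S "{u, v}"] by auto
      have "adj G u v"
      proof (rule ccontr)
        assume "\<not> adj G u v"
        then have "{u} = S" by (intro connD[OF S(5)]) (use Suv adj_verts[OF mG, of u u] in auto)
        then show False using S by auto
      qed
      then obtain e where e: "e \<in> edges G" "ends G e = {u, v}" by (auto simp: adj_def)
      have "\<not> 2 \<le> card (edges_within G S)"
        using nt 1 two_connected_induced_iff[OF mG psubset_imp_subset[OF S(1)]] by auto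
      moreover have eS: "e \<in> edges_within G S" using e Suv by (auto simp: edges_within_def)
      moreover have "finite (edges_within G S)" using fin by (auto simp: edges_within_def)
      ultimately have "edges_within G S = {e}"
        by (metis One_nat_def Suc_1 Suc_leI card_0_eq card_1_singletonE empty_iff less_one
            linorder_neqE_nat not_less_eq singletonD)
      moreover have "is_path G [u, v] [e]" using e S by (auto simp: is_path_def)
      ultimately show ?thesis using Suv by (intro disjI2 exI[of _ "[u, v]"] exI[of _ "[e]"]) auto
    next
      case 2
      obtain z X Y where XY: "X \<union> Y = S" "X \<inter> Y = {z}" "u \<in> X" "v \<in> Y" "u \<noteq> z" "v \<noteq> z"
        "conn G X" "conn G Y" "attached_at G X u z" "attached_at G Y z v"
        "\<forall>a\<in>X - {z}. \<forall>b\<in>Y - {z}. \<not> adj G a b \<and> \<not> adj G b a"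
        "conn G (verts G - S) \<longrightarrow> conn G (verts G - X) \<and> conn G (verts G - Y)"
        by (rule cut_split[OF G S 2 nt])
      have z: "z \<in> X" "z \<in> Y" using XY(2) by auto
      have X: "X \<subset> S" using XY by auto
      have Y: "Y \<subset> S" using XY by auto
      have "(\<exists>T a b. block_at G T a b) \<or>
        (\<exists>vs es. is_path G vs es \<and> set vs = X \<and> set es = edges_within G X \<and> hd vs = u \<and> last vs = z)"
        by (rule less.hyps) (use X S finS XY z in \<open>auto intro: psubset_card_mono\<close>)
      moreover have "(\<exists>T a b. block_at G T a b) \<or>
        (\<exists>vs es. is_path G vs es \<and> set vs = Y \<and> set es = edges_within G Y \<and> hd vs = z \<and> last vs = v)"
        by (rule less.hyps) (use Y S finS XY z in \<open>auto intro: psubset_card_mono\<close>)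
      moreover have ?thesis
        if p1: "is_path G vs1 es1" "set vs1 = X" "set es1 = edges_within G X" "hd vs1 = u" "last vs1 = z"
          and p2: "is_path G vs2 es2" "set vs2 = Y" "set es2 = edges_within G Y" "hd vs2 = z" "last vs2 = v"
        for vs1 es1 vs2 es2
      proof -
        have "is_path G (vs1 @ tl vs2) (es1 @ es2)"
          by (rule is_path_append) (use p1 p2 XY in auto)
        moreover obtain ws where ws: "vs2 = z # ws" using p2(1,4) by (cases vs2) (auto simp: is_path_def)
        moreover have "ws \<noteq> []" using ws p2(5) XY by auto
        moreover have "vs1 \<noteq> []" using p1(1) by (auto simp: is_path_def)
        ultimately show ?thesis
          using p1 p2 XY(1) edges_within_split(1)[OF mG XY(1,2,11)] z
          by (intro disjI2 exI[of _ "vs1 @ tl vs2"] exI[of _ "es1 @ es2"]) auto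
      qed
      ultimately show ?thesis by blast
    qed
  qed
qed

text \<open>After splitting at cut vertices, each two-connected piece is a good flat and every other
  piece has at most one edge, so each weighs at most \<delta> times its rank minus 1. Ranks add up
  along the chain, and two pieces already give the deficit 2. Connectivity of the complement is
  inherited by the pieces and makes them flats.\<close>

lemma chain_bound:
  assumes G: "two_connected G" and w: "balanced \<delta> G w" and \<delta>: "2 < \<delta>"
    and S: "S \<subset> verts G" "u \<in> S" "v \<in> S" "u \<noteq> v" "conn G S" "attached_at G S u v" "conn G (verts G - S)"
  shows "sum w (edges_within G S) + 1 \<le> \<delta> * (card S - 1) \<and>
    (\<not> two_connected (induced G S) \<and> 2 \<le> card (edges_within G S) \<longrightarrow>
      sum w (edges_within G S) + 2 \<le> \<delta> * (card S - 1))"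
  using S
proof (induction "card S" arbitrary: S u v rule: less_induct)
  case less
  note mG = two_connected_multigraph[OF G]
  note S = less.prems
  have fin: "finite (verts G)" "finite (edges G)" using two_connected_finite[OF G] by auto
  have finS: "finite S" using S(1) fin by (meson finite_subset psubset_imp_subset)
  have finE: "finite (edges_within G A)" for A using fin by (auto simp: edges_within_def)
  show ?case
  proof (cases "two_connected (induced G S)")
    case True
    then have "good_flat G S" using S by (simp add: good_flat_iff[OF G])
    then show ?thesis using w True by (simp add: balanced_def)
  next
    case nt: False
    have "card {u, v} \<le> card S" using finS S by (intro card_mono) auto
    then consider "card S = 2" | "3 \<le> card S" using S(4) by fastforce
    then show ?thesis
    proof cases
      case 1
      then have le: "\<not> 2 \<le> card (edges_within G S)"
        using nt two_connected_induced_iff[OF mG psubset_imp_subset[OF S(1)]] by auto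
      have "w e \<le> \<delta> - 1" if "e \<in> edges_within G S" for e
        using w that \<delta> by (auto simp: balanced_def edges_within_def)
      then have "sum w (edges_within G S) \<le> card (edges_within G S) * (\<delta> - 1)"
        using sum_bounded_above[of "edges_within G S" w "\<delta> - 1"] by simp
      also have "\<dots> \<le> 1 * (\<delta> - 1)" using le by (intro mult_right_mono) auto
      finally show ?thesis using 1 le \<delta> by simp
    next
      case 2
      obtain z X Y where XY: "X \<union> Y = S" "X \<inter> Y = {z}" "u \<in> X" "v \<in> Y" "u \<noteq> z" "v \<noteq> z"
        "conn G X" "conn G Y" "attached_at G X u z" "attached_at G Y z v"
        "\<forall>a\<in>X - {z}. \<forall>b\<in>Y - {z}. \<not> adj G a b \<and> \<not> adj G b a"
        "conn G (verts G - S) \<longrightarrow> conn G (verts G - X) \<and> conn G (verts G - Y)"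
        by (rule cut_split[OF G S(1-6) 2 nt])
      have z: "z \<in> X" "z \<in> Y" using XY(2) by auto
      have X: "X \<subset> S" and Y: "Y \<subset> S" using XY by auto
      have fXY: "finite X" "finite Y" using X Y finS by (auto intro: finite_subset)
      have IX: "sum w (edges_within G X) + 1 \<le> \<delta> * (card X - 1)"
        using less.hyps[OF psubset_card_mono[OF finS X] psubset_trans[OF X S(1)] XY(3) z(1) XY(5,7,9)]
          XY(12) S(7) by simp
      have IY: "sum w (edges_within G Y) + 1 \<le> \<delta> * (card Y - 1)"
        using less.hyps[OF psubset_card_mono[OF finS Y] psubset_trans[OF Y S(1)] z(2) XY(4) not_sym[OF XY(6)] XY(8,10)]
          XY(12) S(7) by simp
      have "card S + 1 = card X + card Y" using card_Un_Int[OF fXY] XY(1,2) by simp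
      moreover have "1 \<le> card X" "1 \<le> card Y" using fXY z by (auto simp: Suc_le_eq card_gt_0_iff)
      ultimately have "card S - 1 = (card X - 1) + (card Y - 1)" by linarith
      then have "\<delta> * (card S - 1) = \<delta> * (card X - 1) + \<delta> * (card Y - 1)" by (simp add: distrib_left)
      moreover have "sum w (edges_within G S) = sum w (edges_within G X) + sum w (edges_within G Y)"
        using edges_within_split[OF mG XY(1,2,11)] finE by (simp add: sum.union_disjoint)
      ultimately show ?thesis using IX IY by linarith
    qed
  qed
qed

text \<open>The list \<open>es\<close> exhausts all edges, so \<open>G\<close> itself is a cycle. At
  least three vertices are required to separate this case from the digon.\<close>

definition hamilton_cycle :: "('v, 'e) pre_multigraph \<Rightarrow> 'v list \<Rightarrow> 'e list \<Rightarrow> bool" where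
  "hamilton_cycle G vs es \<longleftrightarrow> length vs = length es \<and> 3 \<le> length vs \<and> distinct vs \<and> distinct es \<and>
     set vs = verts G \<and> set es = edges G \<and>
     (\<forall>i<length vs. ends G (es ! i) = {vs ! i, vs ! (Suc i mod length vs)})"

section \<open>A good flat attached at two vertices, or a cycle\<close>

lemma is_path_distinct_edges:
  assumes "is_path G vs es"
  shows "distinct es"
  unfolding distinct_conv_nth
proof (intro allI impI notI)
  fix i j assume ij: "i < length es" "j < length es" "i \<noteq> j" "es ! i = es ! j"
  have d: "distinct vs" and l: "length vs = Suc (length es)" using assms by (auto simp: is_path_def)
  have "{vs ! i, vs ! Suc i} = {vs ! j, vs ! Suc j}"
    using assms ij unfolding is_path_def by metis
  then show False using ij l nth_eq_iff_index_eq[OF d] by (auto simp: doubleton_eq_iff)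
qed

text \<open>Counting the weight of the edges at each vertex: if every \<open>verts G - {x}\<close> were a good flat,
  each star would have weight \<open>\<delta> + 1\<close>, so \<open>n * (\<delta> + 1) = 2 * \<delta> * (n - 1)\<close> where \<open>n\<close> is the
  number of vertices.\<close>

lemma all_vertex_deleted_two_connected:
  assumes G: "two_connected G" and w: "balanced \<delta> G w" and \<delta>: "2 < \<delta>" and n: "3 \<le> card (verts G)"
    and all: "\<And>x. x \<in> verts G \<Longrightarrow> two_connected (induced G (verts G - {x}))"
  shows "card (verts G) = 3"
proof -
  note mG = two_connected_multigraph[OF G]
  have fin: "finite (verts G)" "finite (edges G)" using two_connected_finite[OF G] by auto
  define m where "m = card (verts G) - 2"
  have m: "card (verts G) = m + 2" "1 \<le> m" using n by (auto simp: m_def)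
  have star: "sum w {e \<in> edges G. x \<in> ends G e} = \<delta> + 1" if x: "x \<in> verts G" for x
  proof -
    have "verts G - (verts G - {x}) = {x}" using x by auto
    then have "good_flat G (verts G - {x})" using all[OF x] x by (auto simp: good_flat_iff[OF G])
    moreover have "card (verts G - {x}) = m + 1" using x m fin by simp
    ultimately have f: "sum w (edges_within G (verts G - {x})) + 1 = \<delta> * m"
      using w by (simp add: balanced_def)
    have "edges G = edges_within G (verts G - {x}) \<union> {e \<in> edges G. x \<in> ends G e}"
      using mG by (auto simp: edges_within_def multigraph_def)
    moreover have "edges_within G (verts G - {x}) \<inter> {e \<in> edges G. x \<in> ends G e} = {}"
      by (auto simp: edges_within_def)
    moreover have "finite (edges_within G (verts G - {x}))" using fin by (auto simp: edges_within_def)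
    ultimately have "sum w (edges G) = sum w (edges_within G (verts G - {x})) + sum w {e \<in> edges G. x \<in> ends G e}"
      using fin sum.union_disjoint[of "edges_within G (verts G - {x})" "{e \<in> edges G. x \<in> ends G e}" w] by simp
    moreover have "sum w (edges G) = \<delta> * (m + 1)" using w m by (simp add: balanced_def)
    ultimately show ?thesis using f by simp
  qed
  have "(\<Sum>x\<in>verts G. sum w {e \<in> edges G. x \<in> ends G e}) = (\<Sum>e\<in>edges G. \<Sum>x\<in>{x \<in> verts G. x \<in> ends G e}. w e)"
    by (rule sum.swap_restrict[OF fin])
  also have "\<dots> = (\<Sum>e\<in>edges G. 2 * w e)"
  proof (rule sum.cong)
    fix e assume e: "e \<in> edges G"
    have "{x \<in> verts G. x \<in> ends G e} = ends G e" using mG e by (auto simp: multigraph_def)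
    then show "(\<Sum>x\<in>{x \<in> verts G. x \<in> ends G e}. w e) = 2 * w e" using mG e by (simp add: multigraph_def)
  qed simp
  also have "\<dots> = 2 * (\<delta> * (m + 1))" using w m by (simp add: balanced_def flip: sum_distrib_left)
  finally have "(\<Sum>x\<in>verts G. sum w {e \<in> edges G. x \<in> ends G e}) = 2 * (\<delta> * (m + 1))" .
  moreover have "(\<Sum>x\<in>verts G. sum w {e \<in> edges G. x \<in> ends G e}) = (\<Sum>x\<in>verts G. \<delta> + 1)"
    using star by (rule sum.cong[OF refl])
  ultimately have eq: "(m + 2) * (\<delta> + 1) = 2 * (\<delta> * (m + 1))" using m(1) by (simp only: sum_constant of_nat_id)
  have "m \<le> 1"
  proof (rule ccontr)
    assume m2: "\<not> m \<le> 1"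
    \<comment> \<open>With these offsets the equation reads (k + 4) * (d + 4) = 2 * (d + 3) * (k +
      3), whose right-hand side is larger in every coefficient.\<close>
    define k d where "k = m - 2" and "d = \<delta> - 3"
    have k: "m = k + 2" and d: "\<delta> = d + 3" using m2 \<delta> by (simp_all add: k_def d_def)
    show False using eq unfolding k d by (simp add: algebra_simps)
  qed
  then show ?thesis using m by simp
qed

text \<open>The set of the other vertices is attached at the two neighbours of \<open>p\<close>. It
  contains a block or is a path between them, and \<open>p\<close> closes this path to a
  cycle.\<close>

lemma block_or_cycle_degree2:
  assumes G: "two_connected G" and n: "3 \<le> card (verts G)" and p: "p \<in> verts G"
    and deg: "card {e \<in> edges G. p \<in> ends G e} \<le> 2"
  shows "(\<exists>T a b. block_at G T a b) \<or> (\<exists>vs es. hamilton_cycle G vs es)"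
proof -
  note mG = two_connected_multigraph[OF G]
  have "card {e \<in> edges G. p \<in> ends G e} = 2" using deg two_connected_degree[OF G p] by simp
  then obtain e1 e2 where e12: "{e \<in> edges G. p \<in> ends G e} = {e1, e2}" "e1 \<noteq> e2" by (meson card_2_iff)
  have other: "\<exists>c. ends G e = {p, c} \<and> c \<noteq> p \<and> c \<in> verts G" if e: "e \<in> edges G" "p \<in> ends G e" for e
  proof -
    from multigraph_ends[OF mG e(1)] obtain a b where "ends G e = {a, b}" "a \<noteq> b" "a \<in> verts G" "b \<in> verts G" .
    then show ?thesis using e(2) by auto
  qed
  have e1: "e1 \<in> edges G" "p \<in> ends G e1" and e2: "e2 \<in> edges G" "p \<in> ends G e2" using e12 by auto
  obtain c where c: "ends G e1 = {p, c}" "c \<noteq> p" "c \<in> verts G" using other[OF e1] by auto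
  obtain d where d: "ends G e2 = {p, d}" "d \<noteq> p" "d \<in> verts G" using other[OF e2] by auto
  have nb: "r = c \<or> r = d" if "adj G r p" for r
  proof -
    from that obtain e where e: "e \<in> edges G" "ends G e = {r, p}" by (auto simp: adj_def)
    then have "e = e1 \<or> e = e2" using e12 by auto
    then show ?thesis using e c d by (auto simp: doubleton_eq_iff)
  qed
  have cd: "c \<noteq> d"
  proof
    assume "c = d"
    have "{p} = verts G - {c}"
    proof (rule connD[OF two_connected_conn_remove[OF G c(3)]])
      fix a b assume "a \<in> {p}" "b \<in> verts G - {c}" "adj G a b"
      then show "b \<in> {p}" using nb[of b] \<open>c = d\<close> adj_commute[of G b p] by auto
    qed (use p c in auto)
    then have "verts G = {p, c}" using c by auto
    then show False using n c(2) by (simp add: card_insert_if)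
  qed
  let ?S = "verts G - {p}"
  have "(\<exists>T a b. block_at G T a b) \<or>
    (\<exists>vs es. is_path G vs es \<and> set vs = ?S \<and> set es = edges_within G ?S \<and> hd vs = c \<and> last vs = d)"
  proof (rule path_or_block[OF G])
    show "conn G ?S" by (rule two_connected_conn_remove[OF G p])
    show "attached_at G ?S c d" using nb p by (auto simp: attached_at_def)
  qed (use c d cd p in auto)
  then show ?thesis
  proof
    assume "\<exists>vs es. is_path G vs es \<and> set vs = ?S \<and> set es = edges_within G ?S \<and> hd vs = c \<and> last vs = d"
    then obtain vs es where vs: "is_path G vs es" "set vs = ?S" "set es = edges_within G ?S"
      "hd vs = c" "last vs = d" by blast
    have l: "length vs = Suc (length es)" "distinct vs"
      "\<forall>i<length es. ends G (es ! i) = {vs ! i, vs ! Suc i}" using vs(1) by (auto simp: is_path_def)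
    have vs0: "vs ! 0 = c" "vs ! length es = d"
      using vs(4,5) l by (metis hd_conv_nth length_0_conv nat.distinct(1), metis last_conv_nth length_0_conv nat.distinct(1) diff_Suc_1)
    have es: "es \<noteq> []"
    proof
      assume "es = []"
      then show False using vs0 cd by simp
    qed
    \<comment> \<open>The cycle starts at \<open>p\<close>: \<open>e1\<close> leads to
      \<open>c\<close>, the path to \<open>d\<close>, and \<open>e2\<close> closes it.\<close>
    let ?vs = "p # vs" and ?es = "e1 # es @ [e2]"
    have "edges G = insert e1 (insert e2 (edges_within G ?S))"
    proof -
      have "e \<in> {e1, e2} \<or> ends G e \<subseteq> ?S" if "e \<in> edges G" for e
        using that e12 mG by (auto simp: multigraph_def)
      then show ?thesis using e1 e2 by (auto simp: edges_within_def)
    qed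
    moreover have "e1 \<notin> edges_within G ?S" "e2 \<notin> edges_within G ?S"
      using c d by (auto simp: edges_within_def)
    moreover have "ends G (?es ! i) = {?vs ! i, ?vs ! (Suc i mod length ?vs)}" if i: "i < length ?vs" for i
    proof -
      consider "i = 0" | j where "i = Suc j" "j < length es" | "i = Suc (length es)"
        using i l by (cases i) (auto simp: less_Suc_eq)
      then show ?thesis
      proof cases
        case 1
        then show ?thesis using c vs0 l es by simp
      next
        case 2
        then show ?thesis using l by (simp add: nth_append)
      next
        case 3
        then show ?thesis using d vs0 l by (simp add: nth_append insert_commute)
      qed
    qed
    ultimately have "hamilton_cycle G ?vs ?es"
      unfolding hamilton_cycle_def
      using l vs(2,3) p e12(2) is_path_distinct_edges[OF vs(1)] es by (auto simp: Suc_le_eq)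
    then show ?thesis by blast
  qed simp
qed

text \<open>Two vertices joined by parallel edges are two-connected, and every set of two vertices
  is attached at these two.\<close>

lemma parallel_block:
  assumes G: "two_connected G" and n: "3 \<le> card (verts G)"
    and e: "e \<in> edges G" "f \<in> edges G" "e \<noteq> f" "ends G e = ends G f"
  shows "\<exists>T a b. block_at G T a b"
proof -
  note mG = two_connected_multigraph[OF G]
  from multigraph_ends[OF mG e(1)] obtain a b where ab: "ends G e = {a, b}" "a \<noteq> b" "a \<in> verts G" "b \<in> verts G" .
  have fin: "finite (edges_within G {a, b})" using two_connected_finite[OF G] by (auto simp: edges_within_def)
  have "{e, f} \<subseteq> edges_within G {a, b}" using e ab by (auto simp: edges_within_def)
  then have "card {e, f} \<le> card (edges_within G {a, b})" using fin by (rule card_mono[rotated])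
  then have "two_connected (induced G {a, b})"
    using ab e(3) by (subst two_connected_induced_iff[OF mG]) auto
  moreover have "card {a, b} = 2" using ab by simp
  then have "{a, b} \<noteq> verts G" using n by fastforce
  ultimately have "block_at G {a, b} a b" using ab by (auto simp: block_at_def attached_at_def)
  then show ?thesis by blast
qed

text \<open>On three vertices, without parallel edges, \<open>x\<close> has degree at most two.
  Otherwise some \<open>y\<close> separates \<open>G - x\<close>; one part together with
  \<open>x\<close> and \<open>y\<close> is attached at these two, so it contains a block or is a
  path, and an inner vertex of this path has degree two in \<open>G\<close>.\<close>

lemma block_or_cycle_separated:
  assumes G: "two_connected G" and n: "3 \<le> card (verts G)" and x: "x \<in> verts G"
    and nt: "\<not> two_connected (induced G (verts G - {x}))"
  shows "(\<exists>T a b. block_at G T a b) \<or> (\<exists>vs es. hamilton_cycle G vs es)"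
proof (cases "card (verts G) = 3")
  case True
  note mG = two_connected_multigraph[OF G]
  have fin: "finite (verts G)" "finite (edges G)" using two_connected_finite[OF G] by auto
  show ?thesis
  proof (cases "\<exists>e\<in>edges G. \<exists>f\<in>edges G. e \<noteq> f \<and> ends G e = ends G f")
    case True
    then show ?thesis using parallel_block[OF G n] by blast
  next
    case False
    then have inj: "inj_on (ends G) {e \<in> edges G. x \<in> ends G e}" by (auto simp: inj_on_def)
    have "ends G ` {e \<in> edges G. x \<in> ends G e} \<subseteq> (\<lambda>s. {x, s}) ` (verts G - {x})"
    proof (rule image_subsetI)
      fix e assume e: "e \<in> {e \<in> edges G. x \<in> ends G e}"
      then obtain a b where "ends G e = {a, b}" "a \<noteq> b" "a \<in> verts G" "b \<in> verts G"
        using multigraph_ends[OF mG, of e] by blast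
      then show "ends G e \<in> (\<lambda>s. {x, s}) ` (verts G - {x})" using e by (auto simp: insert_commute)
    qed
    then have "card (ends G ` {e \<in> edges G. x \<in> ends G e}) \<le> card ((\<lambda>s. {x, s}) ` (verts G - {x}))"
      using fin by (intro card_mono) auto
    then have "card {e \<in> edges G. x \<in> ends G e} \<le> card ((\<lambda>s. {x, s}) ` (verts G - {x}))"
      by (simp only: card_image[OF inj])
    also have "\<dots> \<le> card (verts G - {x})" using fin by (intro card_image_le) simp
    also have "\<dots> = 2" using \<open>card (verts G) = 3\<close> x fin by simp
    finally show ?thesis using block_or_cycle_degree2[OF G n x] by simp
  qed
next
  case False
  note mG = two_connected_multigraph[OF G]
  have fin: "finite (verts G)" "finite (edges G)" using two_connected_finite[OF G] by auto
  have "3 \<le> card (verts G - {x})" using n False x fin by simp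
  then obtain y where y: "y \<in> verts G - {x}" "\<not> conn G (verts G - {x} - {y})"
    using nt by (auto simp: two_connected_induced_iff[OF mG])
  have "verts G - {x} - {y} \<noteq> {}"
  proof
    assume "verts G - {x} - {y} = {}"
    then have "verts G = {x, y}" using x y by auto
    then show False using n by (simp add: card_insert_if split: if_splits)
  qed
  with y(2) obtain A B where A: "A \<union> B = verts G - {x} - {y}" "A \<inter> B = {}" "A \<noteq> {}" "B \<noteq> {}"
    "\<forall>p\<in>A. \<forall>q\<in>B. \<not> adj G p q \<and> \<not> adj G q p" by (rule not_connE)
  have xyA: "x \<notin> A" "y \<notin> A" "x \<noteq> y" "y \<in> verts G" "A \<subseteq> verts G" using A(1) y by auto
  have nb: "s \<in> A \<or> s = x \<or> s = y" if "r \<in> A" "s \<in> verts G" "adj G r s" for r s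
    using that A(1,5) by blast
  have "conn G ({x} \<union> A)"
    by (rule conn_add_attached[OF G, where z = y]) (use xyA x nb in auto)
  moreover have "conn G ({y} \<union> A)"
    by (rule conn_add_attached[OF G, where z = x]) (use xyA x nb in auto)
  moreover have "({x} \<union> A) \<inter> ({y} \<union> A) \<noteq> {}" using A(3) by auto
  ultimately have "conn G (({x} \<union> A) \<union> ({y} \<union> A))" by (rule conn_Un)
  moreover have "({x} \<union> A) \<union> ({y} \<union> A) = insert x (insert y A)" by auto
  ultimately have cS: "conn G (insert x (insert y A))" by simp
  let ?S = "insert x (insert y A)"
  have "(\<exists>T a b. block_at G T a b) \<or>
    (\<exists>vs es. is_path G vs es \<and> set vs = ?S \<and> set es = edges_within G ?S \<and> hd vs = x \<and> last vs = y)"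
  proof (rule path_or_block[OF G _ _ _ _ cS])
    show "attached_at G ?S x y" using nb by (auto simp: attached_at_def)
    show "?S \<subset> verts G" using A xyA x by auto
  qed (use xyA in auto)
  then show ?thesis
  proof
    assume "\<exists>vs es. is_path G vs es \<and> set vs = ?S \<and> set es = edges_within G ?S \<and> hd vs = x \<and> last vs = y"
    then obtain vs es where vs: "is_path G vs es" "set vs = ?S" "set es = edges_within G ?S"
      "hd vs = x" "last vs = y" by blast
    have l: "length vs = Suc (length es)" "distinct vs"
      "\<forall>i<length es. ends G (es ! i) = {vs ! i, vs ! Suc i}" using vs(1) by (auto simp: is_path_def)
    have vs0: "vs ! 0 = x" "vs ! length es = y"
      using vs(4,5) l by (metis hd_conv_nth length_0_conv nat.distinct(1), metis last_conv_nth length_0_conv nat.distinct(1) diff_Suc_1)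
    have "card ?S = Suc (Suc (card A))" using xyA fin finite_subset[of A "verts G"] by simp
    moreover have "0 < card A" using A(3) xyA fin finite_subset[of A "verts G"] by (simp add: card_gt_0_iff)
    moreover have "card ?S = length vs" using vs(2) l(2) distinct_card by metis
    ultimately have le: "2 \<le> length es" using l by linarith
    then have "es \<noteq> []" by auto
    \<comment> \<open>An inner vertex, since the path has at least two edges; all its edges stay
      within the path.\<close>
    define p where "p = vs ! 1"
    have px: "p \<noteq> x" "p \<noteq> y"
      using nth_eq_iff_index_eq[OF l(2), of 1 0] nth_eq_iff_index_eq[OF l(2), of 1 "length es"] l(1) le vs0 \<open>es \<noteq> []\<close>
      by (auto simp: p_def)
    have pS: "p \<in> ?S" using vs(2) l(1) le by (metis One_nat_def Suc_le_lessD le_imp_less_Suc less_imp_le_nat nth_mem numeral_2_eq_2 p_def)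
    then have pA: "p \<in> A" using px by auto
    have "{e \<in> edges G. p \<in> ends G e} \<subseteq> {es ! 0, es ! 1}"
    proof
      fix e assume e: "e \<in> {e \<in> edges G. p \<in> ends G e}"
      then obtain a b where ab: "ends G e = {a, b}" "a \<noteq> b" "a \<in> verts G" "b \<in> verts G"
        using multigraph_ends[OF mG, of e] by blast
      then have "adj G a b" "adj G b a" using e by (auto simp: adj_def insert_commute)
      then have "ends G e \<subseteq> ?S" using nb[of a b] nb[of b a] e ab pA by auto
      then have "e \<in> set es" using e vs(3) by (auto simp: edges_within_def)
      then obtain i where i: "i < length es" "e = es ! i" by (auto simp: in_set_conv_nth)
      then have "p = vs ! i \<or> p = vs ! Suc i" using l(3) e by auto
      then have "i = 1 \<or> i = 0"
        using \<open>es \<noteq> []\<close> i l(1) le nth_eq_iff_index_eq[OF l(2), of 1 i] nth_eq_iff_index_eq[OF l(2), of 1 "Suc i"]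
        by (auto simp: p_def)
      then show "e \<in> {es ! 0, es ! 1}" using i by auto
    qed
    then have "card {e \<in> edges G. p \<in> ends G e} \<le> card {es ! 0, es ! 1}" by (intro card_mono) auto
    also have "\<dots> \<le> 2" by (simp add: card_insert_if)
    finally show ?thesis using block_or_cycle_degree2[OF G n, of p] pA xyA by auto
  qed simp
qed

text \<open>Balance enters through the vertex count: if all vertex-deleted graphs are two-connected,
  three vertices remain, and any two of them form a block.\<close>

lemma good_flat_or_cycle:
  assumes G: "two_connected G" and w: "balanced \<delta> G w" and \<delta>: "2 < \<delta>" and n: "3 \<le> card (verts G)"
  shows "(\<exists>S a b. good_flat G S \<and> block_at G S a b) \<or> (\<exists>vs es. hamilton_cycle G vs es)"
proof -
  have "(\<exists>T a b. block_at G T a b) \<or> (\<exists>vs es. hamilton_cycle G vs es)"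
  proof (cases "\<forall>x\<in>verts G. two_connected (induced G (verts G - {x}))")
    case True
    have c3: "card (verts G) = 3" by (rule all_vertex_deleted_two_connected[OF G w \<delta> n]) (use True in auto)
    then obtain x where x: "x \<in> verts G" by fastforce
    have "card (verts G - {x}) = 2" using c3 x by simp
    then obtain a b where ab: "verts G - {x} = {a, b}" "a \<noteq> b" by (meson card_2_iff)
    have "block_at G (verts G - {x}) a b"
      unfolding block_at_def attached_at_def using True x ab by auto
    then show ?thesis by blast
  next
    case False
    then show ?thesis using block_or_cycle_separated[OF G n] by blast
  qed
  then show ?thesis using block_extends_to_good_flat[OF G] by blast
qed

section \<open>Cycles and bonds\<close>

lemma hamilton_cycle_degree:
  assumes H: "hamilton_cycle G vs es" and v: "v \<in> verts G"
  shows "card {e \<in> edges G. v \<in> ends G e} \<le> 2"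
proof -
  let ?n = "length vs"
  have h: "length es = ?n" "3 \<le> ?n" "distinct vs" "set vs = verts G" "set es = edges G"
    "\<And>i. i < ?n \<Longrightarrow> ends G (es ! i) = {vs ! i, vs ! (Suc i mod ?n)}"
    using H by (auto simp: hamilton_cycle_def)
  obtain i where i: "i < ?n" "v = vs ! i" using v h(4) by (metis in_set_conv_nth)
  \<comment> \<open>Edge \<open>i\<close> leaves vertex \<open>i\<close>; the other edge at it has
    the cyclic predecessor of \<open>i\<close> as its index.\<close>
  have "{e \<in> edges G. v \<in> ends G e} \<subseteq> {es ! i, es ! ((i + ?n - 1) mod ?n)}"
  proof
    fix e assume e: "e \<in> {e \<in> edges G. v \<in> ends G e}"
    then have "e \<in> set es" using h(5) by simp
    then obtain j where j: "j < ?n" "e = es ! j" using h(1) by (metis in_set_conv_nth)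
    then have "vs ! i = vs ! j \<or> vs ! i = vs ! (Suc j mod ?n)" using e h(6)[OF j(1)] i by auto
    moreover have "Suc j mod ?n < ?n" using h(2) by (intro mod_less_divisor) linarith
    ultimately have "i = j \<or> i = Suc j mod ?n" using nth_eq_iff_index_eq[OF h(3)] i(1) j(1) by metis
    moreover have "j = (Suc j mod ?n + ?n - 1) mod ?n"
      using j(1) by (cases "Suc j = ?n") auto
    ultimately show "e \<in> {es ! i, es ! ((i + ?n - 1) mod ?n)}" using j(2) by auto
  qed
  then have "card {e \<in> edges G. v \<in> ends G e} \<le> card {es ! i, es ! ((i + ?n - 1) mod ?n)}"
    by (intro card_mono) auto
  also have "\<dots> \<le> 2" by (simp add: card_insert_if)
  finally show ?thesis .
qed

text \<open>A two-connected induced subgraph uses two edges at each of its vertices, hence all of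
  them, so no edge leaves it. Deleting an edge leaves an end of degree at most one.\<close>

lemma degree_two_no_proper_two_connected:
  assumes G: "two_connected G" and deg: "\<And>v. v \<in> verts G \<Longrightarrow> card {e \<in> edges G. v \<in> ends G e} \<le> 2"
  shows "S \<subset> verts G \<Longrightarrow> \<not> two_connected (induced G S)"
    "e \<in> edges G \<Longrightarrow> \<not> two_connected (delete_edges G {e})"
proof -
  note mG = two_connected_multigraph[OF G]
  have fin: "finite (edges G)" using two_connected_finite[OF G] by auto
  show "\<not> two_connected (induced G S)" if S: "S \<subset> verts G"
  proof
    assume t: "two_connected (induced G S)"
    have "S = verts G"
    proof (rule connD[OF two_connected_conn[OF G]])
      fix a b assume ab: "a \<in> S" "b \<in> verts G" "adj G a b"
      then obtain e where e: "e \<in> edges G" "ends G e = {a, b}" by (auto simp: adj_def)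
      let ?A = "{e \<in> edges_within G S. a \<in> ends G e}" and ?B = "{e \<in> edges G. a \<in> ends G e}"
      have "2 \<le> card ?A" using two_connected_degree[OF t, of a] ab by simp
      moreover have "card ?B \<le> 2" using deg ab S by auto
      moreover have "?A \<subseteq> ?B" by (auto simp: edges_within_def)
      ultimately have "?A = ?B" using card_seteq[of ?B ?A] fin by simp
      then have "e \<in> ?A" using e by auto
      then show "b \<in> S" using e by (auto simp: edges_within_def)
    next
      show "S \<noteq> {}" using two_connected_card[OF t] by auto
    qed (use S in auto)
    then show False using S by simp
  qed
  show "\<not> two_connected (delete_edges G {e})" if e: "e \<in> edges G"
  proof
    assume t: "two_connected (delete_edges G {e})"
    from multigraph_ends[OF mG e] obtain a b where ab: "ends G e = {a, b}" "a \<in> verts G" by metis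
    have "{f \<in> edges G - {e}. a \<in> ends G f} = {f \<in> edges G. a \<in> ends G f} - {e}" by auto
    then have "2 \<le> card ({f \<in> edges G. a \<in> ends G f} - {e})"
      using two_connected_degree[OF t, of a] ab by simp
    also have "\<dots> < card {f \<in> edges G. a \<in> ends G f}"
      using e ab fin by (intro card_Diff1_less) auto
    finally show False using deg[OF ab(2)] by simp
  qed
qed

lemma sum_two_values:
  assumes "finite F" "\<And>e. e \<in> F \<Longrightarrow> w e \<in> {1, \<delta> - 1 :: nat}"
  obtains k m where "k = card {e \<in> F. w e = 1}" "m = card {e \<in> F. w e \<noteq> 1}"
    "card F = k + m" "sum w F = k + m * (\<delta> - 1)"
proof -
  let ?A = "{e \<in> F. w e = 1}" and ?B = "{e \<in> F. w e \<noteq> 1}"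
  have F: "F = ?A \<union> ?B" "?A \<inter> ?B = {}" "finite ?A" "finite ?B" using assms(1) by auto
  have c: "card F = card ?A + card ?B" using card_Un_disjoint[OF F(3,4,2)] F(1) by simp
  have "sum w F = sum w ?A + sum w ?B" using sum.union_disjoint[OF F(3,4,2), of w] F(1) by simp
  moreover have "sum w ?A = card ?A" by simp
  moreover have "sum w ?B = (\<Sum>e\<in>?B. \<delta> - 1)" using assms(2) by (intro sum.cong) auto
  ultimately have "sum w F = card ?A + card ?B * (\<delta> - 1)" by simp
  with c show thesis by (rule that[OF refl refl])
qed

text \<open>With k edges of weight 1 and m of weight \<delta> - 1, the total gives \<delta> =
  (\<delta> - 1) * k + m. The value k = 1 would leave only two edges and k > 1 exceeds \<delta>, so
  k = 0 and m = \<delta>.\<close>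

lemma hamilton_cycle_balanced:
  assumes G: "two_connected G" and H: "hamilton_cycle G vs es" and w: "balanced \<delta> G w" and \<delta>: "2 < \<delta>"
  shows "length vs = \<delta>" "weight_function \<delta> G w"
proof -
  have fin: "finite (edges G)" using two_connected_finite[OF G] by auto
  have cV: "card (verts G) = length vs" "card (edges G) = length vs" "3 \<le> length vs"
    using H distinct_card[of vs] distinct_card[of es] by (auto simp: hamilton_cycle_def)
  obtain k m where km: "k = card {e \<in> edges G. w e = 1}" "card (edges G) = k + m"
    "sum w (edges G) = k + m * (\<delta> - 1)"
    using sum_two_values[OF fin, of w \<delta>] w by (auto simp: balanced_def)
  define d where "d = \<delta> - 3"
  have d: "\<delta> = d + 3" using \<delta> by (simp add: d_def)
  have "k + m * (\<delta> - 1) = \<delta> * (k + m - 1)" using km w cV by (simp add: balanced_def)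
  then have "k + m * (\<delta> - 1) + \<delta> = \<delta> * (k + m)"
    using cV km(2) by (metis add.commute add_leD2 le_add_diff_inverse2 mult_Suc_right numeral_3_eq_3 plus_1_eq_Suc)
  then have eq: "d + 3 = (d + 2) * k + m" unfolding d by (simp add: algebra_simps)
  have k0: "k = 0"
  proof (rule ccontr)
    assume "k \<noteq> 0"
    then consider "k = 1" | j where "k = j + 2"
      by (metis One_nat_def add_2_eq_Suc' not0_implies_Suc)
    then show False
    proof cases
      case 1
      then show False using eq cV km by simp
    next
      case 2
      then show False using eq by (simp add: algebra_simps)
    qed
  qed
  then show "length vs = \<delta>" using eq d km cV by simp
  have "{e \<in> edges G. w e = 1} = {}" using k0 km(1) fin by simp
  then have "w e = \<delta> - 1" if "e \<in> edges G" for e using w that by (auto simp: balanced_def)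
  then show "weight_function \<delta> G w"
    using degree_two_no_proper_two_connected(2)[OF G hamilton_cycle_degree[OF H]]
    by (auto simp: weight_function_def)
qed

text \<open>A cycle has no good flats and no deletable edges, so constant weight \<delta> - 1 works;
  \<delta> edges give the right total.\<close>

lemma hamilton_cycle_spade:
  assumes G: "two_connected G" and H: "hamilton_cycle G vs es" and n: "length vs = \<delta>"
  shows "spade \<delta> G"
proof -
  note no = degree_two_no_proper_two_connected[OF G hamilton_cycle_degree[OF H]]
  have c: "card (verts G) = \<delta>" "card (edges G) = \<delta>"
    using H n distinct_card[of vs] distinct_card[of es] by (auto simp: hamilton_cycle_def)
  have "weight_function \<delta> G (\<lambda>_. \<delta> - 1)" using no(2) by (auto simp: weight_function_def)
  moreover have "balanced \<delta> G (\<lambda>_. \<delta> - 1)"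
    using no(1) good_flatD[of G] c by (auto simp: balanced_def)
  ultimately show ?thesis unfolding spade_iff by blast
qed

lemma cycle_multigraph_sel [simp]:
  "verts (cycle_multigraph n) = {..<n}" "edges (cycle_multigraph n) = {..<n}"
  "ends (cycle_multigraph n) i = {i, Suc i mod n}"
  by (simp_all add: cycle_multigraph_def)

lemma multigraph_cycle: "2 \<le> n \<Longrightarrow> multigraph (cycle_multigraph n)"
  by (auto simp: multigraph_def card_insert_if mod_Suc)

lemma hamilton_cycle_cycle: "3 \<le> n \<Longrightarrow> hamilton_cycle (cycle_multigraph n) [0..<n] [0..<n]"
  by (auto simp: hamilton_cycle_def)

lemma hamilton_cycle_iso:
  assumes "hamilton_cycle G vs es"
  shows "G \<simeq>\<^sub>m cycle_multigraph (length vs)"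
proof -
  have h: "length es = length vs" "3 \<le> length vs" "distinct vs" "distinct es" "set vs = verts G" "set es = edges G"
    "\<And>i. i < length vs \<Longrightarrow> ends G (es ! i) = {vs ! i, vs ! (Suc i mod length vs)}"
    using assms by (auto simp: hamilton_cycle_def)
  have "iso_via ((!) vs) ((!) es) (cycle_multigraph (length vs)) G"
    using h bij_betw_nth[OF h(3), of "{..<length vs}" "verts G"]
      bij_betw_nth[OF h(4), of "{..<length vs}" "edges G"]
    by (simp add: iso_via_def)
  then show ?thesis
    using multigraph_iso_sym[OF multigraph_cycle] h(2) unfolding multigraph_iso_iff
    by (metis One_nat_def Suc_1 Suc_leD numeral_3_eq_3)
qed

lemma two_connected_cycle:
  assumes n: "3 \<le> n"
  shows "two_connected (cycle_multigraph n)"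
proof -
  let ?C = "cycle_multigraph n"
  have m: "multigraph ?C" using multigraph_cycle n by simp
  have "conn ?C ({..<n} - {v})" if v: "v < n" for v
  proof -
    \<comment> \<open>The remaining vertices in cyclic order, starting behind
      \<open>v\<close>.\<close>
    let ?xs = "map (\<lambda>j. (v + 1 + j) mod n) [0..<n - 1]"
    have "conn ?C (set ?xs)"
    proof (rule conn_path)
      show "?xs \<noteq> []" using n by simp
      fix i assume i: "Suc i < length ?xs"
      then have "?xs ! i = (v + 1 + i) mod n" "?xs ! Suc i = Suc ((v + 1 + i) mod n) mod n"
        by (simp_all add: mod_Suc_eq)
      moreover have "(v + 1 + i) mod n < n" using n by simp
      ultimately show "adj ?C (?xs ! i) (?xs ! Suc i)" by (auto simp: adj_def)
    qed
    moreover have "set ?xs = {..<n} - {v}"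
    proof (intro subset_antisym subsetI)
      fix u assume "u \<in> set ?xs"
      then obtain j where j: "j < n - 1" "u = (v + 1 + j) mod n" by auto
      show "u \<in> {..<n} - {v}"
      proof (cases "v + 1 + j < n")
        case True
        then show ?thesis using j by simp
      next
        case False
        then have "u = v + 1 + j - n" using j v n by (simp add: mod_if)
        then show ?thesis using False j v n by auto
      qed
    next
      fix u assume u: "u \<in> {..<n} - {v}"
      show "u \<in> set ?xs"
      proof (cases "v < u")
        case True
        then have "u = (v + 1 + (u - v - 1)) mod n" "u - v - 1 < n - 1" using u by auto
        then show ?thesis by (auto intro!: image_eqI)
      next
        case False
        then have "u = (v + 1 + (n - v - 1 + u)) mod n" "n - v - 1 + u < n - 1" using u v by auto
        then show ?thesis by (auto intro!: image_eqI)
      qed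
    qed
    ultimately show ?thesis by simp
  qed
  then show ?thesis using n by (simp add: two_connected_iff[OF m])
qed

section \<open>Graphs on two vertices\<close>

lemma bond_no_good_flat:
  assumes "card (verts G) = 2"
  shows "\<not> good_flat G S"
proof
  assume S: "good_flat G S"
  have "finite (verts G)" using assms by (metis card.infinite zero_neq_numeral)
  then have "card S < card (verts G)" using good_flatD(1)[OF S] psubset_card_mono by blast
  moreover have "2 \<le> card S" using two_connected_card[OF good_flatD(2)[OF S]] by simp
  ultimately show False using assms by simp
qed

lemma bond_contract:
  assumes "two_connected G" "card (verts G) = 2" "e \<in> edges G"
  shows "\<not> two_connected (contract G {e})"
  using two_connected_contract_edge_iff[OF assms(1,3)] assms(2) by simp

lemma two_edges_delete:
  assumes "card (edges G) = 2" "e \<in> edges G"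
  shows "\<not> two_connected (delete_edges G {e})"
proof
  assume "two_connected (delete_edges G {e})"
  then have "2 \<le> card (edges G - {e})" using two_connected_card_edges by fastforce
  moreover have "finite (edges G)" using assms by (metis card.infinite zero_neq_numeral)
  ultimately show False using assms by simp
qed

text \<open>Deleting an edge leaves one edge and contracting one leaves one vertex, so both
  conditions on weights are vacuous.\<close>

lemma digon_weight_function:
  assumes "two_connected G" "card (verts G) = 2" "card (edges G) = 2"
    "\<And>e. e \<in> edges G \<Longrightarrow> w e \<in> {1, \<delta> - 1}"
  shows "weight_function \<delta> G w"
  using bond_contract[OF assms(1,2)] two_edges_delete[OF assms(3)] assms(4)
  by (simp add: weight_function_def)

lemma bond_weight_function:
  assumes "two_connected G" "card (verts G) = 2" "\<And>e. e \<in> edges G \<Longrightarrow> w e = 1"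
  shows "weight_function \<delta> G w"
  using bond_contract[OF assms(1,2)] assms(3) by (simp add: weight_function_def)

text \<open>With k edges of weight 1 and m others, k + m * (\<delta> - 1) = \<delta> has only the
  solutions m = 0, k = \<delta> and m = k = 1.\<close>

lemma bond_balanced:
  assumes G: "two_connected G" "card (verts G) = 2" and w: "balanced \<delta> G w" and \<delta>: "2 < \<delta>"
  shows "card (edges G) = 2 \<or> card (edges G) = \<delta>" "weight_function \<delta> G w"
proof -
  have fin: "finite (edges G)" using two_connected_finite[OF G(1)] by auto
  have rng: "w e \<in> {1, \<delta> - 1}" if "e \<in> edges G" for e using w that by (simp add: balanced_def)
  obtain k m where km: "k = card {e \<in> edges G. w e = 1}" "m = card {e \<in> edges G. w e \<noteq> 1}"
    "card (edges G) = k + m" "sum w (edges G) = k + m * (\<delta> - 1)"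
    by (rule sum_two_values[OF fin rng])
  have eq: "k + m * (\<delta> - 1) = \<delta>" using w km G(2) by (simp add: balanced_def)
  consider "m = 0" | "m = 1" | j where "m = j + 2" by (metis One_nat_def add_2_eq_Suc' not0_implies_Suc)
  then have "(m = 0 \<and> k = \<delta>) \<or> (m = 1 \<and> k = 1)"
  proof cases
    case 3
    then have "2 * (\<delta> - 1) \<le> m * (\<delta> - 1)" by simp
    then have False using eq \<delta> by linarith
    then show ?thesis ..
  qed (use eq \<delta> in auto)
  then show "card (edges G) = 2 \<or> card (edges G) = \<delta>" "weight_function \<delta> G w"
    using km(2,3) fin digon_weight_function[OF G _ rng] bond_weight_function[OF G, of w \<delta>] by auto
qed

text \<open>Both admissible weights can be prescribed on \<open>e\<close>, since the complement to
  \<delta> is the other admissible value.\<close>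

lemma digon_spade:
  assumes G: "two_connected G" "card (verts G) = 2" "card (edges G) = 2" and \<delta>: "2 < \<delta>"
    and e: "e \<in> edges G" and k: "k \<in> {1, \<delta> - 1}"
  shows "\<exists>w. weight_function \<delta> G w \<and> balanced \<delta> G w \<and> w e = k"
proof -
  let ?w = "\<lambda>f. if f = e then k else \<delta> - k"
  obtain f where f: "edges G = {e, f}" "f \<noteq> e" using G(3) e by (metis card_2_iff doubleton_eq_iff insert_iff singletonD)
  have kk: "k \<le> \<delta>" "\<delta> - k \<in> {1, \<delta> - 1}" using k \<delta> by auto
  have "weight_function \<delta> G ?w" by (rule digon_weight_function[OF G]) (use k kk in auto)
  moreover have "balanced \<delta> G ?w"
    using bond_no_good_flat[OF G(2)] f k kk G(2) by (auto simp: balanced_def)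
  ultimately show ?thesis by (intro exI[of _ ?w]) simp
qed

lemma bond_spade:
  assumes G: "two_connected G" "card (verts G) = 2" "card (edges G) = \<delta>"
  shows "weight_function \<delta> G (\<lambda>_. 1)" "balanced \<delta> G (\<lambda>_. 1)"
  using bond_weight_function[OF G(1,2)] bond_no_good_flat[OF G(2)] G by (auto simp: balanced_def)

section \<open>Spade graphs are constructible\<close>

text \<open>The effect of the identification in \<open>glue\<close> on the right copy.
  \<open>y\<^sub>2\<close> is tested first because its update is the outer one.\<close>

definition merge :: "'v \<Rightarrow> 'v \<Rightarrow> 'w \<Rightarrow> 'w \<Rightarrow> 'w \<Rightarrow> 'v + 'w" where
  "merge x\<^sub>1 y\<^sub>1 x\<^sub>2 y\<^sub>2 v = (if v = y\<^sub>2 then Inl y\<^sub>1 else if v = x\<^sub>2 then Inl x\<^sub>1 else Inr v)"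

lemma glue_sel:
  "verts (glue G x\<^sub>1 y\<^sub>1 H x\<^sub>2 y\<^sub>2) = Inl ` verts G \<union> merge x\<^sub>1 y\<^sub>1 x\<^sub>2 y\<^sub>2 ` verts H"
  "edges (glue G x\<^sub>1 y\<^sub>1 H x\<^sub>2 y\<^sub>2) = Inl ` edges G \<union> Inr ` edges H"
  "ends (glue G x\<^sub>1 y\<^sub>1 H x\<^sub>2 y\<^sub>2) (Inl e) = Inl ` ends G e"
  "ends (glue G x\<^sub>1 y\<^sub>1 H x\<^sub>2 y\<^sub>2) (Inr f) = merge x\<^sub>1 y\<^sub>1 x\<^sub>2 y\<^sub>2 ` ends H f"
  by (auto simp: glue_def identify_vertices_def disjoint_union_def merge_def image_Un image_image
      intro!: image_cong)

text \<open>Vertices of \<open>VP\<close> go to the left copy and the others to the right. On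
  \<open>VQ\<close> this agrees with \<open>merge\<close>, as \<open>x\<close> and \<open>y\<close>
  are the only shared vertices and are identified in this order.\<close>

lemma (in two_sep) glue_iso:
  assumes 1: "iso_via f1 g1 sideP K1" and 2: "iso_via f2 g2 sideQ K2"
  shows "G \<simeq>\<^sub>m delete_edges (glue K1 (f1 x) (f1 y) K2 (f2 x) (f2 y)) {Inl (g1 None), Inr (g2 None)}"
    (is "G \<simeq>\<^sub>m ?H")
proof -
  interpret S: two_sep G VQ VP Q P x y by (rule swap)
  note s1 = iso_simps[OF multigraph_sideP 1] and s2 = iso_simps[OF S.multigraph_sideP 2]
  let ?m = "merge (f1 x) (f1 y) (f2 x) (f2 y)"
  define F where "F = (\<lambda>v. if v \<in> VP then Inl (f1 v) else Inr (f2 v))"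
  define g where "g = (\<lambda>e. if e \<in> P then Inl (g1 (Some e)) else Inr (g2 (Some e)))"
  have i1: "inj_on f1 VP" and i2: "inj_on f2 VQ" using s1(1) s2(1) by auto
  have FQ: "F v = ?m (f2 v)" if "v \<in> VQ" for v
  proof (cases "v = x \<or> v = y")
    case True
    then show ?thesis using xyV xy inj_on_eq_iff[OF i2, of x y] by (auto simp: F_def merge_def)
  next
    case False
    then have "v \<notin> VP" using inter that by blast
    moreover have "f2 v \<noteq> f2 x" "f2 v \<noteq> f2 y" using False that xyV inj_on_eq_iff[OF i2] by auto
    ultimately show ?thesis by (simp add: F_def merge_def)
  qed
  have FP: "F v = Inl (f1 v)" if "v \<in> VP" for v using that by (simp add: F_def)
  have "inj_on F (verts G)"
    using V i1 i2 by (auto simp: F_def inj_on_def)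
  moreover have "F ` verts G = verts ?H"
  proof -
    have "F ` verts G = F ` VP \<union> F ` VQ" using V by (simp add: image_Un)
    also have "F ` VP = Inl ` f1 ` VP" unfolding image_image by (rule image_cong) (simp_all add: FP)
    also have "F ` VQ = ?m ` f2 ` VQ" unfolding image_image by (rule image_cong) (simp_all add: FQ)
    finally show ?thesis using s1(2) s2(2) by (simp add: glue_sel)
  qed
  moreover have "inj_on g (edges G)"
    using E s1(3) s2(3) by (auto simp: g_def inj_on_def)
  moreover have "g ` edges G = edges ?H"
  proof -
    have "g ` edges G = g ` P \<union> g ` Q" using E by (simp add: image_Un)
    also have "g ` P = (\<lambda>e. Inl (g1 (Some e))) ` P" by (rule image_cong) (simp_all add: g_def)
    also have "g ` Q = (\<lambda>e. Inr (g2 (Some e))) ` Q" using PQ by (intro image_cong) (auto simp: g_def)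
    also have "(\<lambda>e. Inl (g1 (Some e))) ` P \<union> (\<lambda>e. Inr (g2 (Some e))) ` Q = edges ?H"
    proof -
      have "g1 None \<notin> g1 ` Some ` P"
        using inj_on_image_mem_iff[OF s1(3), of None "Some ` P"] by auto
      moreover have "g2 None \<notin> g2 ` Some ` Q"
        using inj_on_image_mem_iff[OF s2(3), of None "Some ` Q"] by auto
      ultimately show ?thesis using s1(4) s2(4) by (auto simp: glue_sel)
    qed
    finally show ?thesis .
  qed
  moreover have "ends ?H (g e) = F ` ends G e" if e: "e \<in> edges G" for e
  proof (cases "e \<in> P")
    case True
    have "F ` ends G e = Inl ` f1 ` ends G e"
      unfolding image_image by (rule image_cong) (use endsP[OF True] FP in auto)
    then show ?thesis using True s1(5)[of "Some e"] by (simp add: g_def glue_sel)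
  next
    case False
    then have eQ: "e \<in> Q" using e E by auto
    have "F ` ends G e = ?m ` f2 ` ends G e"
      unfolding image_image by (rule image_cong) (use endsQ[OF eQ] FQ in auto)
    then show ?thesis using False eQ s2(5)[of "Some e"] by (simp add: g_def glue_sel)
  qed
  ultimately have "iso_via F g G ?H" by (simp add: iso_via_def bij_betw_def)
  then show ?thesis unfolding multigraph_iso_iff by blast
qed

text \<open>Edges that leave \<open>S\<close> start at \<open>a\<close> or \<open>b\<close>, so
  these two vertices suffice as interface. The second claim, from the degree of an outside vertex,
  makes the inner side with its one virtual edge smaller than \<open>G\<close>.\<close>

lemma flat_two_sep:
  assumes G: "two_connected G" and S: "good_flat G S" "block_at G S a b"
  shows "two_sep G S (verts G - S \<union> {a, b}) (edges_within G S) (edges G - edges_within G S) a b"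
    "2 \<le> card (edges G - edges_within G S)"
proof -
  note mG = two_connected_multigraph[OF G]
  have fin: "finite (edges G)" using two_connected_finite[OF G] by simp
  have S': "S \<subset> verts G" "two_connected (induced G S)" "a \<in> S" "b \<in> S" "a \<noteq> b" "attached_at G S a b"
    using S(2) by (auto simp: block_at_def)
  obtain r where r: "r \<in> verts G" "r \<notin> S" using S' by auto
  have "{e \<in> edges G. r \<in> ends G e} \<subseteq> edges G - edges_within G S"
    using r by (auto simp: edges_within_def)
  then have "card {e \<in> edges G. r \<in> ends G e} \<le> card (edges G - edges_within G S)"
    using fin by (intro card_mono) auto
  then show two: "2 \<le> card (edges G - edges_within G S)" using two_connected_degree[OF G r(1)] by simp
  show "two_sep G S (verts G - S \<union> {a, b}) (edges_within G S) (edges G - edges_within G S) a b"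
  proof
    show "edges_within G S \<noteq> {}" using two_connected_card_edges[OF S'(2)] by auto
    show "edges G - edges_within G S \<noteq> {}" using two by (intro notI) simp
    show "ends G e \<subseteq> verts G - S \<union> {a, b}" if e: "e \<in> edges G - edges_within G S" for e
    proof -
      from e have eG: "e \<in> edges G" by simp
      from multigraph_ends[OF mG eG] obtain p q where pq: "ends G e = {p, q}" "p \<noteq> q" "p \<in> verts G" "q \<in> verts G" .
      have att: "r = a \<or> r = b" if "{r, s} = {p, q}" "r \<in> S" "s \<notin> S" for r s
      proof -
        have "adj G r s" "s \<in> verts G" using that(1) eG pq by (auto simp: adj_def)
        then show ?thesis using S'(6) that(2,3) unfolding attached_at_def by blast
      qed
      have "p \<notin> S \<or> q \<notin> S" using e pq by (auto simp: edges_within_def)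
      then show ?thesis using att[of p q] att[of q p] pq by auto
    qed
  qed (use mG S' in \<open>auto simp: edges_within_def\<close>)
qed

text \<open>Construction C applied to the \<delta>-cycle itself: all but one of its edges form the
  path, and its replacement is parallel to the remaining edge.\<close>

lemma constructible_digon:
  fixes G :: "(nat, nat) pre_multigraph"
  assumes \<delta>: "2 < \<delta>" and G: "multigraph G" "card (verts G) = 2" "card (edges G) = 2"
  shows "constructible \<delta> G"
proof -
  let ?C = "cycle_multigraph \<delta>"
  have c: "constructible \<delta> ?C"
    by (rule constructible.cycle) (auto simp: multigraph_iso_def intro!: exI[of _ id])
  have tC: "two_connected ?C" using two_connected_cycle \<delta> by simp
  let ?vs = "[0..<\<delta>]" and ?es = "[0..<\<delta> - 1]"
  let ?I = "set ?vs - {hd ?vs, last ?vs}"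
  have hl: "hd ?vs = 0" "last ?vs = \<delta> - 1" using \<delta> by simp_all
  have path: "is_path ?C ?vs ?es" using \<delta> by (auto simp: is_path_def)
  have deg: "degree ?C v = 2" if "v \<in> ?I" for v
  proof -
    have v: "v \<in> verts ?C" using that by auto
    have "hamilton_cycle ?C [0..<\<delta>] [0..<\<delta>]" using hamilton_cycle_cycle \<delta> by simp
    then have "card {e \<in> edges ?C. v \<in> ends ?C e} \<le> 2" using v by (rule hamilton_cycle_degree)
    then show ?thesis using two_connected_degree[OF tC v] by (simp add: degree_def)
  qed
  define H where "H = add_parallel_edges 1 (hd ?vs) (last ?vs)
    (delete_edges (induced ?C (verts ?C - ?I)) (set ?es))"
  have con: "construction_C \<delta> ?C H"
    unfolding construction_C_def Let_def H_def
  proof (rule conjI[OF tC], rule exI[of _ ?vs], rule exI[of _ ?es], intro conjI ballI)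
    show "is_path ?C ?vs ?es" by (rule path)
    show "degree ?C v = 2" if "v \<in> ?I" for v using that by (rule deg)
  qed simp_all
  have V: "verts ?C - ?I = {0, \<delta> - 1}" using \<delta> hl by auto
  have E: "edges_within ?C {0, \<delta> - 1} - set ?es = {\<delta> - 1}"
    using \<delta> by (auto simp: edges_within_def)
  have H: "verts H = {0, \<delta> - 1}" "edges H = {Inr 0, Inl (\<delta> - 1)}"
    "ends H (Inl (\<delta> - 1)) = {\<delta> - 1, 0}" "ends H (Inr 0) = {0, \<delta> - 1}"
    using \<delta> V E hl by (simp_all add: H_def add_parallel_edges_def lessThan_Suc)
  have "multigraph H" unfolding multigraph_def H(1,2) using \<delta> H(3,4) by auto
  then have "G \<simeq>\<^sub>m H" by (rule bond_iso[OF G(1,2)]) (use \<delta> G(3) in \<open>simp_all add: H\<close>)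
  with c con show ?thesis by (rule constructible.C)
qed

text \<open>Construction B applied to two digons: one edge of each survives, and \<delta> - 2 new
  ones are added. The weight \<delta> - 1 is available because digon weights are free.\<close>

lemma constructible_bond:
  fixes G :: "(nat, nat) pre_multigraph"
  assumes \<delta>: "2 < \<delta>" and G: "multigraph G" "card (verts G) = 2" "card (edges G) = \<delta>"
  shows "constructible \<delta> G"
proof -
  define D :: "(nat, nat) pre_multigraph" where
    "D = \<lparr>verts = {0, 1}, edges = {0, 1}, ends = (\<lambda>_. {0, 1})\<rparr>"
  have D: "verts D = {0, 1}" "edges D = {0, 1}" "ends D e = {0, 1}" for e by (simp_all add: D_def)
  have mD: "multigraph D" by (simp add: multigraph_def D)
  have tD: "two_connected D" by (simp add: two_connected_iff[OF mD] D)
  have cD: "constructible \<delta> D" by (rule constructible_digon[OF \<delta> mD]) (simp_all add: D)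
  have "weight_function \<delta> D (\<lambda>_. \<delta> - 1)" by (rule digon_weight_function[OF tD]) (simp_all add: D)
  then have h: "has_weight \<delta> D 0 (\<delta> - 1)" unfolding has_weight_def by blast
  define H where "H = add_parallel_edges (\<delta> - 2) (Inl 0) (Inl 1)
    (delete_edges (glue D 0 1 D 0 1) {Inl 0, Inr 0})"
  have con: "construction_B \<delta> D D H"
    unfolding construction_B_def H_def
  proof (intro conjI bexI exI)
    show "ends D 0 = {0, 1}" "ends D 0 = {0, 1}" by (simp_all add: D)
  qed (use tD h in \<open>simp_all add: D\<close>)
  have E: "Inl ` {0 :: nat, 1} \<union> Inr ` {0 :: nat, 1} - {Inl 0, Inr 0} = {Inl 1, Inr 1}" by auto
  have H: "verts H = {Inl 0, Inl 1}" "edges H = {Inl (Inl 1), Inl (Inr 1)} \<union> Inr ` {..<\<delta> - 2}"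
    using E by (auto simp: H_def add_parallel_edges_def glue_sel D merge_def)
  have ends: "ends H e = {Inl 0, Inl 1}" if "e \<in> edges H" for e
    using that unfolding H(2) by (auto simp: H_def add_parallel_edges_def glue_sel D merge_def)
  have mH: "multigraph H" using ends by (auto simp: multigraph_def H)
  have "{Inl (Inl 1), Inl (Inr 1)} \<inter> Inr ` {..<\<delta> - 2} = {}" by auto
  then have "card (edges H) = card {Inl (Inl 1) :: (nat + nat) + nat, Inl (Inr 1)} + card (Inr ` {..<\<delta> - 2} :: ((nat + nat) + nat) set)"
    unfolding H(2) by (intro card_Un_disjoint) auto
  then have "card (edges H) = \<delta>" using \<delta> by (simp add: card_image)
  with mH have "G \<simeq>\<^sub>m H" using G by (intro bond_iso) (simp_all add: H)
  with cD cD con show ?thesis by (rule constructible.B)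
qed

text \<open>The conclusion \<open>weight_function\<close> belongs to the induction: for the sides it
  certifies the weights of the virtual edges, as construction A demands.\<close>

lemma balanced_constructible:
  fixes G :: "(nat, nat) pre_multigraph"
  assumes \<delta>: "2 < \<delta>" and "two_connected G" "balanced \<delta> G w"
  shows "weight_function \<delta> G w \<and> constructible \<delta> G"
  using assms(2,3)
proof (induction "card (edges G)" arbitrary: G w rule: less_induct)
  case less
  note G = less.prems(1) and w = less.prems(2)
  note mG = two_connected_multigraph[OF G]
  have "2 \<le> card (verts G)" by (rule two_connected_card[OF G])
  then consider (bond) "card (verts G) = 2" | (large) "3 \<le> card (verts G)" by linarith
  then show ?case
  proof cases
    case bond
    then show ?thesis
      using bond_balanced[OF G bond w \<delta>] constructible_digon[OF \<delta> mG bond] constructible_bond[OF \<delta> mG bond]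
      by blast
  next
    case large
    from good_flat_or_cycle[OF G w \<delta> large] show ?thesis
    proof
      assume "\<exists>vs es. hamilton_cycle G vs es"
      then obtain vs es where H: "hamilton_cycle G vs es" by blast
      then have "G \<simeq>\<^sub>m cycle_multigraph \<delta>"
        using hamilton_cycle_iso[OF H] hamilton_cycle_balanced(1)[OF G H w \<delta>] by simp
      then show ?thesis
        using hamilton_cycle_balanced(2)[OF G H w \<delta>] constructible.cycle by blast
    next
      assume "\<exists>S a b. good_flat G S \<and> block_at G S a b"
      then obtain S x y where S: "good_flat G S" "block_at G S x y" by blast
      define VQ P Q where "VQ = verts G - S \<union> {x, y}" and "P = edges_within G S"
        and "Q = edges G - edges_within G S"
      interpret T: two_sep G S VQ P Q x y
        unfolding VQ_def P_def Q_def by (rule flat_two_sep(1)[OF G S])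
      interpret T': two_sep G VQ S Q P x y by (rule T.swap)
      have tP: "two_connected T.sideP" by (rule T.two_connected_sideP[OF G])
      have tQ: "two_connected T.sideQ" by (rule T'.two_connected_sideP[OF G])
      have P1: "sum w P + 1 = \<delta> * (card S - 1)" using w S(1) by (simp add: balanced_def P_def)
      obtain p q where pq: "card S = p + 2" "card VQ = q + 2"
        using T.card_ge2 by (metis le_add_diff_inverse2)
      \<comment> \<open>The flat \<open>S\<close> falls 1 short of \<delta> times its rank; against
        the total this leaves the outer edges short of theirs by \<delta> - 1.\<close>
      have "sum w P + sum w Q = \<delta> * (p + q + 1)"
        using w T.sum_edges[of w] T.card_V pq by (simp add: balanced_def)
      then have "sum w Q + (\<delta> - 1) = \<delta> * (card VQ - 1)"
        using P1 pq \<delta> by (simp add: algebra_simps)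
      then have bQ: "balanced \<delta> T.sideQ (case_option (\<delta> - 1) w)"
        by (intro T'.balanced_sideP[OF G w]) simp
      have bP: "balanced \<delta> T.sideP (case_option 1 w)"
        by (rule T.balanced_sideP[OF G w _ P1]) simp
      have cE: "card (edges G) = card P + card Q" using T.E T.PQ T.fin by (simp add: card_Un_disjoint)
      \<comment> \<open>Each part has at least two edges and is replaced by one virtual edge, so
        both sides have fewer edges than \<open>G\<close>.\<close>
      have cQ: "2 \<le> card Q" using flat_two_sep(2)[OF G S] by (simp add: Q_def)
      have cP: "2 \<le> card P"
        using two_connected_card_edges[OF good_flatD(2)[OF S(1)]] by (simp add: P_def)
      \<comment> \<open>The induction hypothesis concerns natural numbers: a side is copied there,
        and the weight condition is brought back.\<close>
      have copy: "\<exists>f g (K :: (nat, nat) pre_multigraph) u. iso_via f g A K \<and> two_connected K \<and>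
          constructible \<delta> K \<and> weight_function \<delta> K u \<and> u (g None) = c None \<and> weight_function \<delta> A c"
        if A: "two_connected A" "balanced \<delta> A c" "card (edges A) < card (edges G)" "None \<in> edges A"
        for A :: "(nat, nat option) pre_multigraph" and c
      proof -
        note mA = two_connected_multigraph[OF A(1)]
        obtain f g and K :: "(nat, nat) pre_multigraph" where fg: "iso_via f g A K"
          by (rule multigraph_nat_copy[OF mA])
        have tK: "two_connected K" using iso_two_connected[OF mA fg] A(1) by simp
        let ?gi = "the_inv_into (edges A) g"
        note inv = iso_via_sym[OF mA fg]
        have "balanced \<delta> K (c \<circ> ?gi)" using iso_balanced[OF tK inv] A(2) by simp
        then have "weight_function \<delta> K (c \<circ> ?gi) \<and> constructible \<delta> K"
          using less.hyps[OF _ tK] iso_card(2)[OF mA fg] A(3) by simp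
        moreover have "?gi (g None) = None"
          using A(4) iso_simps(3)[OF mA fg] by (simp add: the_inv_into_f_f)
        ultimately show ?thesis
          using fg tK iso_weight_function[OF tK inv, of \<delta> c]
          by (intro exI[of _ f] exI[of _ g] exI[of _ K] exI[of _ "c \<circ> ?gi"]) simp
      qed
      have less: "card (edges T.sideP) < card (edges G)" "card (edges T.sideQ) < card (edges G)"
        and None: "None \<in> edges T.sideP" "None \<in> edges T.sideQ"
        using T.fin cE cP cQ by (simp_all add: card_image)
      from copy[OF tP bP less(1) None(1)] obtain f1 g1 K1 u1 where
        K1: "iso_via f1 g1 T.sideP K1" "two_connected K1" "constructible \<delta> K1" "weight_function \<delta> K1 u1"
          "u1 (g1 None) = case_option 1 w None" "weight_function \<delta> T.sideP (case_option 1 w)" by blast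
      from copy[OF tQ bQ less(2) None(2)] obtain f2 g2 K2 u2 where
        K2: "iso_via f2 g2 T.sideQ K2" "two_connected K2" "constructible \<delta> K2" "weight_function \<delta> K2 u2"
          "u2 (g2 None) = case_option (\<delta> - 1) w None" "weight_function \<delta> T.sideQ (case_option (\<delta> - 1) w)" by blast
      have u: "u1 (g1 None) = 1" "u2 (g2 None) = \<delta> - 1" using K1(5) K2(5) by simp_all
      have "weight_function \<delta> G w"
        by (rule T.glued_spade(1)[OF tP tQ K1(6) bP K2(6) bQ]) (use \<delta> in auto)
      moreover have "constructible \<delta> G"
      proof (rule constructible.A[OF K1(3) K2(3)])
        show "G \<simeq>\<^sub>m delete_edges (glue K1 (f1 x) (f1 y) K2 (f2 x) (f2 y)) {Inl (g1 None), Inr (g2 None)}"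
          by (rule T.glue_iso[OF K1(1) K2(1)])
        have 1: "ends K1 (g1 None) = {f1 x, f1 y}" "g1 None \<in> edges K1"
          using iso_simps[OF T.multigraph_sideP K1(1)] by auto
        have 2: "ends K2 (g2 None) = {f2 x, f2 y}" "g2 None \<in> edges K2"
          using iso_simps[OF T'.multigraph_sideP K2(1)] by auto
        have "has_weight \<delta> K1 (g1 None) 1" "has_weight \<delta> K2 (g2 None) (\<delta> - 1)"
          unfolding has_weight_def using K1(4) K2(4) u by blast+
        then show "construction_A \<delta> K1 K2
          (delete_edges (glue K1 (f1 x) (f1 y) K2 (f2 x) (f2 y)) {Inl (g1 None), Inr (g2 None)})"
          unfolding construction_A_def using K1(2) K2(2) 1 2 by blast
      qed
      ultimately show ?thesis by simp
    qed
  qed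
qed

lemma balanced_weight_function:
  assumes \<delta>: "2 < \<delta>" and G: "two_connected G" and w: "balanced \<delta> G w"
  shows "weight_function \<delta> G w"
proof -
  note mG = two_connected_multigraph[OF G]
  obtain f g and K :: "(nat, nat) pre_multigraph" where fg: "iso_via f g G K"
    by (rule multigraph_nat_copy[OF mG])
  note inv = iso_via_sym[OF mG fg]
  have tK: "two_connected K" using iso_two_connected[OF mG fg] G by simp
  show ?thesis
    using balanced_constructible[OF \<delta> tK] iso_balanced[OF tK inv] iso_weight_function[OF tK inv] w by blast
qed

lemma spade_obtainable:
  assumes \<delta>: "2 < \<delta>" and G: "two_connected G" "spade \<delta> G"
  shows "obtainable_from_cycles \<delta> G"
proof -
  note mG = two_connected_multigraph[OF G(1)]
  obtain w where w: "balanced \<delta> G w" using G(2) by (auto simp: spade_iff)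
  obtain f g and K :: "(nat, nat) pre_multigraph" where fg: "iso_via f g G K"
    by (rule multigraph_nat_copy[OF mG])
  note inv = iso_via_sym[OF mG fg]
  have tK: "two_connected K" using iso_two_connected[OF mG fg] G by simp
  have "constructible \<delta> K"
    using balanced_constructible[OF \<delta> tK] iso_balanced[OF tK inv] w by blast
  then show ?thesis unfolding obtainable_from_cycles_def multigraph_iso_iff using fg by blast
qed

section \<open>Constructible graphs are spade graphs\<close>

text \<open>Every vertex has degree at least two, so it meets both edges and is an end of
  each.\<close>

lemma two_edges_two_vertices:
  assumes G: "two_connected G" "card (edges G) = 2"
  shows "card (verts G) = 2"
proof -
  note mG = two_connected_multigraph[OF G(1)]
  have fin: "finite (edges G)" using two_connected_finite[OF G(1)] by simp
  obtain e where e: "e \<in> edges G" using G(2) by fastforce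
  have "verts G \<subseteq> ends G e"
  proof
    fix v assume "v \<in> verts G"
    then have "card (edges G) \<le> card {e \<in> edges G. v \<in> ends G e}"
      using two_connected_degree[OF G(1)] G(2) by simp
    then have "{e \<in> edges G. v \<in> ends G e} = edges G" using fin by (intro card_seteq) auto
    then show "v \<in> ends G e" using e by auto
  qed
  then have "verts G = ends G e" using mG e by (auto simp: multigraph_def)
  then show ?thesis using mG e by (auto simp: multigraph_def)
qed

text \<open>The weight function behind \<open>has_weight\<close> need not be the balanced one. With
  three edges the value at \<open>e\<close> is forced, so the two agree there; in a digon balanced
  weights with the desired value exist.\<close>

lemma spade_has_weight:
  assumes \<delta>: "2 < \<delta>" and G: "two_connected G" "spade \<delta> G" and e: "e \<in> edges G"
    and h: "has_weight \<delta> G e k" and k: "k \<in> {1, \<delta> - 1}"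
  shows "\<exists>w. weight_function \<delta> G w \<and> balanced \<delta> G w \<and> w e = k"
proof (cases "card (edges G) = 2")
  case True
  then show ?thesis using digon_spade[OF G(1) two_edges_two_vertices[OF G(1)] _ \<delta> e k] by simp
next
  case False
  then have E: "3 \<le> card (edges G)" using two_connected_card_edges[OF G(1)] by linarith
  obtain w where w: "weight_function \<delta> G w" "balanced \<delta> G w" using G(2) by (auto simp: spade_iff)
  obtain w' where w': "weight_function \<delta> G w'" "w' e = k" using h by (auto simp: has_weight_def)
  have "w e = w' e"
    using two_connected_delete_or_contract[OF G(1) e E] w(1) w'(1) e
    unfolding weight_function_def by metis
  then show ?thesis using w w'(2) by auto
qed

text \<open>The glued edge \<open>e\<close> plays the virtual edge, which presents each input of a
  construction as a side of its result.\<close>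

lemma side_isoI:
  assumes e: "e \<in> edges G" "ends G e = {x, y}" and f: "inj_on f (verts G)"
    and g: "inj_on g (edges G - {e})"
    and ends: "\<And>e'. e' \<in> edges G - {e} \<Longrightarrow> ends H (g e') = f ` ends G e'"
  shows "iso_via f (\<lambda>e'. if e' = e then None else Some (g e')) G
    (side H (f ` verts G) (g ` (edges G - {e})) (f x) (f y))" (is "iso_via f ?g G ?H")
proof -
  have "inj_on ?g (edges G)" using g by (auto simp: inj_on_def)
  moreover have "?g ` edges G = edges ?H" using e(1) by (auto simp: image_iff)
  moreover have "ends ?H (?g e') = f ` ends G e'" if "e' \<in> edges G" for e'
    using that e ends[of e'] by auto
  ultimately show ?thesis using f by (simp add: iso_via_def bij_betw_def)
qed

lemma iso_spade_weight:
  assumes G: "two_connected G" and iso: "iso_via f g G H"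
    and w: "weight_function \<delta> G w" "balanced \<delta> G w"
  shows "\<exists>w'. two_connected H \<and> weight_function \<delta> H w' \<and> balanced \<delta> H w' \<and> (\<forall>e\<in>edges G. w' (g e) = w e)"
proof -
  note mG = two_connected_multigraph[OF G]
  note inv = iso_via_sym[OF mG iso]
  have H: "two_connected H" using iso_two_connected[OF mG iso] G by simp
  have "\<forall>e\<in>edges G. the_inv_into (edges G) g (g e) = e"
    using iso_simps(3)[OF mG iso] by (simp add: the_inv_into_f_f)
  then show ?thesis
    using H iso_weight_function[OF H inv, of \<delta> w] iso_balanced[OF H inv, of \<delta> w] w
    by (intro exI[of _ "w \<circ> the_inv_into (edges G) g"]) simp
qed

text \<open>The last conjunct remembers the weights on one side, so that a further graph can be
  glued at one of its edges.\<close>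

lemma (in two_sep) glued_spade_exists:
  assumes tP: "two_connected sideP" and tQ: "two_connected sideQ"
    and wP: "weight_function \<delta> sideP wP" "balanced \<delta> sideP wP"
    and wQ: "weight_function \<delta> sideQ wQ" "balanced \<delta> sideQ wQ"
    and virt: "wP None + wQ None = \<delta>"
  shows "\<exists>w. two_connected G \<and> weight_function \<delta> G w \<and> balanced \<delta> G w \<and> (\<forall>e\<in>P. w e = wP (Some e))"
proof -
  let ?w = "\<lambda>e. if e \<in> P then wP (Some e) else wQ (Some e)"
  have "weight_function \<delta> G ?w" "balanced \<delta> G ?w"
    by (rule glued_spade[OF tP tQ wP wQ virt]; use PQ in auto)+
  then show ?thesis using two_connected_from_sides[OF tP tQ] by (intro exI[of _ ?w]) simp
qed

section \<open>Constructions A and B as two-separations\<close>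

locale glued_pair =
  fixes G\<^sub>1 :: "('v, 'e) pre_multigraph" and G\<^sub>2 :: "('w, 'f) pre_multigraph"
    and e\<^sub>1 e\<^sub>2 x\<^sub>1 y\<^sub>1 x\<^sub>2 y\<^sub>2
  assumes t1: "two_connected G\<^sub>1" and t2: "two_connected G\<^sub>2"
    and e1: "e\<^sub>1 \<in> edges G\<^sub>1" "ends G\<^sub>1 e\<^sub>1 = {x\<^sub>1, y\<^sub>1}"
    and e2: "e\<^sub>2 \<in> edges G\<^sub>2" "ends G\<^sub>2 e\<^sub>2 = {x\<^sub>2, y\<^sub>2}"
begin

abbreviation "m \<equiv> merge x\<^sub>1 y\<^sub>1 x\<^sub>2 y\<^sub>2"
abbreviation "H \<equiv> delete_edges (glue G\<^sub>1 x\<^sub>1 y\<^sub>1 G\<^sub>2 x\<^sub>2 y\<^sub>2) {Inl e\<^sub>1, Inr e\<^sub>2}"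

lemma mult: "multigraph G\<^sub>1" "multigraph G\<^sub>2"
  using two_connected_multigraph t1 t2 by auto

lemma neq: "x\<^sub>1 \<noteq> y\<^sub>1" "x\<^sub>2 \<noteq> y\<^sub>2"
proof -
  have "card {x\<^sub>1, y\<^sub>1} = 2" "card {x\<^sub>2, y\<^sub>2} = 2" using mult e1 e2 unfolding multigraph_def by metis+
  then show "x\<^sub>1 \<noteq> y\<^sub>1" "x\<^sub>2 \<noteq> y\<^sub>2" by auto
qed

lemma xy_in: "x\<^sub>1 \<in> verts G\<^sub>1" "y\<^sub>1 \<in> verts G\<^sub>1" "x\<^sub>2 \<in> verts G\<^sub>2" "y\<^sub>2 \<in> verts G\<^sub>2"
  using mult e1 e2 unfolding multigraph_def by blast+

lemma m_xy: "m x\<^sub>2 = Inl x\<^sub>1" "m y\<^sub>2 = Inl y\<^sub>1"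
  using neq by (auto simp: merge_def)

lemma inj_m: "inj_on m A"
  using neq by (auto simp: inj_on_def merge_def split: if_splits)

lemma verts_inter: "Inl ` verts G\<^sub>1 \<inter> m ` verts G\<^sub>2 = {Inl x\<^sub>1, Inl y\<^sub>1}"
  using xy_in m_xy[symmetric] by (auto simp: merge_def split: if_splits)

lemma edges_ne: "edges G\<^sub>1 - {e\<^sub>1} \<noteq> {}" "edges G\<^sub>2 - {e\<^sub>2} \<noteq> {}"
proof -
  have "2 \<le> card (edges G\<^sub>1)" "2 \<le> card (edges G\<^sub>2)"
    using two_connected_card_edges t1 t2 by auto
  then show "edges G\<^sub>1 - {e\<^sub>1} \<noteq> {}" "edges G\<^sub>2 - {e\<^sub>2} \<noteq> {}"
    using card_mono[of "{e\<^sub>1}" "edges G\<^sub>1"] card_mono[of "{e\<^sub>2}" "edges G\<^sub>2"] by auto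
qed

lemma ends1:
  "e \<in> edges G\<^sub>1 \<Longrightarrow> (Inl :: 'v \<Rightarrow> 'v + 'w) ` ends G\<^sub>1 e \<subseteq> Inl ` verts G\<^sub>1 \<and>
     card ((Inl :: 'v \<Rightarrow> 'v + 'w) ` ends G\<^sub>1 e) = 2"
  using mult(1) by (auto simp: multigraph_def card_image)

lemma ends2: "e \<in> edges G\<^sub>2 \<Longrightarrow> m ` ends G\<^sub>2 e \<subseteq> m ` verts G\<^sub>2 \<and> card (m ` ends G\<^sub>2 e) = 2"
  using mult(2) by (auto simp: multigraph_def card_image[OF inj_m])

lemma H_sel:
  "verts H = Inl ` verts G\<^sub>1 \<union> m ` verts G\<^sub>2"
  "edges H = Inl ` (edges G\<^sub>1 - {e\<^sub>1}) \<union> Inr ` (edges G\<^sub>2 - {e\<^sub>2})"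
  "ends H (Inl e) = Inl ` ends G\<^sub>1 e" "ends H (Inr f) = m ` ends G\<^sub>2 f"
  by (auto simp: glue_sel)

lemma multigraph_H: "multigraph H"
proof -
  have "ends H e \<subseteq> verts H \<and> card (ends H e) = 2" if "e \<in> edges H" for e
  proof (cases e)
    case (Inl f)
    then have "f \<in> edges G\<^sub>1" using that by (auto simp: glue_sel)
    then show ?thesis unfolding Inl H_sel(1,3) using ends1 by blast
  next
    case (Inr f)
    then have "f \<in> edges G\<^sub>2" using that by (auto simp: glue_sel)
    then show ?thesis unfolding Inr H_sel(1,4) using ends2 by blast
  qed
  moreover have "finite (verts H)" "finite (edges H)"
    unfolding H_sel(1,2) using mult by (auto simp: multigraph_def)
  ultimately show ?thesis by (simp add: multigraph_def)
qed

lemma two_sep_H: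
  "two_sep H (Inl ` verts G\<^sub>1) (m ` verts G\<^sub>2) (Inl ` (edges G\<^sub>1 - {e\<^sub>1})) (Inr ` (edges G\<^sub>2 - {e\<^sub>2})) (Inl x\<^sub>1) (Inl y\<^sub>1)"
proof (rule two_sep.intro)
  show "verts H = Inl ` verts G\<^sub>1 \<union> m ` verts G\<^sub>2"
    "edges H = Inl ` (edges G\<^sub>1 - {e\<^sub>1}) \<union> Inr ` (edges G\<^sub>2 - {e\<^sub>2})" by (rule H_sel)+
  show "ends H e \<subseteq> Inl ` verts G\<^sub>1" if "e \<in> Inl ` (edges G\<^sub>1 - {e\<^sub>1})" for e
  proof -
    from that obtain f where f: "e = Inl f" "f \<in> edges G\<^sub>1" by auto
    then show ?thesis using ends1[OF f(2)] by (simp add: glue_sel)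
  qed
  show "ends H e \<subseteq> m ` verts G\<^sub>2" if "e \<in> Inr ` (edges G\<^sub>2 - {e\<^sub>2})" for e
  proof -
    from that obtain f where f: "e = Inr f" "f \<in> edges G\<^sub>2" by auto
    then show ?thesis using ends2[OF f(2)] by (simp add: glue_sel)
  qed
qed (use multigraph_H verts_inter neq edges_ne in auto)

text \<open>The two inputs are the sides of the result up to isomorphism, with the glued edges as
  virtual edges, so gluing of weights applies.\<close>

lemma construction_A_spade:
  assumes w1: "weight_function \<delta> G\<^sub>1 w\<^sub>1" "balanced \<delta> G\<^sub>1 w\<^sub>1" and w2: "weight_function \<delta> G\<^sub>2 w\<^sub>2" "balanced \<delta> G\<^sub>2 w\<^sub>2"
    and virt: "w\<^sub>1 e\<^sub>1 + w\<^sub>2 e\<^sub>2 = \<delta>"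
  shows "two_connected H" "spade \<delta> H"
proof -
  interpret S: two_sep H "Inl ` verts G\<^sub>1" "m ` verts G\<^sub>2" "Inl ` (edges G\<^sub>1 - {e\<^sub>1})" "Inr ` (edges G\<^sub>2 - {e\<^sub>2})"
    "Inl x\<^sub>1" "Inl y\<^sub>1" by (rule two_sep_H)
  let ?g1 = "\<lambda>e. if e = e\<^sub>1 then None else Some (Inl e)" and ?g2 = "\<lambda>e. if e = e\<^sub>2 then None else Some (Inr e)"
  have i1: "iso_via Inl ?g1 G\<^sub>1 S.sideP"
    by (rule side_isoI[OF e1]) (auto simp: glue_sel)
  have i2: "iso_via m ?g2 G\<^sub>2 S.sideQ"
    using side_isoI[OF e2 inj_m, of Inr H] m_xy by (auto simp: glue_sel)
  obtain v\<^sub>1 where v1: "two_connected S.sideP" "weight_function \<delta> S.sideP v\<^sub>1" "balanced \<delta> S.sideP v\<^sub>1"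
    "\<forall>e\<in>edges G\<^sub>1. v\<^sub>1 (?g1 e) = w\<^sub>1 e" using iso_spade_weight[OF t1 i1 w1] by blast
  obtain v\<^sub>2 where v2: "two_connected S.sideQ" "weight_function \<delta> S.sideQ v\<^sub>2" "balanced \<delta> S.sideQ v\<^sub>2"
    "\<forall>e\<in>edges G\<^sub>2. v\<^sub>2 (?g2 e) = w\<^sub>2 e" using iso_spade_weight[OF t2 i2 w2] by blast
  have "v\<^sub>1 None = w\<^sub>1 e\<^sub>1" "v\<^sub>2 None = w\<^sub>2 e\<^sub>2" using bspec[OF v1(4) e1(1)] bspec[OF v2(4) e2(1)] by auto
  then have "v\<^sub>1 None + v\<^sub>2 None = \<delta>" using virt by simp
  from S.glued_spade_exists[OF v1(1) v2(1) v1(2,3) v2(2,3) this]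
  show "two_connected H" "spade \<delta> H" unfolding spade_iff by blast+
qed

text \<open>Construction B amounts to two applications of construction A, gluing both graphs onto a bond
  of \<open>\<delta>\<close> parallel edges.\<close>

lemma construction_B_spade:
  assumes \<delta>: "2 < \<delta>"
    and w1: "weight_function \<delta> G\<^sub>1 w\<^sub>1" "balanced \<delta> G\<^sub>1 w\<^sub>1" "w\<^sub>1 e\<^sub>1 = \<delta> - 1"
    and w2: "weight_function \<delta> G\<^sub>2 w\<^sub>2" "balanced \<delta> G\<^sub>2 w\<^sub>2" "w\<^sub>2 e\<^sub>2 = \<delta> - 1"
  shows "two_connected (add_parallel_edges (\<delta> - 2) (Inl x\<^sub>1) (Inl y\<^sub>1) H) \<and>
    spade \<delta> (add_parallel_edges (\<delta> - 2) (Inl x\<^sub>1) (Inl y\<^sub>1) H)"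
proof -
  define x :: "'v + 'w" where "x = Inl x\<^sub>1"
  define y :: "'v + 'w" where "y = Inl y\<^sub>1"
  define J where "J = add_parallel_edges (\<delta> - 2) x y H"
  define V1 :: "('v + 'w) set" where "V1 = Inl ` verts G\<^sub>1"
  define V2 where "V2 = m ` verts G\<^sub>2"
  define A :: "(('e + 'f) + nat) set" where "A = (Inl \<circ> Inl) ` (edges G\<^sub>1 - {e\<^sub>1})"
  define B :: "(('e + 'f) + nat) set" where "B = (Inl \<circ> Inr) ` (edges G\<^sub>2 - {e\<^sub>2})"
  define D :: "(('e + 'f) + nat) set" where "D = Inr ` {..<\<delta> - 2}"
  have J: "verts J = V1 \<union> V2" "edges J = A \<union> (B \<union> D)"
    by (auto simp: J_def add_parallel_edges_def glue_sel V1_def V2_def A_def B_def D_def)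
  have endsA: "ends J e = Inl ` ends G\<^sub>1 e'" if "e = Inl (Inl e')" for e e'
    using that by (simp add: J_def add_parallel_edges_def glue_sel)
  have endsB: "ends J e = m ` ends G\<^sub>2 e'" if "e = Inl (Inr e')" for e e'
    using that by (simp add: J_def add_parallel_edges_def glue_sel)
  have endsD: "ends J e = {x, y}" if "e \<in> D" for e
    using that by (auto simp: J_def add_parallel_edges_def D_def)
  have xy: "x \<noteq> y" using neq by (simp add: x_def y_def)
  have VI: "V1 \<inter> V2 = {x, y}" using verts_inter by (simp add: V1_def V2_def x_def y_def)
  have eA: "ends J e \<subseteq> V1 \<and> card (ends J e) = 2" if e: "e \<in> A" for e
  proof -
    from e obtain e' where "e = Inl (Inl e')" "e' \<in> edges G\<^sub>1" by (auto simp: A_def)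
    then show ?thesis using endsA ends1 by (simp add: V1_def)
  qed
  have eB: "ends J e \<subseteq> V2 \<and> card (ends J e) = 2" if e: "e \<in> B" for e
  proof -
    from e obtain e' where "e = Inl (Inr e')" "e' \<in> edges G\<^sub>2" by (auto simp: B_def)
    then show ?thesis using endsB ends2 by (simp add: V2_def)
  qed
  have eD: "ends J e \<subseteq> {x, y} \<and> card (ends J e) = 2" if e: "e \<in> D" for e
    using endsD[OF e] xy by simp
  have xyV: "{x, y} \<subseteq> V1" "{x, y} \<subseteq> V2" using VI by auto
  have fin: "finite V1" "finite V2" "finite A" "finite B" "finite D"
    using mult by (auto simp: V1_def V2_def A_def B_def D_def multigraph_def)
  have mJ: "multigraph J" unfolding multigraph_def J using fin eA eB eD xyV by blast
  have disj: "A \<inter> B = {}" "A \<inter> D = {}" "B \<inter> D = {}" by (auto simp: A_def B_def D_def)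
  have ne: "A \<noteq> {}" "B \<noteq> {}" using edges_ne by (auto simp: A_def B_def)
  \<comment> \<open>First separation: \<open>G\<^sub>1\<close> without its edge against the rest, so
    that the side \<open>?K\<close> holds the parallel edges and a virtual edge.\<close>
  interpret S: two_sep J V2 V1 "B \<union> D" A x y
  proof (rule two_sep.intro)
    show "ends J e \<subseteq> V2" if e: "e \<in> B \<union> D" for e
      using e eB[of e] eD[of e] xyV(2) by auto
    show "ends J e \<subseteq> V1" if "e \<in> A" for e using eA[OF that] by simp
    show "V2 \<inter> V1 = {x, y}" using VI by (simp add: Int_commute)
    show "(B \<union> D) \<inter> A = {}" using disj by auto
    show "verts J = V2 \<union> V1" "edges J = B \<union> D \<union> A" using J by auto
  qed (use mJ xy ne in auto)
  interpret S': two_sep J V1 V2 A "B \<union> D" x y by (rule S.swap)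
  let ?K = "S.sideP"
  have cD: "card (Some ` D) = \<delta> - 2" by (simp add: D_def card_image)
  \<comment> \<open>Second separation, inside \<open>?K\<close>: the new edges and the first virtual
    edge against \<open>G\<^sub>2\<close> without its edge. A second virtual edge completes the
    bond.\<close>
  interpret T: two_sep ?K "{x, y}" V2 "insert None (Some ` D)" "Some ` B" x y
  proof (rule two_sep.intro)
    show "multigraph ?K" by (rule S.multigraph_sideP)
    show "ends ?K e \<subseteq> {x, y}" if "e \<in> insert None (Some ` D)" for e using that endsD by auto
    show "ends ?K e \<subseteq> V2" if "e \<in> Some ` B" for e
    proof -
      from that obtain f where "e = Some f" "f \<in> B" by auto
      then show ?thesis using eB by simp
    qed
  qed (use xy xyV ne disj in auto)
  interpret T': two_sep ?K V2 "{x, y}" "Some ` B" "insert None (Some ` D)" x y by (rule T.swap)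
  have mx: "m x\<^sub>2 = x" "m y\<^sub>2 = y" using m_xy by (auto simp: x_def y_def)
  let ?g1 = "\<lambda>e. if e = e\<^sub>1 then None else Some ((Inl \<circ> Inl) e :: ('e + 'f) + nat)"
  let ?g2 = "\<lambda>e. if e = e\<^sub>2 then None else Some ((Some \<circ> (Inl \<circ> Inr)) e :: (('e + 'f) + nat) option)"
  have "iso_via Inl ?g1 G\<^sub>1 (side J (Inl ` verts G\<^sub>1) ((Inl \<circ> Inl) ` (edges G\<^sub>1 - {e\<^sub>1})) (Inl x\<^sub>1) (Inl y\<^sub>1))"
    by (rule side_isoI[OF e1]) (auto simp: inj_on_def endsA)
  then have i1: "iso_via Inl ?g1 G\<^sub>1 S.sideQ" by (simp add: V1_def A_def x_def y_def)
  have "iso_via m ?g2 G\<^sub>2 (side ?K (m ` verts G\<^sub>2) ((Some \<circ> (Inl \<circ> Inr)) ` (edges G\<^sub>2 - {e\<^sub>2})) (m x\<^sub>2) (m y\<^sub>2))"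
    by (rule side_isoI[OF e2 inj_m]) (auto simp: inj_on_def endsB)
  then have i2: "iso_via m ?g2 G\<^sub>2 T.sideQ" by (simp add: V2_def B_def mx image_comp o_assoc)
  obtain v\<^sub>1 where v1: "two_connected S.sideQ" "weight_function \<delta> S.sideQ v\<^sub>1" "balanced \<delta> S.sideQ v\<^sub>1"
    "\<forall>e\<in>edges G\<^sub>1. v\<^sub>1 (?g1 e) = w\<^sub>1 e" using iso_spade_weight[OF t1 i1 w1(1,2)] by blast
  obtain v\<^sub>2 where v2: "two_connected T.sideQ" "weight_function \<delta> T.sideQ v\<^sub>2" "balanced \<delta> T.sideQ v\<^sub>2"
    "\<forall>e\<in>edges G\<^sub>2. v\<^sub>2 (?g2 e) = w\<^sub>2 e" using iso_spade_weight[OF t2 i2 w2(1,2)] by blast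
  have n1: "v\<^sub>1 None = \<delta> - 1" and n2: "v\<^sub>2 None = \<delta> - 1"
    using bspec[OF v1(4) e1(1)] bspec[OF v2(4) e2(1)] w1(3) w2(3) by auto
  have cT: "card (edges T.sideP) = \<delta>"
  proof -
    have "card (Some ` insert None (Some ` D)) = card (insert None (Some ` D))"
      by (rule card_image) (rule inj_Some)
    also have "\<dots> = \<delta> - 1" using cD \<delta> fin by (simp add: card_insert_if)
    finally have "card (Some ` insert None (Some ` D)) = \<delta> - 1" .
    moreover have "None \<notin> Some ` insert None (Some ` D)" "finite (Some ` insert None (Some ` D))"
      using fin by auto
    ultimately show ?thesis using \<delta> unfolding edges_side by (subst card_insert_disjoint) auto
  qed
  have tT: "two_connected T.sideP"
    unfolding two_connected_iff[OF T.multigraph_sideP] using cT \<delta> xy by simp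
  have "card (verts T.sideP) = 2" using xy by simp
  \<comment> \<open>All bond edges weigh 1, complementary to \<delta> - 1. After
    \<open>G\<^sub>2\<close> is glued on, the virtual edge of \<open>?K\<close> still has weight 1,
    ready for \<open>G\<^sub>1\<close>.\<close>
  note b = bond_spade[OF tT this cT]
  have "1 + v\<^sub>2 None = \<delta>" using n2 \<delta> by simp
  from T.glued_spade_exists[OF tT v2(1) b v2(2,3) this]
  obtain u where u: "two_connected ?K" "weight_function \<delta> ?K u" "balanced \<delta> ?K u" "u None = 1" by auto
  have "u None + v\<^sub>1 None = \<delta>" using u(4) n1 \<delta> by simp
  from S.glued_spade_exists[OF u(1) v1(1) u(2,3) v1(2,3) this]
  have "two_connected J \<and> spade \<delta> J" unfolding spade_iff by blast
  then show ?thesis by (simp add: J_def x_def y_def)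
qed

end

section \<open>Construction C\<close>

lemma construction_C_spade:
  assumes \<delta>: "2 < \<delta>" and G: "two_connected G" "spade \<delta> G" and con: "construction_C \<delta> G H"
  shows "two_connected H \<and> spade \<delta> H"
proof -
  note mG = two_connected_multigraph[OF G(1)]
  have finG: "finite (verts G)" "finite (edges G)" using two_connected_finite[OF G(1)] by auto
  obtain w where w: "weight_function \<delta> G w" "balanced \<delta> G w" using G(2) by (auto simp: spade_iff)
  obtain vs es where path: "is_path G vs es" and len: "length es = \<delta> - 1"
    and deg: "\<forall>v\<in>set vs - {hd vs, last vs}. degree G v = 2"
    and H: "H = add_parallel_edges 1 (hd vs) (last vs)
      (delete_edges (induced G (verts G - (set vs - {hd vs, last vs}))) (set es))"
    using con unfolding construction_C_def Let_def by blast
  have lv: "length vs = \<delta>" and dv: "distinct vs" and sv: "set vs \<subseteq> verts G" and se: "set es \<subseteq> edges G"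
    and en: "\<And>i. i < \<delta> - 1 \<Longrightarrow> ends G (es ! i) = {vs ! i, vs ! Suc i}"
    using path len \<delta> by (auto simp: is_path_def)
  define x y I where "x = hd vs" and "y = last vs" and "I = set vs - {x, y}"
  define S P where "S = verts G - I" and "P = edges_within G S"
  have ne: "vs \<noteq> []" using lv \<delta> by auto
  have x0: "x = vs ! 0" and yl: "y = vs ! (\<delta> - 1)"
    using ne lv by (simp_all add: x_def y_def hd_conv_nth last_conv_nth)
  have nth_eq: "vs ! i = vs ! j \<longleftrightarrow> i = j" if "i < \<delta>" "j < \<delta>" for i j
    using nth_eq_iff_index_eq[OF dv] lv that by simp
  have xy: "x \<noteq> y" using nth_eq[of 0 "\<delta> - 1"] \<delta> x0 yl by simp
  have xyv: "x \<in> set vs" "y \<in> set vs" using ne by (simp_all add: x_def y_def)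
  have inI: "vs ! i \<in> I \<longleftrightarrow> 0 < i \<and> i < \<delta> - 1" if i: "i < \<delta>" for i
  proof -
    have "vs ! i \<in> set vs" using i lv by simp
    moreover have "vs ! i = x \<longleftrightarrow> i = 0" "vs ! i = y \<longleftrightarrow> i = \<delta> - 1"
      using nth_eq[of i 0] nth_eq[of i "\<delta> - 1"] i x0 yl \<delta> by auto
    ultimately show ?thesis using i by (auto simp: I_def)
  qed
  have es_I: "\<not> ends G e \<subseteq> S" if ees: "e \<in> set es" for e
  proof -
    obtain i where i: "i < \<delta> - 1" "e = es ! i" using ees unfolding in_set_conv_nth len by blast
    then have "vs ! i \<in> I \<or> vs ! Suc i \<in> I" using inI[of i] inI[of "Suc i"] \<delta> by auto
    then show ?thesis using en[OF i(1)] i(2) by (auto simp: S_def)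
  qed
  \<comment> \<open>The two path edges at an interior vertex are distinct and use up its
    degree.\<close>
  have I_es: "e \<in> set es" if e: "e \<in> edges G" "v \<in> ends G e" "v \<in> I" for e v
  proof -
    have "v \<in> set vs" using e(3) by (simp add: I_def)
    then obtain i where i: "i < \<delta>" "v = vs ! i" unfolding in_set_conv_nth lv by blast
    then have i': "0 < i" "i < \<delta> - 1" using inI e(3) by auto
    define a b where "a = es ! (i - 1)" and "b = es ! i"
    have ab: "a \<in> set es" "b \<in> set es" using i' len by (simp_all add: a_def b_def)
    have lt: "i - 1 < \<delta>" "i < \<delta>" "Suc i < \<delta>" "i - 1 \<noteq> i" "i - 1 \<noteq> Suc i" using i' by auto
    then have "vs ! (i - 1) \<noteq> vs ! i" "vs ! (i - 1) \<noteq> vs ! Suc i" using nth_eq by blast+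
    moreover have "ends G a = {vs ! (i - 1), vs ! i}" "ends G b = {vs ! i, vs ! Suc i}"
      using en[of "i - 1"] en[of i] i' by (simp_all add: a_def b_def)
    moreover from calculation have "a \<noteq> b" by (auto simp: doubleton_eq_iff)
    ultimately have sub: "{a, b} \<subseteq> {e \<in> edges G. v \<in> ends G e}" "card {a, b} = 2" using ab se i by auto
    have "card {e \<in> edges G. v \<in> ends G e} = 2"
      using deg e(3) by (simp add: degree_def I_def x_def y_def)
    then have "{a, b} = {e \<in> edges G. v \<in> ends G e}" using sub finG by (intro card_subset_eq) auto
    moreover have "e \<in> {e \<in> edges G. v \<in> ends G e}" using e by simp
    ultimately have "e \<in> {a, b}" by simp
    then show ?thesis using ab by auto
  qed
  have E: "edges G - set es = P"
  proof -
    have "ends G e \<subseteq> S" if "e \<in> edges G" "e \<notin> set es" for e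
      using I_es[OF that(1)] that mG by (auto simp: S_def multigraph_def)
    then show ?thesis using es_I by (auto simp: P_def edges_within_def)
  qed
  have VI: "S \<inter> set vs = {x, y}" using xyv sv by (auto simp: S_def I_def)
  have PE: "P \<inter> set es = {}" "edges G = P \<union> set es" using E se by auto
  \<comment> \<open>Without an edge off the path, \<open>x\<close> would have degree at most
    one.\<close>
  have Pne: "P \<noteq> {}"
  proof
    assume "P = {}"
    then have Ees: "edges G = set es" using PE by simp
    have "{e \<in> edges G. x \<in> ends G e} \<subseteq> {es ! 0}"
    proof
      fix e assume "e \<in> {e \<in> edges G. x \<in> ends G e}"
      then have e: "e \<in> set es" "x \<in> ends G e" using Ees by auto
      then obtain i where i: "i < \<delta> - 1" "e = es ! i" unfolding in_set_conv_nth len by blast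
      then have "vs ! 0 = vs ! i \<or> vs ! 0 = vs ! Suc i" using e(2) en x0 by auto
      then have "i = 0" using nth_eq[of 0 i] nth_eq[of 0 "Suc i"] i(1) by auto
      then show "e \<in> {es ! 0}" using i by simp
    qed
    then have "card {e \<in> edges G. x \<in> ends G e} \<le> card {es ! 0}" by (intro card_mono) auto
    then show False using two_connected_degree[OF G(1), of x] xyv sv by auto
  qed
  interpret T: two_sep G S "set vs" P "set es" x y
  proof (rule two_sep.intro)
    show "verts G = S \<union> set vs" using sv by (auto simp: S_def I_def)
    show "set es \<noteq> {}" using len \<delta> by auto
    show "ends G e \<subseteq> S" if "e \<in> P" for e using that by (simp add: P_def edges_within_def)
    show "ends G e \<subseteq> set vs" if ees: "e \<in> set es" for e
    proof -
      obtain i where i: "i < \<delta> - 1" "e = es ! i" using ees unfolding in_set_conv_nth len by blast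
      then show ?thesis using en[OF i(1)] lv by simp
    qed
  qed (use mG xy VI PE Pne in auto)
  have tP: "two_connected T.sideP" by (rule T.two_connected_sideP[OF G(1)])
  have eH: "edges_within G S - set es = P" using PE by (auto simp: P_def)
  have Hsel: "verts H = S" "edges H = Inl ` P \<union> {Inr 0}" "\<And>e. ends H (Inl e) = ends G e" "ends H (Inr 0) = {x, y}"
    using eH unfolding H add_parallel_edges_def x_def[symmetric] y_def[symmetric] I_def[symmetric] S_def[symmetric]
    by (simp_all add: lessThan_Suc)
  \<comment> \<open>The edge that replaces the path is the virtual edge of the side.\<close>
  let ?g = "case_sum Some (\<lambda>_::nat. None)"
  have iso: "iso_via id ?g H T.sideP"
    unfolding iso_via_def bij_betw_def by (auto simp: Hsel inj_on_def image_image)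
  have mH: "multigraph H"
    unfolding multigraph_def using mG PE T.fin T.xyV T.endsP xy by (auto simp: Hsel multigraph_def)
  have isoH: "H \<simeq>\<^sub>m T.sideP" using iso unfolding multigraph_iso_iff by blast
  have "spade \<delta> T.sideP"
  proof (cases "card P = 1")
    case True
    then obtain e where e: "P = {e}" by (auto simp: card_1_singleton_iff)
    \<comment> \<open>One edge off the path means that \<open>G\<close> is a \<delta>-cycle and the
      result a digon.\<close>
    have "card (edges T.sideP) = 2" "card (verts T.sideP) = 2"
      using e T.single_edge_sideP(1)[OF tP e] xy by simp_all
    then show ?thesis using digon_spade[OF tP _ _ \<delta>, of None 1] unfolding spade_iff by auto
  next
    case False
    have cP: "2 \<le> card P" using False Pne T.fin by (cases "card P") auto
    have cS: "conn G S" by (rule T.conn_VP[OF tP])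
    have VS: "verts G - S = I" using sv by (auto simp: S_def I_def)
    have conI: "conn G I"
    proof -
      let ?ws = "map (\<lambda>i. vs ! Suc i) [0..<\<delta> - 2]"
      have "set ?ws = I"
      proof (intro subset_antisym subsetI)
        fix v assume "v \<in> set ?ws"
        then show "v \<in> I" using inI by auto
      next
        fix v assume v: "v \<in> I"
        then have "v \<in> set vs" by (simp add: I_def)
        then obtain i where i: "i < \<delta>" "v = vs ! i" unfolding in_set_conv_nth lv by blast
        then have "0 < i" "i < \<delta> - 1" using inI v by auto
        then have "v = vs ! Suc (i - 1)" "i - 1 < \<delta> - 2" using i by auto
        then show "v \<in> set ?ws" by auto
      qed
      moreover have "conn G (set ?ws)"
      proof (rule conn_path)
        show "?ws \<noteq> []" using \<delta> by simp
        fix i assume i: "Suc i < length ?ws"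
        then have "ends G (es ! Suc i) = {vs ! Suc i, vs ! Suc (Suc i)}" by (intro en) simp
        moreover have "es ! Suc i \<in> edges G" using i se len by (auto intro!: subsetD[OF se] nth_mem)
        ultimately show "adj G (?ws ! i) (?ws ! Suc i)" using i by (auto simp: adj_def)
      qed
      ultimately show ?thesis by simp
    qed
    have Ine: "I \<noteq> {}" using conn_nonempty[OF conI] .
    have SV: "S \<subset> verts G" using Ine sv by (auto simp: S_def I_def)
    have att: "attached_at G S x y"
      unfolding attached_at_def
    proof (intro ballI impI)
      fix p q assume pq: "p \<in> S" "q \<in> verts G - S" "adj G p q"
      then obtain e where e: "e \<in> edges G" "ends G e = {p, q}" by (auto simp: adj_def)
      then have "e \<in> set es" using I_es[of e q] pq VS by auto
      then have "p \<in> set vs" using T.endsQ[of e] e by auto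
      then show "p = x \<or> p = y" using T.inter pq by auto
    qed
    have cV: "card (verts G) = card S + (\<delta> - 2)"
      using T.card_V distinct_card[OF dv] lv \<delta> by simp
    have S2: "2 \<le> card S" by (rule T.card_ge2)
    have wQ: "sum w (set es) \<le> (\<delta> - 1) * (\<delta> - 1)"
    proof -
      have "w e \<le> \<delta> - 1" if "e \<in> set es" for e
      proof -
        have "w e \<in> {1, \<delta> - 1}" using w(2) that se by (auto simp: balanced_def)
        then show ?thesis using \<delta> by auto
      qed
      then have "sum w (set es) \<le> card (set es) * (\<delta> - 1)"
        using sum_bounded_above[of "set es" w "\<delta> - 1"] by simp
      also have "\<dots> \<le> (\<delta> - 1) * (\<delta> - 1)" using card_length[of es] len by (intro mult_right_mono) auto
      finally show ?thesis .
    qed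
    have total: "sum w P + sum w (set es) = \<delta> * (card S + (\<delta> - 2) - 1)"
      using w(2) T.sum_edges[of w] cV by (simp add: balanced_def)
    \<comment> \<open>The \<delta> - 1 path edges weigh at most \<delta> - 1 each, so
      \<open>P\<close> keeps at least \<delta> * (card S - 1) - 1 of the total. By
      \<open>chain_bound\<close>, a set that is not two-connected stays at least 2 below \<delta> *
      (card S - 1).\<close>
    have tS: "two_connected (induced G S)"
    proof (rule ccontr)
      assume "\<not> two_connected (induced G S)"
      then have "sum w P + 2 \<le> \<delta> * (card S - 1)"
        using chain_bound[OF G(1) w(2) \<delta> SV T.xyV(1,2) xy cS att] conI VS cP by (simp add: P_def)
      moreover define s d where "s = card S - 2" and "d = \<delta> - 3"
      ultimately have "sum w P + 2 \<le> (d + 3) * (s + 1)" "sum w (set es) \<le> (d + 2) * (d + 2)"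
        "sum w P + sum w (set es) = (d + 3) * (s + d + 2)"
        using wQ total S2 \<delta> by (simp_all add: s_def d_def Suc_diff_Suc numeral_2_eq_2 numeral_3_eq_3)
      then show False by (simp add: algebra_simps)
    qed
    have "good_flat G S" using tS SV conI VS by (simp add: good_flat_iff[OF G(1)])
    then have "sum w P + 1 = \<delta> * (card S - 1)" using w(2) by (simp add: balanced_def P_def)
    then have "balanced \<delta> T.sideP (case_option 1 w)" by (intro T.balanced_sideP[OF G(1) w(2)]) simp_all
    then show ?thesis using balanced_weight_function[OF \<delta> tP] unfolding spade_iff by blast
  qed
  then show ?thesis using iso_spade[OF mH isoH tP] by blast
qed

text \<open>An isomorphic copy in the sense of \<open>multigraph_iso\<close> need not be a multigraph, since the
  endpoints of its edges may lie outside its vertex set.\<close>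

lemma constructible_spade:
  assumes \<delta>: "2 < \<delta>" and "constructible \<delta> G" "multigraph G"
  shows "two_connected G \<and> spade \<delta> G"
  using assms(2,3)
proof induction
  case (cycle G)
  have "two_connected (cycle_multigraph \<delta>)" using two_connected_cycle \<delta> by simp
  moreover from this have "spade \<delta> (cycle_multigraph \<delta>)"
    using hamilton_cycle_spade[OF _ hamilton_cycle_cycle] \<delta> by simp
  ultimately show ?case using iso_spade[OF cycle(2,1)] by blast
next
  case (A G\<^sub>1 G\<^sub>2 H G)
  from A.hyps(3) obtain e\<^sub>1 e\<^sub>2 x\<^sub>1 y\<^sub>1 x\<^sub>2 y\<^sub>2 where
    t: "two_connected G\<^sub>1" "two_connected G\<^sub>2" and e: "e\<^sub>1 \<in> edges G\<^sub>1" "e\<^sub>2 \<in> edges G\<^sub>2"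
    and h: "has_weight \<delta> G\<^sub>1 e\<^sub>1 1" "has_weight \<delta> G\<^sub>2 e\<^sub>2 (\<delta> - 1)"
    and ends: "ends G\<^sub>1 e\<^sub>1 = {x\<^sub>1, y\<^sub>1}" "ends G\<^sub>2 e\<^sub>2 = {x\<^sub>2, y\<^sub>2}"
    and H: "H = delete_edges (glue G\<^sub>1 x\<^sub>1 y\<^sub>1 G\<^sub>2 x\<^sub>2 y\<^sub>2) {Inl e\<^sub>1, Inr e\<^sub>2}"
    unfolding construction_A_def by blast
  interpret glued_pair G\<^sub>1 G\<^sub>2 e\<^sub>1 e\<^sub>2 x\<^sub>1 y\<^sub>1 x\<^sub>2 y\<^sub>2 by unfold_locales (use t e ends in auto)
  have s: "spade \<delta> G\<^sub>1" "spade \<delta> G\<^sub>2" using A.IH t two_connected_multigraph by blast+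
  obtain w\<^sub>1 where w1: "weight_function \<delta> G\<^sub>1 w\<^sub>1" "balanced \<delta> G\<^sub>1 w\<^sub>1" "w\<^sub>1 e\<^sub>1 = 1"
    using spade_has_weight[OF \<delta> t(1) s(1) e(1) h(1)] by auto
  obtain w\<^sub>2 where w2: "weight_function \<delta> G\<^sub>2 w\<^sub>2" "balanced \<delta> G\<^sub>2 w\<^sub>2" "w\<^sub>2 e\<^sub>2 = \<delta> - 1"
    using spade_has_weight[OF \<delta> t(2) s(2) e(2) h(2)] by auto
  have "w\<^sub>1 e\<^sub>1 + w\<^sub>2 e\<^sub>2 = \<delta>" using w1(3) w2(3) \<delta> by simp
  from construction_A_spade[OF w1(1,2) w2(1,2) this] have "two_connected H" "spade \<delta> H"
    unfolding H .
  then show ?case using iso_spade[OF A.prems A.hyps(4)] by blast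
next
  case (B G\<^sub>1 G\<^sub>2 H G)
  from B.hyps(3) obtain e\<^sub>1 e\<^sub>2 x\<^sub>1 y\<^sub>1 x\<^sub>2 y\<^sub>2 where
    t: "two_connected G\<^sub>1" "two_connected G\<^sub>2" and e: "e\<^sub>1 \<in> edges G\<^sub>1" "e\<^sub>2 \<in> edges G\<^sub>2"
    and h: "has_weight \<delta> G\<^sub>1 e\<^sub>1 (\<delta> - 1)" "has_weight \<delta> G\<^sub>2 e\<^sub>2 (\<delta> - 1)"
    and ends: "ends G\<^sub>1 e\<^sub>1 = {x\<^sub>1, y\<^sub>1}" "ends G\<^sub>2 e\<^sub>2 = {x\<^sub>2, y\<^sub>2}"
    and H: "H = add_parallel_edges (\<delta> - 2) (Inl x\<^sub>1) (Inl y\<^sub>1)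
      (delete_edges (glue G\<^sub>1 x\<^sub>1 y\<^sub>1 G\<^sub>2 x\<^sub>2 y\<^sub>2) {Inl e\<^sub>1, Inr e\<^sub>2})"
    unfolding construction_B_def by blast
  interpret glued_pair G\<^sub>1 G\<^sub>2 e\<^sub>1 e\<^sub>2 x\<^sub>1 y\<^sub>1 x\<^sub>2 y\<^sub>2 by unfold_locales (use t e ends in auto)
  have s: "spade \<delta> G\<^sub>1" "spade \<delta> G\<^sub>2" using B.IH t two_connected_multigraph by blast+
  obtain w\<^sub>1 where w1: "weight_function \<delta> G\<^sub>1 w\<^sub>1" "balanced \<delta> G\<^sub>1 w\<^sub>1" "w\<^sub>1 e\<^sub>1 = \<delta> - 1"
    using spade_has_weight[OF \<delta> t(1) s(1) e(1) h(1)] by auto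
  obtain w\<^sub>2 where w2: "weight_function \<delta> G\<^sub>2 w\<^sub>2" "balanced \<delta> G\<^sub>2 w\<^sub>2" "w\<^sub>2 e\<^sub>2 = \<delta> - 1"
    using spade_has_weight[OF \<delta> t(2) s(2) e(2) h(2)] by auto
  have "two_connected H" "spade \<delta> H" using construction_B_spade[OF \<delta> w1 w2] unfolding H by auto
  then show ?case using iso_spade[OF B.prems B.hyps(4)] by blast
next
  case (C G\<^sub>1 H G)
  have t: "two_connected G\<^sub>1" using C.hyps(2) by (simp add: construction_C_def)
  then have "spade \<delta> G\<^sub>1" using C.IH two_connected_multigraph by blast
  then have "two_connected H \<and> spade \<delta> H" using construction_C_spade[OF \<delta> t _ C.hyps(2)] by simp
  then show ?case using iso_spade[OF C.prems C.hyps(3)] by blast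
qed

theorem theorem2p22:
  fixes \<delta> :: nat and G :: "('v, 'e) pre_multigraph"
  assumes "\<delta> > 2" and "two_connected G"
  shows "spade \<delta> G \<longleftrightarrow> obtainable_from_cycles \<delta> G"
proof
  assume "spade \<delta> G"
  then show "obtainable_from_cycles \<delta> G" by (rule spade_obtainable[OF assms])
next
  assume "obtainable_from_cycles \<delta> G"
  then obtain H where H: "constructible \<delta> H" "G \<simeq>\<^sub>m H" unfolding obtainable_from_cycles_def by blast
  note mG = two_connected_multigraph[OF assms(2)]
  \<comment> \<open>\<open>H\<close> is given only as an isomorphic image; \<open>G\<close> passes
    the property on.\<close>
  have "multigraph H" using H(2) iso_via_multigraph[OF mG] unfolding multigraph_iso_iff by blast
  then show "spade \<delta> G" using iso_spade(2)[OF mG H(2)] constructible_spade[OF assms(1) H(1)] by blast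
qed

end
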